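(* Let $\nu$ be the Euclidean norm on $\mathbb{R}^d$, $d=m+n$. The critical locus $\mathcal{K}_2(1)\subset X$ is contained in the union of finitely many $\mathrm{SO}(d)$-orbits, and each such orbit is an $(F,H)$-transversal submanifold of $X$. Consequently $\widehat D_2\subset M_{m,n}(\mathbb{R})$ is hyperplane absolute winning.
   Context: $X=\mathrm{SL}_d(\mathbb{R})/\mathrm{SL}_d(\mathbb{Z})$ with $\mathrm{SO}(d)$ acting on the left. $\Delta_2$ is the smallest covolume of a lattice in $\mathbb{R}^d$ meeting the open Euclidean unit ball only in $0$; $\mathcal{K}_2(1)$ is the set of unimodular lattices with no nonzero vector of Euclidean norm $<\Delta_2^{-1/d}$. $F=\{\operatorname{diag}(e^{s/m}I_m,e^{-s/n}I_n):s\in\mathbb{R}\}$, $H=\{\begin{pmatrix}I_m&A\\0&I_n\end{pmatrix}:A\in M_{m,n}(\mathbb{R})\}$. A $\mathcal{C}^1$ submanifold $Z\subset X$ is $(F,H)$-transversal if at each $x\in Z$: $T_x(Fx)\not\subset T_xZ$ and $T_x(Hx)\not\subset T_xZ+T_x(Fx)$. $\widehat D_2=\bigcup_{c<1}D_2(ct^{-n/m})$, where $A\in D_2(\psi)$ means that for all large $t$ there are $\mathbf{q}\in\mathbb{Z}^n\smallsetminus\{0\},\mathbf{p}\in\mathbb{Z}^m$ with $(A\mathbf{q}-\mathbf{p},\mathbf{q})\in\operatorname{diag}(\psi(t)I_m,tI_n)B_2(\Delta_2^{-1/d})$, $B_2(r)$ the open Euclidean ball. HAW is in the sense of Broderick–Fishman–Kleinbock–Reich–Weiss.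 *)

theory Defs
  imports "HOL-Analysis.Analysis"
begin

section \<open>Lattices and the space of unimodular lattices\<close>

definition int_vecs :: "(real ^ 'k) set" where
  "int_vecs = {z. \<forall>i. z $ i \<in> \<int>}"

definition lattice_of :: "real ^ 'd ^ 'd \<Rightarrow> (real ^ 'd) set" where
  "lattice_of g = {g *v z | z. z \<in> int_vecs}"

text \<open>Every lattice is \<open>g \<int>\<^sup>d\<close> with \<open>g\<close> invertible, and its covolume is \<open>\<bar>det g\<bar>\<close>.\<close>

definition critical_det :: "'d::finite itself \<Rightarrow> real" where
  "critical_det _ = Inf {\<bar>det g\<bar> | g :: real ^ 'd ^ 'd.
      invertible g \<and> lattice_of g \<inter> ball 0 1 = {0}}"

definition critical_radius :: "'d::finite itself \<Rightarrow> real" where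
  "critical_radius d = critical_det d powr (- 1 / real CARD('d))"

definition SL_real :: "(real ^ 'd ^ 'd) set" where
  "SL_real = {g. det g = 1}"

definition SL_int :: "(real ^ 'd ^ 'd) set" where
  "SL_int = {g. det g = 1 \<and> (\<forall>i j. g $ i $ j \<in> \<int>)}"

definition SO_real :: "(real ^ 'd ^ 'd) set" where
  "SO_real = {k. orthogonal_matrix k \<and> det k = 1}"

text \<open>Points of \<open>SL\<^sub>d(\<real>)/SL\<^sub>d(\<int>)\<close> are the left cosets \<open>g SL\<^sub>d(\<int>)\<close>, as sets of matrices.\<close>

definition lat_coset :: "real ^ 'd ^ 'd \<Rightarrow> (real ^ 'd ^ 'd) set" where
  "lat_coset g = {g ** \<gamma> | \<gamma>. \<gamma> \<in> SL_int}"

definition lat_space :: "(real ^ 'd ^ 'd) set set" where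
  "lat_space = lat_coset ` SL_real"

definition lat_act :: "real ^ 'd ^ 'd \<Rightarrow> (real ^ 'd ^ 'd) set \<Rightarrow> (real ^ 'd ^ 'd) set" where
  "lat_act h x = (\<lambda>g. h ** g) ` x"

definition lat_orbit :: "(real ^ 'd ^ 'd) set \<Rightarrow> (real ^ 'd ^ 'd) set \<Rightarrow> (real ^ 'd ^ 'd) set set" where
  "lat_orbit G x = (\<lambda>h. lat_act h x) ` G"

text \<open>All representatives \<open>g\<close> of a coset \<open>x\<close> give the same lattice \<open>lattice_of g\<close>.\<close>

definition lattice_at :: "(real ^ 'd ^ 'd) set \<Rightarrow> (real ^ 'd) set" where
  "lattice_at x = (\<Union>g\<in>x. lattice_of g)"

definition critical_locus :: "(real ^ 'd ^ 'd) set set" where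
  "critical_locus = {x \<in> lat_space.
      \<not> (\<exists>v \<in> lattice_at x. v \<noteq> 0 \<and> norm v < critical_radius TYPE('d))}"


section \<open>Submanifolds and tangent spaces\<close>

definition C1_map_on :: "'a::euclidean_space set \<Rightarrow> ('a \<Rightarrow> 'a) \<Rightarrow> bool" where
  "C1_map_on U f \<longleftrightarrow> (\<exists>f' :: 'a \<Rightarrow> 'a \<Rightarrow>\<^sub>L 'a.
      (\<forall>x\<in>U. (f has_derivative blinfun_apply (f' x)) (at x)) \<and> continuous_on U f')"

definition C1_submanifold :: "nat \<Rightarrow> 'a::euclidean_space set \<Rightarrow> bool" where
  "C1_submanifold k S \<longleftrightarrow> (\<forall>p\<in>S. \<exists>U V \<phi> \<psi> W.
      open U \<and> p \<in> U \<and> open V \<and> homeomorphism U V \<phi> \<psi> \<and> C1_map_on U \<phi> \<and> C1_map_on V \<psi> \<and>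
      subspace W \<and> dim W = k \<and> \<phi> ` (S \<inter> U) = V \<inter> W)"

definition tangent_space :: "'a::euclidean_space set \<Rightarrow> 'a \<Rightarrow> 'a set" where
  "tangent_space S p = {v. \<exists>\<epsilon>>0. \<exists>\<gamma> :: real \<Rightarrow> 'a.
      \<gamma> C1_differentiable_on {-\<epsilon><..<\<epsilon>} \<and> \<gamma> ` {-\<epsilon><..<\<epsilon>} \<subseteq> S \<and>
      \<gamma> 0 = p \<and> (\<gamma> has_vector_derivative v) (at 0)}"

text \<open>
  The manifold structure of \<open>X = SL\<^sub>d(\<real>)/SL\<^sub>d(\<int>)\<close> is the one for which the covering map
  \<open>\<pi> : SL\<^sub>d(\<real>) \<rightarrow> X\<close> is a local diffeomorphism: local inverses of \<open>\<pi>\<close> serve as charts, with values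
  in \<open>SL\<^sub>d(\<real>)\<close>, itself a submanifold of the space of matrices. In the chart around \<open>g\<close> a set
  \<open>Z \<subseteq> X\<close> is given by \<open>\<pi>\<inverse>(Z) = \<Union>Z\<close>, and \<open>T\<^sub>xX\<close> is identified with \<open>T\<^sub>gSL\<^sub>d(\<real>)\<close>
  for each representative \<open>g\<close> of \<open>x\<close>.
\<close>

definition lat_submanifold :: "(real ^ 'd ^ 'd) set set \<Rightarrow> bool" where
  "lat_submanifold Z \<longleftrightarrow> Z \<subseteq> lat_space \<and> (\<exists>k. C1_submanifold k (\<Union>Z))"

definition lat_tangent :: "(real ^ 'd ^ 'd) set set \<Rightarrow> real ^ 'd ^ 'd \<Rightarrow> (real ^ 'd ^ 'd) set" where
  "lat_tangent Z g = tangent_space (\<Union>Z) g"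

text \<open>
  For closed subgroups \<open>G\<close> the orbit \<open>Gx\<close> is in general only immersed; its tangent space at
  \<open>x = \<pi>(g)\<close> is that of the leaf \<open>Gg\<close> through \<open>g\<close>.
\<close>

definition orbit_tangent :: "(real ^ 'd ^ 'd) set \<Rightarrow> real ^ 'd ^ 'd \<Rightarrow> (real ^ 'd ^ 'd) set" where
  "orbit_tangent G g = tangent_space ((\<lambda>h. h ** g) ` G) g"

definition transversal ::
    "(real ^ 'd ^ 'd) set \<Rightarrow> (real ^ 'd ^ 'd) set \<Rightarrow> (real ^ 'd ^ 'd) set set \<Rightarrow> bool" where
  "transversal F H Z \<longleftrightarrow> lat_submanifold Z \<and>
     (\<forall>x\<in>Z. \<forall>g\<in>x.
        \<not> orbit_tangent F g \<subseteq> lat_tangent Z g \<and>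
        \<not> orbit_tangent H g \<subseteq> {u + v | u v. u \<in> lat_tangent Z g \<and> v \<in> orbit_tangent F g})"


section \<open>The groups \<open>F\<close> and \<open>H\<close>\<close>

definition block_mat ::
    "real ^ 'm ^ 'm \<Rightarrow> real ^ 'n ^ 'm \<Rightarrow> real ^ 'm ^ 'n \<Rightarrow> real ^ 'n ^ 'n
      \<Rightarrow> real ^ ('m + 'n) ^ ('m + 'n)" where
  "block_mat P Q R S = (\<chi> i j.
     (case i of
        Inl a \<Rightarrow> (case j of Inl b \<Rightarrow> P $ a $ b | Inr b \<Rightarrow> Q $ a $ b)
      | Inr a \<Rightarrow> (case j of Inl b \<Rightarrow> R $ a $ b | Inr b \<Rightarrow> S $ a $ b)))"

definition block_vec :: "real ^ 'm \<Rightarrow> real ^ 'n \<Rightarrow> real ^ ('m + 'n)" where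
  "block_vec u v = (\<chi> i. (case i of Inl a \<Rightarrow> u $ a | Inr b \<Rightarrow> v $ b))"

definition F_group :: "(real ^ ('m::finite + 'n::finite) ^ ('m + 'n)) set" where
  "F_group = {block_mat (mat (exp (s / real CARD('m)))) 0 0 (mat (exp (- s / real CARD('n)))) | s.
     s \<in> UNIV}"

definition H_group :: "(real ^ ('m::finite + 'n::finite) ^ ('m + 'n)) set" where
  "H_group = {block_mat (mat 1) A 0 (mat 1) | A. A \<in> UNIV}"


section \<open>Dirichlet improvability\<close>

definition Dirichlet_set :: "(real \<Rightarrow> real) \<Rightarrow> (real ^ 'n ^ 'm) set" where
  "Dirichlet_set \<psi> = {A. \<forall>\<^sub>F t in at_top. \<exists>q\<in>int_vecs - {0}. \<exists>p\<in>int_vecs.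
      block_vec (A *v q - p) q \<in>
        (\<lambda>w. block_mat (mat (\<psi> t)) 0 0 (mat t) *v w) `
          ball 0 (critical_radius TYPE('m + 'n))}"

text \<open>
  Approximating functions are positive, so \<open>c < 1\<close> means \<open>0 < c < 1\<close>. (As the ball is symmetric,
  a negative \<open>c\<close> would act like \<open>\<bar>c\<bar>\<close>.)
\<close>

definition D_hat :: "(real ^ 'n::finite ^ 'm::finite) set" where
  "D_hat = (\<Union>c\<in>{0<..<1}.
      Dirichlet_set (\<lambda>t. c * t powr (- (real CARD('n) / real CARD('m)))))"


section \<open>The hyperplane absolute game\<close>

text \<open>
  A strategy for Alice maps the nonempty list of balls (centre, radius) chosen so far by Bob to a
  hyperplane and the width of the open neighbourhood of it that she removes.
\<close>

type_synonym 'a HA_strategy = "('a \<times> real) list \<Rightarrow> 'a set \<times> real"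

definition HA_legal_strategy :: "real \<Rightarrow> 'a::euclidean_space HA_strategy \<Rightarrow> bool" where
  "HA_legal_strategy \<beta> \<sigma> \<longleftrightarrow> (\<forall>h. h \<noteq> [] \<and> (\<forall>(x, \<rho>) \<in> set h. \<rho> > 0) \<longrightarrow>
      affine (fst (\<sigma> h)) \<and> aff_dim (fst (\<sigma> h)) = int DIM('a) - 1 \<and>
      0 < snd (\<sigma> h) \<and> snd (\<sigma> h) \<le> \<beta> * snd (last h))"

definition HA_play ::
    "real \<Rightarrow> 'a::euclidean_space HA_strategy \<Rightarrow> (nat \<Rightarrow> 'a) \<Rightarrow> (nat \<Rightarrow> real) \<Rightarrow> bool" where
  "HA_play \<beta> \<sigma> x \<rho> \<longleftrightarrow> (\<forall>i. \<rho> i > 0) \<and>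
     (\<forall>i. \<rho> (Suc i) \<ge> \<beta> * \<rho> i \<and>
        (let (L, \<epsilon>) = \<sigma> (map (\<lambda>j. (x j, \<rho> j)) [0..<Suc i])
         in cball (x (Suc i)) (\<rho> (Suc i)) \<subseteq> cball (x i) (\<rho> i) - {y. infdist y L < \<epsilon>}))"

definition HA_winning :: "real \<Rightarrow> 'a::euclidean_space set \<Rightarrow> bool" where
  "HA_winning \<beta> S \<longleftrightarrow> (\<exists>\<sigma>. HA_legal_strategy \<beta> \<sigma> \<and>
     (\<forall>x \<rho>. HA_play \<beta> \<sigma> x \<rho> \<longrightarrow> (\<Inter>i. cball (x i) (\<rho> i)) \<inter> S \<noteq> {}))"

definition HAW :: "'a::euclidean_space set \<Rightarrow> bool" where
  "HAW S \<longleftrightarrow> (\<forall>\<beta>. 0 < \<beta> \<and> \<beta> < 1 / 3 \<longrightarrow> HA_winning \<beta> S)"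

end

theory Submission
  imports Defs
begin

text \<open>
  Write \<open>r\<close> for the critical radius and call a lattice \<open>c\<close>-admissible if its nonzero vectors have norm
  at least \<open>c\<close>; admissibility for \<open>c > r\<close> is impossible at covolume 1. If \<open>M \<int>\<^sup>d\<close> is critical and \<open>Q\<close> is
  symmetric and traceless, some minimal vector \<open>v\<close> has \<open>v \<bullet> Q v < 0\<close>, because \<open>det (1 + tQ) < 1\<close> for
  small \<open>t > 0\<close> (Korkine--Zolotareff). By compactness, a lattice \<open>g M \<int>\<^sup>d\<close> with \<open>g\<close> near 1 that is
  \<open>(r - \<epsilon>)\<close>-admissible satisfies \<open>\<bar>g\<^sup>T g - 1\<bar> \<le> C \<epsilon>\<close>. For \<open>\<epsilon> = 0\<close> this isolates the \<open>SO(d)\<close>-orbits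
  in the compact critical locus, so there are finitely many. Tangent vectors of such an orbit at \<open>g\<close> are
  \<open>B g\<close> with \<open>B\<close> skew, which gives transversality.

  For the game, \<open>A\<close> belongs to the set of Dirichlet improvable matrices as soon as its trajectory
  \<open>flow s ** horo A\<close> is eventually not \<open>(r - \<epsilon>)\<close>-admissible. Applied to \<open>g = flow \<sigma> ** horo B\<close>, the
  estimate bounds \<open>\<bar>B\<bar>\<close> by a multiple of \<open>\<epsilon>\<close>: in each time interval of a fixed length the matrices to be
  avoided in Bob's ball lie in one ball of relative radius \<open>O(\<epsilon>)\<close>. Alice escapes from finitely many such
  balls by bisection.
\<close>

subsection \<open>The hyperplane absolute game\<close>

text \<open>A nearly critical moment of a trajectory is located only up to an interval of time, so
  an estimate depending on the moment would leave Alice a whole family of points per interval.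
  Rigidity bounds the displacement along \<open>H\<close> whatever the small displacement along
  \<open>F\<close> is, which leaves one point per interval. The constants are fixed in the order
  \<open>L\<close>, \<kappa>, \<epsilon>. In L turns the radius loses at most the factor \<beta>^L,
  so a block lasts a time linear in L and meets linearly many intervals, while L halvings deal with
  up to 2^L - 1 points. The scale \<kappa> then keeps Bob's ball within the range of rigidity during
  the whole block, and \<epsilon> is made small against the margin left by the halvings. Compactness
  rests on bounded representatives of admissible lattices, obtained from short independent vectors
  and from the finiteness of integer matrices of bounded nonzero determinant modulo
  \<open>SL_int\<close>.\<close>

lemma median_exists:
  fixes f :: "'i \<Rightarrow> real"
  assumes fin: "finite J" and ne: "J \<noteq> {}"
  shows "\<exists>i\<in>J. 2 * card {j\<in>J. f j < f i} \<le> card J \<and> 2 * card {j\<in>J. f i < f j} \<le> card J"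
proof -
  \<comment> \<open>\<open>T\<close> collects the indices with at least half of the values at or
    below them. Its element of least value is the median: the next smaller value lies outside
    \<open>T\<close>, so fewer than half of the values are strictly below.\<close>
  define T where "T = {i\<in>J. card J \<le> 2 * card {j\<in>J. f j \<le> f i}}"
  have argmax: "\<exists>m\<in>A. \<forall>j\<in>A. f j \<le> f m" if "A \<subseteq> J" "A \<noteq> {}" for A
    using obtains_MAX[of A f] that finite_subset[OF that(1) fin] by (metis Max_ge finite_imageI imageI)
  obtain m where m: "m \<in> J" "\<And>j. j \<in> J \<Longrightarrow> f j \<le> f m"
    using argmax[OF order_refl ne] by blast
  have "{j\<in>J. f j \<le> f m} = J" using m by auto
  then have "m \<in> T" using m by (simp add: T_def)
  then have "finite T" "T \<noteq> {}" using fin by (auto simp: T_def)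
  then obtain i where i: "i \<in> T" "\<And>j. j \<in> T \<Longrightarrow> f i \<le> f j"
    by (metis arg_min_if_finite(1) arg_min_if_finite(2) linorder_le_less_linear)
  have "card {j\<in>J. f j \<le> f i} + card {j\<in>J. f i < f j} = card J"
    using fin by (subst card_Un_disjoint[symmetric]) (auto intro!: arg_cong[where f = card])
  moreover have "card J \<le> 2 * card {j\<in>J. f j \<le> f i}" using i by (simp add: T_def)
  moreover have "2 * card {j\<in>J. f j < f i} \<le> card J"
  proof (cases "{j\<in>J. f j < f i} = {}")
    case False
    then obtain k where k: "k \<in> J" "f k < f i" "\<And>j. j \<in> J \<Longrightarrow> f j < f i \<Longrightarrow> f j \<le> f k"
      using argmax[OF _ False] by blast
    have "f j < f i \<longleftrightarrow> f j \<le> f k" if "j \<in> J" for j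
      using k(2) k(3)[OF that] by linarith
    then have "{j\<in>J. f j < f i} = {j\<in>J. f j \<le> f k}" by blast
    moreover have "k \<notin> T" using i(2)[of k] k(2) by auto
    ultimately show ?thesis using k by (simp add: T_def)
  next
    case True
    then show ?thesis by (simp only: card.empty)
  qed
  ultimately show ?thesis using i by (intro bexI[of _ i]) (auto simp: T_def)
qed

text \<open>Only the projection to the line along \<open>e\<close> matters. It maps the smaller ball
  onto an interval, which misses an open interval around \<open>a\<close> and hence, being
  connected, lies on one side of it.\<close>

lemma cball_avoiding_slab:
  fixes e :: "'a::euclidean_space"
  assumes e: "norm e = 1" and r': "0 < \<rho>'" and \<delta>: "0 < \<delta>"
    and sub: "cball x' \<rho>' \<subseteq> cball x \<rho> - {y. infdist y {y. e \<bullet> y = a} < \<delta>}"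
  shows "a + \<delta> \<le> e \<bullet> x' - \<rho>' \<or> e \<bullet> x' + \<rho>' \<le> a - \<delta>"
    and "e \<bullet> x - \<rho> \<le> e \<bullet> x' - \<rho>'" and "e \<bullet> x' + \<rho>' \<le> e \<bullet> x + \<rho>"
proof -
  have ee: "e \<bullet> e = 1" using e by (simp add: norm_eq_1)
  have far: "\<delta> \<le> \<bar>e \<bullet> y - a\<bar>" if "y \<in> cball x' \<rho>'" for y
  proof -
    have "y - (e \<bullet> y - a) *\<^sub>R e \<in> {y. e \<bullet> y = a}"
      by (simp add: inner_diff_right ee)
    then have "infdist y {y. e \<bullet> y = a} \<le> dist y (y - (e \<bullet> y - a) *\<^sub>R e)"
      by (rule infdist_le)
    also have "\<dots> = \<bar>e \<bullet> y - a\<bar>" by (simp add: dist_norm e)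
    finally show ?thesis using sub that by force
  qed
  have line: "x' + s *\<^sub>R e \<in> cball x' \<rho>'" if "\<bar>s\<bar> \<le> \<rho>'" for s
    using that by (simp add: dist_norm e)
  have far': "\<delta> \<le> \<bar>e \<bullet> x' + s - a\<bar>" if "\<bar>s\<bar> \<le> \<rho>'" for s
    using far[OF line[OF that]] by (simp add: inner_add_right ee)
  show "a + \<delta> \<le> e \<bullet> x' - \<rho>' \<or> e \<bullet> x' + \<rho>' \<le> a - \<delta>"
    using far'[of "a - e \<bullet> x'"] far'[of "\<rho>'"] far'[of "-\<rho>'"] r' \<delta> by linarith
  have inside: "\<bar>e \<bullet> x' + s - e \<bullet> x\<bar> \<le> \<rho>" if "\<bar>s\<bar> \<le> \<rho>'" for s
  proof -
    have "\<bar>e \<bullet> (x' + s *\<^sub>R e - x)\<bar> \<le> norm (x' + s *\<^sub>R e - x)"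
      using Cauchy_Schwarz_ineq2[of e "x' + s *\<^sub>R e - x"] e by simp
    also have "\<dots> \<le> \<rho>"
    proof -
      have "x' + s *\<^sub>R e \<in> cball x \<rho>" using line[OF that] sub by blast
      then show ?thesis by (simp add: dist_norm norm_minus_commute)
    qed
    finally show ?thesis by (simp add: inner_add_right inner_diff_right ee)
  qed
  show "e \<bullet> x - \<rho> \<le> e \<bullet> x' - \<rho>'" "e \<bullet> x' + \<rho>' \<le> e \<bullet> x + \<rho>"
    using inside[of "\<rho>'"] inside[of "-\<rho>'"] r' by linarith+
qed

text \<open>
  Alice plays in blocks of \<open>L\<close> turns. Bob's ball \<open>(x, \<rho>)\<close> at the start of a block determines
  \<open>n < 2 ^ L\<close> points that have to be avoided. Working with one fixed coordinate, Alice removes in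
  each turn the slab around the median of the points not yet avoided; as the next ball lies on one
  side of the slab, at least half of these points are disposed of.
\<close>

lemma HA_winning_median:
  fixes S :: "'a::euclidean_space set" and P :: "'a \<Rightarrow> real \<Rightarrow> nat \<Rightarrow> 'a"
  assumes \<beta>: "0 < \<beta>" "\<beta> < 1" and l: "0 < L" and n: "n < 2 ^ L" and w: "0 < w" "w \<le> \<beta> ^ Suc L / 2"
    and S: "\<And>y X R. \<lbrakk>\<And>b. 0 < R b; \<And>b. \<beta> ^ L * R b \<le> R (Suc b); R \<longlonglongrightarrow> 0;
        \<And>b. y \<in> cball (X b) (R b); \<And>b i. i < n \<Longrightarrow> w * R b < dist y (P (X b) (R b) i)\<rbrakk> \<Longrightarrow> y \<in> S"
  shows "HA_winning \<beta> S"
proof -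
  obtain e :: 'a where e: "norm e = 1"
    using vector_choose_size[of 1] by auto
  \<comment> \<open>The points not yet avoided: their coordinate is within
    \<open>w * \<rho>b\<close> of the projection of Bob's current ball. The margin refers to the
    radius \<open>\<rho>b\<close> at the start of the block, so it stays the same throughout the
    block.\<close>
  define J where "J = (\<lambda>(xb, \<rho>b) (x, \<rho>). {i. i < n \<and> \<bar>e \<bullet> P xb \<rho>b i - e \<bullet> x\<bar> \<le> \<rho> + w * \<rho>b})"
  define med where "med = (\<lambda>(f :: nat \<Rightarrow> real) J. SOME i. i \<in> J \<and>
     2 * card {j\<in>J. f j < f i} \<le> card J \<and> 2 * card {j\<in>J. f i < f j} \<le> card J)"
  \<comment> \<open>With no point left, the hyperplane goes through the centre of the current ball;
    this still forces Bob to shrink it.\<close>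
  define cut where "cut = (\<lambda>B B'. let f = (\<lambda>i. e \<bullet> P (fst B) (snd B) i) in
     if J B B' = {} then e \<bullet> fst B' else f (med f (J B B')))"
  \<comment> \<open>Turn \<open>length h - 1\<close> belongs to the block that began at the largest
    multiple of \<open>L\<close> not exceeding it; the ball of that turn is read off the
    history.\<close>
  define \<sigma> :: "'a HA_strategy" where "\<sigma> = (\<lambda>h.
     ({y. e \<bullet> y = cut (h ! (L * ((length h - 1) div L))) (last h)}, \<beta> * snd (last h)))"
  have finJ: "finite (J B B')" for B B' by (auto simp: J_def split_def)
  have J_le: "card (J B B') \<le> n" for B B'
    using card_mono[of "{..<n}" "J B B'"] by (auto simp: J_def split_def)
  have cutJ: "2 * card {j\<in>J B B'. e \<bullet> P (fst B) (snd B) j < cut B B'} \<le> card (J B B') \<and>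
      2 * card {j\<in>J B B'. cut B B' < e \<bullet> P (fst B) (snd B) j} \<le> card (J B B') \<and>
      (\<exists>j \<in> J B B'. cut B B' = e \<bullet> P (fst B) (snd B) j)" if ne: "J B B' \<noteq> {}" for B B'
  proof -
    define f where "f = (\<lambda>i. e \<bullet> P (fst B) (snd B) i)"
    have "med f (J B B') \<in> J B B' \<and> 2 * card {j\<in>J B B'. f j < f (med f (J B B'))} \<le> card (J B B') \<and>
       2 * card {j\<in>J B B'. f (med f (J B B')) < f j} \<le> card (J B B')"
      unfolding med_def by (rule someI_ex) (use median_exists[OF finJ ne, of f] in blast)
    moreover have "cut B B' = f (med f (J B B'))" using ne by (simp add: cut_def f_def Let_def)
    ultimately show ?thesis by (auto simp: f_def)
  qed
  have legal: "HA_legal_strategy \<beta> \<sigma>"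
  proof -
    have "e \<noteq> 0" using e by auto
    moreover have "0 < snd (last h)" if "h \<noteq> []" "\<forall>(x, \<rho>) \<in> set h. \<rho> > 0" for h :: "('a \<times> real) list"
      using last_in_set[OF that(1)] that(2) by (metis case_prod_unfold)
    ultimately show ?thesis using \<beta>
      by (auto simp: HA_legal_strategy_def \<sigma>_def affine_hyperplane aff_dim_hyperplane)
  qed
  have "(\<Inter>i. cball (x i) (\<rho> i)) \<inter> S \<noteq> {}" if play: "HA_play \<beta> \<sigma> x \<rho>" for x \<rho>
  proof -
    have pos: "0 < \<rho> i" and low: "\<beta> * \<rho> i \<le> \<rho> (Suc i)" for i
      using play by (auto simp: HA_play_def)
    define B where "B i = (x i, \<rho> i)" for i
    define blk where "blk i = L * (i div L)" for i
    have len: "length (map (\<lambda>j. (x j, \<rho> j)) [0..<Suc i]) - 1 = i" for i by simp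
    have blk_le: "blk i \<le> i" for i by (simp add: blk_def)
    have \<sigma>: "\<sigma> (map (\<lambda>j. (x j, \<rho> j)) [0..<Suc i]) = ({y. e \<bullet> y = cut (B (blk i)) (B i)}, \<beta> * \<rho> i)" for i
    proof -
      have "map (\<lambda>j. (x j, \<rho> j)) [0..<Suc i] ! blk i = B (blk i)"
        using blk_le[of i] by (subst nth_map) (auto simp del: upt_Suc simp: B_def)
      moreover have "last (map (\<lambda>j. (x j, \<rho> j)) [0..<Suc i]) = B i" by (simp add: B_def)
      ultimately show ?thesis unfolding \<sigma>_def len blk_def[symmetric] by (simp add: B_def)
    qed
    have sub: "cball (x (Suc i)) (\<rho> (Suc i)) \<subseteq>
       cball (x i) (\<rho> i) - {y. infdist y {y. e \<bullet> y = cut (B (blk i)) (B i)} < \<beta> * \<rho> i}" for i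
    proof -
      have "let (L, \<epsilon>) = \<sigma> (map (\<lambda>j. (x j, \<rho> j)) [0..<Suc i])
         in cball (x (Suc i)) (\<rho> (Suc i)) \<subseteq> cball (x i) (\<rho> i) - {y. infdist y L < \<epsilon>}"
        using play unfolding HA_play_def by blast
      then show ?thesis unfolding \<sigma> by simp
    qed
    note turn = cball_avoiding_slab[OF e pos mult_pos_pos[OF \<beta>(1) pos] sub]
    have low_pow: "\<beta> ^ k * \<rho> i \<le> \<rho> (i + k)" for i k
    proof (induction k)
      case (Suc k)
      have "\<beta> ^ Suc k * \<rho> i = \<beta> * (\<beta> ^ k * \<rho> i)" by simp
      also have "\<dots> \<le> \<beta> * \<rho> (i + k)" using Suc \<beta> by (intro mult_left_mono) auto
      also have "\<dots> \<le> \<rho> (Suc (i + k))" by (rule low)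
      finally show ?case by simp
    qed simp
    \<comment> \<open>The power \<open>Suc L\<close> in the bound on \<open>w\<close> makes the
      margin at most half of Alice's current width \<open>\<beta> * \<rho> i\<close>, even after the
      losses of radius inside the block.\<close>
    have margin: "w * \<rho> (blk i) \<le> \<beta> * \<rho> i / 2" for i
    proof -
      have d: "i = blk i + i mod L" by (simp add: blk_def)
      have m: "i mod L < L" using l by simp
      have "w * \<rho> (blk i) \<le> \<beta> * \<beta> ^ L * \<rho> (blk i) / 2"
        using mult_right_mono[OF w(2), of "\<rho> (blk i)"] pos[of "blk i"] by simp
      also have "\<dots> \<le> \<beta> * \<beta> ^ (i mod L) * \<rho> (blk i) / 2"
        using \<beta> m pos[of "blk i"] by (auto intro!: mult_mono power_decreasing)
      also have "\<dots> \<le> \<beta> * \<rho> i / 2"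
        using low_pow[of "i mod L" "blk i"] d \<beta> by simp
      finally show ?thesis .
    qed
    \<comment> \<open>The rules alone do not force the radii to tend to 0; the slabs have to do it.
      The median may lie outside the ball, but by at most half the width, so the slab still covers a
      length of at least \<open>\<beta> * \<rho> i / 2\<close> of the diameter.\<close>
    have shrink: "\<rho> (Suc i) \<le> (1 - \<beta> / 4) * \<rho> i" for i
    proof -
      have "\<bar>cut (B (blk i)) (B i) - e \<bullet> x i\<bar> \<le> \<rho> i + \<beta> * \<rho> i / 2"
      proof (cases "J (B (blk i)) (B i) = {}")
        case True
        then show ?thesis using pos[of i] \<beta> by (simp add: cut_def B_def)
      next
        case False
        then obtain j where "j \<in> J (B (blk i)) (B i)" "cut (B (blk i)) (B i) = e \<bullet> P (fst (B (blk i))) (snd (B (blk i))) j"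
          using cutJ by blast
        then have "\<bar>cut (B (blk i)) (B i) - e \<bullet> x i\<bar> \<le> \<rho> i + w * \<rho> (blk i)" "0 < n"
          by (auto simp: J_def B_def)
        then show ?thesis using margin[of i] by linarith
      qed
      then have "\<rho> (Suc i) \<le> \<rho> i - \<beta> * \<rho> i / 4"
        using turn(1)[of i] turn(2,3)[of i] by linarith
      then show ?thesis by (simp add: algebra_simps)
    qed
    have half: "2 * card (J (B (blk i)) (B (Suc i))) \<le> card (J (B (blk i)) (B i))" for i
    proof (cases "J (B (blk i)) (B i) = {}")
      case True
      have "J (B (blk i)) (B (Suc i)) \<subseteq> J (B (blk i)) (B i)"
        using turn(2,3)[of i] by (auto simp: J_def B_def abs_le_iff)
      then show ?thesis using True by simp
    next
      case False
      let ?f = "\<lambda>j. e \<bullet> P (fst (B (blk i))) (snd (B (blk i))) j"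
      let ?c = "cut (B (blk i)) (B i)"
      have lt: "w * \<rho> (blk i) < \<beta> * \<rho> i" using margin[of i] mult_pos_pos[OF \<beta>(1) pos[of i]] by linarith
      have "J (B (blk i)) (B (Suc i)) \<subseteq> {j\<in>J (B (blk i)) (B i). ?c < ?f j} \<or>
            J (B (blk i)) (B (Suc i)) \<subseteq> {j\<in>J (B (blk i)) (B i). ?f j < ?c}"
        using turn(1)[of i]
      proof
        assume "?c + \<beta> * \<rho> i \<le> e \<bullet> x (Suc i) - \<rho> (Suc i)"
        then show ?thesis using lt turn(2,3)[of i] by (intro disjI1) (auto simp: J_def B_def abs_le_iff)
      next
        assume "e \<bullet> x (Suc i) + \<rho> (Suc i) \<le> ?c - \<beta> * \<rho> i"
        then show ?thesis using lt turn(2,3)[of i] by (intro disjI2) (auto simp: J_def B_def abs_le_iff)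
      qed
      moreover have "finite {j\<in>J (B (blk i)) (B i). Q j}" for Q
        using finJ by (rule finite_subset[rotated]) blast
      ultimately have "card (J (B (blk i)) (B (Suc i))) \<le> card {j\<in>J (B (blk i)) (B i). ?c < ?f j} \<or>
            card (J (B (blk i)) (B (Suc i))) \<le> card {j\<in>J (B (blk i)) (B i). ?f j < ?c}"
        by (meson card_mono)
      then show ?thesis using cutJ[OF False] by linarith
    qed
    have empty: "J (B (L * b)) (B (L * b + L)) = {}" for b
    proof -
      have "2 ^ k * card (J (B (L * b)) (B (L * b + k))) \<le> n" if "k \<le> L" for k
        using that
      proof (induction k)
        case 0
        then show ?case using J_le by simp
      next
        case (Suc k)
        have "blk (L * b + k) = L * b" using Suc.prems by (simp add: blk_def)
        then have "2 * card (J (B (L * b)) (B (L * b + Suc k))) \<le> card (J (B (L * b)) (B (L * b + k)))"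
          using half[of "L * b + k"] by simp
        then have "2 ^ k * (2 * card (J (B (L * b)) (B (L * b + Suc k)))) \<le> 2 ^ k * card (J (B (L * b)) (B (L * b + k)))"
          by (rule mult_left_mono) simp
        also have "\<dots> \<le> n" using Suc by simp
        finally show ?case by simp
      qed
      from this[of L] have "2 ^ L * card (J (B (L * b)) (B (L * b + L))) < 2 ^ L * 1"
        using n by (simp only: mult_1_right) linarith
      then have "card (J (B (L * b)) (B (L * b + L))) = 0" by (simp only: mult_less_cancel1 less_one)
      then show ?thesis using finJ by simp
    qed
    have geo: "\<rho> i \<le> (1 - \<beta> / 4) ^ i * \<rho> 0" for i
    proof (induction i)
      case (Suc i)
      have "\<rho> (Suc i) \<le> (1 - \<beta> / 4) * \<rho> i" by (rule shrink)
      also have "\<dots> \<le> (1 - \<beta> / 4) * ((1 - \<beta> / 4) ^ i * \<rho> 0)"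
        using \<beta> by (intro mult_left_mono Suc) auto
      finally show ?case by simp
    qed simp
    have lim: "\<rho> \<longlonglongrightarrow> 0"
    proof (rule tendsto_sandwich[of "\<lambda>_. 0" _ _ "\<lambda>i. (1 - \<beta> / 4) ^ i * \<rho> 0"])
      show "(\<lambda>i. (1 - \<beta> / 4) ^ i * \<rho> 0) \<longlonglongrightarrow> 0"
        using \<beta> by (intro tendsto_mult_left_zero LIMSEQ_power_zero) auto
    qed (use pos geo in \<open>auto simp: less_imp_le\<close>)
    have "(\<Inter>i. cball (x i) (\<rho> i)) \<noteq> {}"
    proof (rule compact_nest)
      have "cball (x (Suc i)) (\<rho> (Suc i)) \<subseteq> cball (x i) (\<rho> i)" for i using sub[of i] by blast
      then show "cball (x j) (\<rho> j) \<subseteq> cball (x i) (\<rho> i)" if "i \<le> j" for i j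
        using that by (rule lift_Suc_antimono_le)
    qed (use pos in \<open>auto simp: not_less less_imp_le\<close>)
    then obtain y where y: "\<And>i. y \<in> cball (x i) (\<rho> i)" by blast
    have "y \<in> S"
    proof (rule S[of "\<lambda>b. \<rho> (L * b)" y "\<lambda>b. x (L * b)"])
      show "0 < \<rho> (L * b)" "y \<in> cball (x (L * b)) (\<rho> (L * b))" for b using pos y by auto
      show "\<beta> ^ L * \<rho> (L * b) \<le> \<rho> (L * Suc b)" for b using low_pow[of L "L * b"] by (simp add: add.commute)
      show "(\<lambda>b. \<rho> (L * b)) \<longlonglongrightarrow> 0"
        using LIMSEQ_subseq_LIMSEQ[OF lim, of "\<lambda>b. L * b"] l by (simp add: strict_mono_def comp_def)
      show "w * \<rho> (L * b) < dist y (P (x (L * b)) (\<rho> (L * b)) i)" if "i < n" for b i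
      proof -
        let ?p = "P (x (L * b)) (\<rho> (L * b)) i"
        have "\<rho> (L * b + L) + w * \<rho> (L * b) < \<bar>e \<bullet> ?p - e \<bullet> x (L * b + L)\<bar>"
          using empty[of b] that by (auto simp: J_def B_def)
        moreover have "\<bar>e \<bullet> v\<bar> \<le> norm v" for v using Cauchy_Schwarz_ineq2[of e v] e by simp
        from this[of "?p - y"] this[of "y - x (L * b + L)"]
        have "\<bar>e \<bullet> ?p - e \<bullet> y\<bar> \<le> dist y ?p" "\<bar>e \<bullet> y - e \<bullet> x (L * b + L)\<bar> \<le> \<rho> (L * b + L)"
          using y[of "L * b + L"] by (auto simp: inner_diff_right dist_norm norm_minus_commute)
        ultimately show ?thesis by linarith
      qed
    qed
    then show ?thesis using y by blast
  qed
  then show ?thesis using legal unfolding HA_winning_def by blast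
qed

subsection \<open>The critical determinant\<close>

text \<open>
  The change-of-variables formula of the library is stated for well-ordered index types. This copy
  of a finite type carries an arbitrary well-order.
\<close>

typedef 'a ordered = "UNIV :: 'a set" ..

lemma bij_Rep_ordered: "bij Rep_ordered"
  by (rule o_bij[where g = Abs_ordered]) (auto simp: fun_eq_iff Rep_ordered_inverse Abs_ordered_inverse)

instance ordered :: (finite) finite
proof
  show "finite (UNIV :: 'a ordered set)"
    using bij_betw_finite[OF bij_Rep_ordered] finite_class.finite_UNIV[where 'a = 'a] by blast
qed

definition ordered_rank :: "'a::finite ordered \<Rightarrow> nat" where
  "ordered_rank = (SOME f. inj f)"

lemma inj_ordered_rank: "inj (ordered_rank :: 'a::finite ordered \<Rightarrow> nat)"
proof -
  have "\<exists>f :: 'a ordered \<Rightarrow> nat. inj f"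
    using finite_imp_inj_to_nat_seg[of "UNIV :: 'a ordered set"] by auto
  then show ?thesis unfolding ordered_rank_def by (rule someI_ex[of inj])
qed

instantiation ordered :: (finite) wellorder
begin

definition less_eq_ordered :: "'a ordered \<Rightarrow> 'a ordered \<Rightarrow> bool" where
  "less_eq_ordered a b \<longleftrightarrow> ordered_rank a \<le> ordered_rank b"

definition less_ordered :: "'a ordered \<Rightarrow> 'a ordered \<Rightarrow> bool" where
  "less_ordered a b \<longleftrightarrow> ordered_rank a < ordered_rank b"

instance
proof
  fix P :: "'a ordered \<Rightarrow> bool" and a
  assume step: "\<And>x. (\<And>y. y < x \<Longrightarrow> P y) \<Longrightarrow> P x"
  show "P a"
  proof (induction a rule: measure_induct_rule[of ordered_rank])
    case (less x)
    show ?case by (rule step, rule less) (simp only: less_ordered_def)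
  qed
next
  fix x y :: "'a ordered"
  assume "x \<le> y" "y \<le> x"
  then have "ordered_rank x = ordered_rank y" by (simp add: less_eq_ordered_def)
  then show "x = y" by (rule injD[OF inj_ordered_rank])
next
  fix x y z :: "'a ordered"
  show "x < y \<longleftrightarrow> x \<le> y \<and> \<not> y \<le> x" "x \<le> x" "x \<le> y \<or> y \<le> x"
    unfolding less_eq_ordered_def less_ordered_def by linarith+
  show "x \<le> z" if "x \<le> y" "y \<le> z"
    using that unfolding less_eq_ordered_def by (rule order_trans)
qed

end

text \<open>Conjugation by \<open>f\<close> turns permutations of one index type into permutations
  of the other with the same sign, so the two Leibniz sums agree term by term.\<close>

lemma det_reindex:
  fixes A :: "real ^ 'a ^ 'a" and f :: "'b::finite \<Rightarrow> 'a::finite"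
  assumes f: "bij f"
  shows "det (\<chi> i j. A $ f i $ f j) = det A"
proof -
  let ?m = "map_permutation UNIV f"
  have inj: "inj_on f UNIV" using f by (simp add: bij_is_inj)
  have bb: "bij_betw ?m {p. p permutes UNIV} {p. p permutes UNIV}"
  proof (rule bij_betwI[where g = "map_permutation UNIV (inv f)"])
    show "?m \<in> {p. p permutes UNIV} \<rightarrow> {p. p permutes UNIV}"
      by (intro Pi_I CollectI map_permutation_permutes[OF f]) (simp only: mem_Collect_eq)
    show "map_permutation UNIV (inv f) \<in> {p. p permutes UNIV} \<rightarrow> {p. p permutes UNIV}"
      by (intro Pi_I CollectI map_permutation_permutes[OF bij_imp_bij_inv[OF f]]) (simp only: mem_Collect_eq)
    show "map_permutation UNIV (inv f) (?m p) = p" if "p \<in> {p. p permutes UNIV}" for p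
      by (rule map_permutation_compose_inv[OF f]) (use that f in \<open>simp_all add: bij_is_inj\<close>)
    show "?m (map_permutation UNIV (inv f) p) = p" if "p \<in> {p. p permutes UNIV}" for p
      by (rule map_permutation_compose_inv[OF bij_imp_bij_inv[OF f]])
        (use that f in \<open>simp_all add: bij_is_surj surj_f_inv_f\<close>)
  qed
  have "of_int (sign p) * (\<Prod>i\<in>UNIV. A $ f i $ f (p i)) =
        of_int (sign (?m p)) * (\<Prod>i\<in>UNIV. A $ i $ ?m p i)" if "p permutes UNIV" for p
  proof -
    have "(\<Prod>i\<in>UNIV. A $ i $ ?m p i) = (\<Prod>i\<in>UNIV. A $ f i $ ?m p (f i))"
      by (rule prod.reindex_bij_betw[OF f, of "\<lambda>i. A $ i $ ?m p i", symmetric])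
    also have "\<dots> = (\<Prod>i\<in>UNIV. A $ f i $ f (p i))"
      by (simp only: map_permutation_apply[OF inj UNIV_I])
    finally show ?thesis by (simp only: sign_map_permutation[OF inj that finite])
  qed
  then have "det (\<chi> i j. A $ f i $ f j) =
      (\<Sum>p\<in>{p. p permutes UNIV}. of_int (sign (?m p)) * (\<Prod>i\<in>UNIV. A $ i $ ?m p i))"
    unfolding det_def by (intro sum.cong) (simp_all only: vec_lambda_beta mem_Collect_eq)
  also have "\<dots> = det A"
    unfolding det_def
    by (rule sum.reindex_bij_betw[OF bb, of "\<lambda>p. of_int (sign p) * (\<Prod>i\<in>UNIV. A $ i $ p i)"])
  finally show ?thesis .
qed

section \<open>Admissible matrices, a packing bound and positivity of the critical
  determinant\<close>

definition admissible :: "real \<Rightarrow> real ^ 'd ^ 'd \<Rightarrow> bool" where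
  "admissible c M \<longleftrightarrow> (\<forall>z\<in>int_vecs. z \<noteq> 0 \<longrightarrow> c \<le> norm (M *v z))"

lemma admissibleD: "admissible c M \<Longrightarrow> z \<in> int_vecs \<Longrightarrow> z \<noteq> 0 \<Longrightarrow> c \<le> norm (M *v z)"
  by (simp add: admissible_def)

lemma int_vecs_zero [simp]: "0 \<in> int_vecs"
  and int_vecs_diff: "a \<in> int_vecs \<Longrightarrow> b \<in> int_vecs \<Longrightarrow> a - b \<in> int_vecs"
  by (auto simp: int_vecs_def)

text \<open>The packing argument: integer translates of \<open>S\<close> are disjoint, since a
  common point would give a nonzero lattice vector of norm below 1. \<open>Suc k ^ CARD('d)\<close>
  of them fit into a cube of side \<open>Suc k + 2 * \<rho>\<close>, and \<open>k\<close> tends to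
  infinity.\<close>

lemma measure_linear_preimage_ball_le_1:
  fixes M :: "real ^ 'd ^ 'd::finite"
  assumes adm: "admissible 1 M" and M: "det M \<noteq> 0"
    and S: "S = {x. norm (M *v x) < 1 / 2}"
  shows "S \<in> lmeasurable" "measure lebesgue S \<le> 1"
proof -
  obtain B where B: "0 < B" "\<And>x. B * norm x \<le> norm (M *v x)"
    using linear_inj_bounded_below_pos[OF matrix_vector_mul_linear inj_matrix_vector_mult, of M] M
    unfolding invertible_det_nz by blast
  define \<rho> where "\<rho> = 1 / B"
  have \<rho>: "\<bar>x $ i\<bar> \<le> \<rho>" if "x \<in> S" for x i
  proof -
    have "B * norm x \<le> 1" using B(2)[of x] that by (simp add: S)
    then have "norm x \<le> \<rho>" using B(1) by (simp add: \<rho>_def field_simps)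
    then show ?thesis using component_le_norm_cart[of x i] by linarith
  qed
  have \<rho>0: "0 < \<rho>" using B by (simp add: \<rho>_def)
  have "open S"
    unfolding S by (intro open_Collect_less continuous_intros)
  moreover have "bounded S"
  proof -
    have "S \<subseteq> cbox (\<chi> i. - \<rho>) (\<chi> i. \<rho>)"
    proof
      fix x assume "x \<in> S"
      then have "- \<rho> \<le> x $ i \<and> x $ i \<le> \<rho>" for i using \<rho>[of x i] by (simp add: abs_le_iff minus_le_iff)
      then show "x \<in> cbox (\<chi> i. - \<rho>) (\<chi> i. \<rho>)" by (simp add: mem_box_cart)
    qed
    then show ?thesis using bounded_cbox bounded_subset by blast
  qed
  ultimately show meas: "S \<in> lmeasurable" by (simp add: lmeasurable_open)
  have "measure lebesgue S \<le> (1 + 2 * \<rho> / Suc k) ^ CARD('d)" for k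
  proof -
    define F where "F = PiE (UNIV :: 'd set) (\<lambda>_. {..<Suc k})"
    define zv :: "('d \<Rightarrow> nat) \<Rightarrow> real ^ 'd" where "zv f = (\<chi> i. real (f i))" for f
    have F: "finite F" "card F = Suc k ^ CARD('d)"
      by (auto simp: F_def card_PiE intro!: finite_PiE)
    have zint: "zv f \<in> int_vecs" for f by (simp add: zv_def int_vecs_def)
    have inj: "f = g" if "zv f = zv g" for f g
      using that by (auto simp: zv_def vec_eq_iff)
    have disj: "disjoint_family_on (\<lambda>f. (+) (zv f) ` S) F"
    proof (clarsimp simp: disjoint_family_on_def)
      fix f g :: "'d \<Rightarrow> nat" assume "f \<noteq> g"
      then have ne: "zv f - zv g \<noteq> 0" using inj by auto
      have False if "x \<in> S" "y \<in> S" "zv f + x = zv g + y" for x y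
      proof -
        have "zv f - zv g = y - x" using that(3) by (simp add: algebra_simps)
        then have "1 \<le> norm (M *v y - M *v x)"
          using admissibleD[OF adm int_vecs_diff[OF zint zint] ne]
          by (simp add: matrix_vector_mult_diff_distrib)
        also have "\<dots> \<le> norm (M *v y) + norm (M *v x)" by (rule norm_triangle_ineq4)
        finally show False using that by (simp add: S)
      qed
      then show "(+) (zv f) ` S \<inter> (+) (zv g) ` S = {}" by blast
    qed
    let ?U = "\<Union>f\<in>F. (+) (zv f) ` S"
    have tm: "(+) (zv f) ` S \<in> lmeasurable" for f using meas by (rule measurable_translation)
    have "measure lebesgue ?U = (\<Sum>f\<in>F. measure lebesgue ((+) (zv f) ` S))"
    proof (rule measure_finite_Union[OF F(1) _ disj])
      show "(\<lambda>f. (+) (zv f) ` S) ` F \<subseteq> sets lebesgue" using fmeasurableD[OF tm] by blast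
      show "emeasure lebesgue ((+) (zv f) ` S) \<noteq> \<infinity>" for f
        using fmeasurableD2[OF tm] by (simp only: infinity_ennreal_def not_False_eq_True)
    qed
    then have U: "measure lebesgue ?U = real (Suc k) ^ CARD('d) * measure lebesgue S"
      by (simp add: measure_translation F)
    let ?C = "cbox (\<chi> i. - \<rho>) (\<chi> i. real (Suc k) + \<rho>) :: (real ^ 'd) set"
    have "zv f + x \<in> ?C" if "f \<in> F" "x \<in> S" for f x
    proof -
      have "f i \<le> k" for i using that(1) by (auto simp: F_def PiE_def Pi_def less_Suc_eq_le)
      then have "real (f i) \<le> real k" for i by simp
      then have "- \<rho> \<le> real (f i) + x $ i \<and> real (f i) + x $ i \<le> real (Suc k) + \<rho>" for i
        using \<rho>[OF that(2), of i] by (smt (verit) of_nat_0_le_iff of_nat_Suc)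
      then show ?thesis by (simp add: mem_box_cart zv_def)
    qed
    then have "?U \<subseteq> ?C" by blast
    moreover have "?U \<in> lmeasurable" using F(1) tm by (intro fmeasurable.finite_UN) auto
    ultimately have "measure lebesgue ?U \<le> measure lebesgue ?C"
      by (intro measure_mono_fmeasurable) (auto simp: fmeasurableD)
    also have "\<dots> = (real (Suc k) + 2 * \<rho>) ^ CARD('d)"
    proof -
      have "- \<rho> \<le> real (Suc k) + \<rho>" using \<rho>0 by simp
      then have "?C \<noteq> {}" by (simp add: interval_ne_empty_cart)
      then have "measure lborel ?C = (real (Suc k) + 2 * \<rho>) ^ CARD('d)"
        by (subst content_cbox_cart) (simp_all add: algebra_simps)
      then show ?thesis by simp
    qed
    finally have "real (Suc k) ^ CARD('d) * measure lebesgue S \<le> (real (Suc k) + 2 * \<rho>) ^ CARD('d)"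
      using U by simp
    then have "measure lebesgue S \<le> (real (Suc k) + 2 * \<rho>) ^ CARD('d) / real (Suc k) ^ CARD('d)"
      by (simp add: field_simps)
    also have "\<dots> = (1 + 2 * \<rho> / Suc k) ^ CARD('d)"
      by (simp add: power_divide[symmetric] add_divide_distrib)
    finally show ?thesis .
  qed
  moreover have "(\<lambda>k. (1 + 2 * \<rho> / real (Suc k)) ^ CARD('d)) \<longlonglongrightarrow> (1 + 0) ^ CARD('d)"
    by (intro tendsto_intros LIMSEQ_Suc[OF lim_const_over_n])
  ultimately show "measure lebesgue S \<le> 1"
    by (intro LIMSEQ_le_const[where X = "\<lambda>k. (1 + 2 * \<rho> / real (Suc k)) ^ CARD('d)"]) auto
qed

lemma content_ball_le_det:
  fixes M :: "((real, 'd::{finite,wellorder}) vec, 'd) vec"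
  assumes adm: "admissible 1 M" and M: "det M \<noteq> 0"
  shows "measure lebesgue (ball (0 :: (real, 'd) vec) (1 / 2)) \<le> \<bar>det M\<bar>"
proof -
  define S where "S = {x. norm (M *v x) < 1 / 2}"
  note S = measure_linear_preimage_ball_le_1[OF adm M S_def]
  have "surj ((*v) M)"
    using M unfolding invertible_det_nz[symmetric] invertible_eq_bij by (rule bij_is_surj)
  then have im: "(*v) M ` S = ball 0 (1 / 2)"
  proof (intro equalityI subsetI)
    fix y :: "(real, 'd) vec" assume "y \<in> ball 0 (1 / 2)"
    moreover obtain x where "y = M *v x" using \<open>surj ((*v) M)\<close> by (rule surjE)
    ultimately show "y \<in> (*v) M ` S" by (auto simp: S_def)
  qed (auto simp: S_def)
  have "measure lebesgue (ball (0 :: (real, 'd) vec) (1 / 2)) = \<bar>det M\<bar> * measure lebesgue S"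
    using measure_linear_image[OF matrix_vector_mul_linear S(1), of M] im by simp
  also have "\<dots> \<le> \<bar>det M\<bar> * 1" using S(2) by (intro mult_left_mono) auto
  finally show ?thesis by simp
qed

text \<open>The bound is the volume of a ball of radius 1/2: balls of that radius around the lattice
  points do not overlap. It keeps the infimum \<open>critical_det\<close> away from 0.\<close>

lemma admissible_det_bounded_below:
  "\<exists>\<delta>>0. \<forall>M :: real ^ 'd ^ 'd::finite. admissible 1 M \<longrightarrow> det M \<noteq> 0 \<longrightarrow> \<delta> \<le> \<bar>det M\<bar>"
proof (intro exI conjI allI impI)
  show "0 < measure lebesgue (ball (0 :: real ^ 'd ordered) (1 / 2))"
    using content_ball_pos[of "1 / 2" "0 :: real ^ 'd ordered"] by simp
next
  fix M :: "real ^ 'd ^ 'd"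
  assume adm: "admissible 1 M" and M: "det M \<noteq> 0"
  define f where "f = (Rep_ordered :: 'd ordered \<Rightarrow> 'd)"
  have f: "bij f" unfolding f_def by (rule bij_Rep_ordered)
  define M' where "M' = (\<chi> i j. M $ f i $ f j)"
  have det: "det M' = det M" unfolding M'_def by (rule det_reindex[OF f])
  define g :: "real ^ 'd ordered \<Rightarrow> real ^ 'd" where "g z = (\<chi> i. z $ inv f i)" for z
  have inv1: "inv f (f i) = i" for i using f by (simp add: bij_is_inj)
  have comp: "(M' *v z) $ i = (M *v g z) $ f i" for z i
  proof -
    have "(M *v g z) $ f i = (\<Sum>j\<in>UNIV. M $ f i $ j * z $ inv f j)"
      by (simp add: matrix_vector_mult_def g_def)
    also have "\<dots> = (\<Sum>j\<in>UNIV. M $ f i $ f j * z $ inv f (f j))"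
      by (rule sum.reindex_bij_betw[OF f, of "\<lambda>j. M $ f i $ j * z $ inv f j", symmetric])
    finally show ?thesis by (simp add: matrix_vector_mult_def M'_def inv1)
  qed
  have nrm: "norm (M' *v z) = norm (M *v g z)" for z
    unfolding norm_vec_def L2_set_def comp
    by (rule arg_cong[where f = sqrt]) (rule sum.reindex_bij_betw[OF f, of "\<lambda>i. (norm ((M *v g z) $ i))\<^sup>2"])
  have "admissible 1 M'"
    unfolding admissible_def
  proof (intro ballI impI)
    fix z :: "real ^ 'd ordered" assume z: "z \<in> int_vecs" "z \<noteq> 0"
    obtain i where "z $ i \<noteq> 0" using z(2) by (auto simp: vec_eq_iff)
    then have "g z $ f i \<noteq> 0" by (simp add: g_def inv1)
    then have "g z \<noteq> 0" by auto
    moreover have "g z \<in> int_vecs" using z(1) by (simp add: int_vecs_def g_def)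
    ultimately show "1 \<le> norm (M' *v z)"
      unfolding nrm using admissibleD[OF adm] by blast
  qed
  from content_ball_le_det[OF this] show "measure lebesgue (ball (0 :: real ^ 'd ordered) (1 / 2)) \<le> \<bar>det M\<bar>"
    using M det by simp
qed

lemma lattice_of_Int_ball_iff_admissible:
  fixes g :: "real ^ 'd ^ 'd::finite"
  assumes "invertible g"
  shows "lattice_of g \<inter> ball 0 1 = {0} \<longleftrightarrow> admissible 1 g"
proof -
  have "0 \<in> lattice_of g" by (auto simp: lattice_of_def intro!: exI[of _ 0])
  moreover have nz: "g *v z = 0 \<longleftrightarrow> z = 0" for z
    using assms inj_matrix_vector_mult[of g] by (metis injD matrix_vector_mult_0_right)
  ultimately show ?thesis
  proof (intro iffI)
    assume "0 \<in> lattice_of g" and eq: "lattice_of g \<inter> ball 0 1 = {0}"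
    show "admissible 1 g"
      unfolding admissible_def
    proof (intro ballI impI)
      fix z :: "real ^ 'd" assume "z \<in> int_vecs" "z \<noteq> 0"
      then have "g *v z \<in> lattice_of g" "g *v z \<noteq> 0" by (auto simp: lattice_of_def nz)
      then have "g *v z \<notin> ball 0 1" using eq by blast
      then show "1 \<le> norm (g *v z)" by simp
    qed
  next
    assume "0 \<in> lattice_of g" and adm: "admissible 1 g"
    have "v = 0" if v: "v \<in> lattice_of g" "v \<in> ball 0 1" for v
    proof -
      obtain z where z: "v = g *v z" "z \<in> int_vecs" using v(1) by (auto simp: lattice_of_def)
      then have "z = 0" using admissibleD[OF adm z(2)] v(2) by force
      then show ?thesis using z by simp
    qed
    then show "lattice_of g \<inter> ball 0 1 = {0}" using \<open>0 \<in> lattice_of g\<close> by auto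
  qed
qed

lemma critical_det_eq_Inf:
  "critical_det TYPE('d::finite) = Inf ((\<lambda>g. \<bar>det g\<bar>) ` {g :: real ^ 'd ^ 'd. det g \<noteq> 0 \<and> admissible 1 g})"
proof -
  have "{\<bar>det g\<bar> | g :: real ^ 'd ^ 'd. invertible g \<and> lattice_of g \<inter> ball 0 1 = {0}} =
    (\<lambda>g. \<bar>det g\<bar>) ` {g :: real ^ 'd ^ 'd. det g \<noteq> 0 \<and> admissible 1 g}"
    unfolding image_Collect
    by (intro Collect_cong ex_cong1 conj_cong refl)
      (rule invertible_det_nz, rule lattice_of_Int_ball_iff_admissible, simp add: invertible_det_nz)
  then show ?thesis unfolding critical_det_def by (rule arg_cong)
qed

lemma det_scaleR:
  fixes A :: "real ^ 'd ^ 'd::finite"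
  shows "det (c *\<^sub>R A) = c ^ CARD('d) * det A"
proof -
  have "c *\<^sub>R A = (\<chi> i. c *s (A $ i))" by (simp add: vec_eq_iff)
  then show ?thesis using det_rows_mul[of "\<lambda>_. c" "\<lambda>i. A $ i"] by simp
qed

lemma critical_det_le:
  fixes M :: "real ^ 'd ^ 'd::finite"
  assumes "admissible 1 M" "det M \<noteq> 0"
  shows "critical_det TYPE('d) \<le> \<bar>det M\<bar>"
  unfolding critical_det_eq_Inf using assms by (intro cINF_lower bdd_belowI[of _ 0]) auto

lemma critical_det_pos: "0 < critical_det TYPE('d::finite)"
proof -
  obtain \<delta> where \<delta>: "0 < \<delta>"
    "\<And>M :: real ^ 'd ^ 'd. admissible 1 M \<Longrightarrow> det M \<noteq> 0 \<Longrightarrow> \<delta> \<le> \<bar>det M\<bar>"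
    using admissible_det_bounded_below[where 'd = 'd] by metis
  \<comment> \<open>The integer lattice shows that the infimum is taken over a nonempty set, as a
    lower bound for \<open>Inf\<close> requires.\<close>
  have "admissible 1 (mat 1 :: real ^ 'd ^ 'd)"
    unfolding admissible_def
  proof (intro ballI impI)
    fix z :: "real ^ 'd" assume z: "z \<in> int_vecs" "z \<noteq> 0"
    then obtain i where "z $ i \<noteq> 0" by (auto simp: vec_eq_iff)
    then have "1 \<le> \<bar>z $ i\<bar>" using z(1) by (auto simp: int_vecs_def Ints_nonzero_abs_ge1)
    also have "\<dots> \<le> norm z" by (rule component_le_norm_cart)
    finally show "1 \<le> norm (mat 1 *v z)" by simp
  qed
  then have "(mat 1 :: real ^ 'd ^ 'd) \<in> {g. det g \<noteq> 0 \<and> admissible 1 g}" by simp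
  then have "{g :: real ^ 'd ^ 'd. det g \<noteq> 0 \<and> admissible 1 g} \<noteq> {}" by blast
  then have "\<delta> \<le> critical_det TYPE('d)"
    unfolding critical_det_eq_Inf using \<delta>(2) by (intro cINF_greatest) simp_all
  then show ?thesis using \<delta>(1) by linarith
qed

lemma critical_radius_pos: "0 < critical_radius TYPE('d::finite)"
  using critical_det_pos[where 'd = 'd] by (simp add: critical_radius_def)

lemma critical_det_radius: "critical_det TYPE('d::finite) * critical_radius TYPE('d) ^ CARD('d) = 1"
proof -
  have "critical_radius TYPE('d) ^ CARD('d) = critical_radius TYPE('d) powr real CARD('d)"
    using critical_radius_pos[where 'd = 'd] by (simp add: powr_realpow)
  also have "\<dots> = critical_det TYPE('d) powr - 1"
    by (simp add: critical_radius_def powr_powr)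
  finally show ?thesis using critical_det_pos[where 'd = 'd] by (simp add: powr_minus_divide)
qed

text \<open>Rescaling by \<open>1 / c\<close>. Keeping the determinant in the bound is what lets
  \<open>critical_lattice_extreme\<close> profit from a determinant only slightly below 1.\<close>

lemma admissible_power_le_det:
  fixes M :: "real ^ 'd ^ 'd::finite"
  assumes adm: "admissible c M" and M: "det M \<noteq> 0" and c: "0 < c"
  shows "c ^ CARD('d) \<le> \<bar>det M\<bar> * critical_radius TYPE('d) ^ CARD('d)"
proof -
  let ?r = "critical_radius TYPE('d)"
  have "admissible 1 ((1 / c) *\<^sub>R M)"
    using adm c by (auto simp: admissible_def scaleR_matrix_vector_assoc[symmetric] field_simps)
  moreover have det: "det ((1 / c) *\<^sub>R M) = det M / c ^ CARD('d)"
    by (simp add: det_scaleR power_divide)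
  ultimately have "critical_det TYPE('d) \<le> \<bar>det M\<bar> / c ^ CARD('d)"
    using critical_det_le[of "(1 / c) *\<^sub>R M"] M c by (simp add: abs_divide)
  then have "critical_det TYPE('d) * ?r ^ CARD('d) \<le> \<bar>det M\<bar> / c ^ CARD('d) * ?r ^ CARD('d)"
    using critical_radius_pos[where 'd = 'd] by (intro mult_right_mono) auto
  then show ?thesis using c by (simp add: critical_det_radius field_simps)
qed

lemma admissible_le_critical_radius:
  fixes M :: "real ^ 'd ^ 'd::finite"
  assumes "admissible c M" "\<bar>det M\<bar> \<le> 1" "det M \<noteq> 0"
  shows "c \<le> critical_radius TYPE('d)"
proof (cases "0 < c")
  case True
  let ?r = "critical_radius TYPE('d)"
  have "c ^ CARD('d) \<le> \<bar>det M\<bar> * ?r ^ CARD('d)" using assms(1,3) True by (rule admissible_power_le_det)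
  also have "\<dots> \<le> 1 * ?r ^ CARD('d)" using assms(2) critical_radius_pos[where 'd = 'd] by (intro mult_right_mono) auto
  finally show ?thesis using critical_radius_pos[where 'd = 'd] by (simp add: power_mono_iff True less_imp_le)
qed (use critical_radius_pos[where 'd = 'd] in linarith)

subsection \<open>Bounded bases of admissible lattices\<close>

lemma norm_matrix_vector_le:
  fixes A :: "real ^ 'n ^ 'm"
  shows "norm (A *v x) \<le> norm A * norm x"
proof -
  have "norm (A *v x) \<le> L2_set (\<lambda>i. norm (A $ i) * norm x) UNIV"
    unfolding norm_vec_def[of "A *v x"]
    by (rule L2_set_mono) (simp_all add: matrix_vector_mul_component Cauchy_Schwarz_ineq2)
  also have "\<dots> = norm A * norm x"
    unfolding norm_vec_def[of A] by (rule L2_set_left_distrib[symmetric]) simp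
  finally show ?thesis .
qed

lemma norm_transpose: "norm (transpose A) = norm (A :: real ^ 'n ^ 'm)"
proof -
  have "(norm (transpose A))\<^sup>2 = (norm A)\<^sup>2"
    by (simp add: norm_vec_def L2_set_def sum_nonneg transpose_def) (rule sum.swap)
  then show ?thesis by simp
qed

lemma norm_matrix_mult_le:
  fixes A :: "real ^ 'n ^ 'm" and B :: "real ^ 'k ^ 'n"
  shows "norm (A ** B) \<le> norm A * norm B"
proof -
  have row: "(A ** B) $ i = transpose B *v (A $ i)" for i
    by (simp add: vec_eq_iff matrix_matrix_mult_def matrix_vector_mult_def transpose_def mult.commute)
  have "norm (A ** B) \<le> L2_set (\<lambda>i. norm (A $ i) * norm B) UNIV"
    unfolding norm_vec_def[of "A ** B"]
  proof (rule L2_set_mono)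
    show "norm ((A ** B) $ i) \<le> norm (A $ i) * norm B" for i
      unfolding row using norm_matrix_vector_le[of "transpose B" "A $ i"]
      by (simp only: norm_transpose mult.commute)
  qed simp
  also have "\<dots> = norm A * norm B"
    unfolding norm_vec_def[of A] by (rule L2_set_left_distrib[symmetric]) simp
  finally show ?thesis .
qed

lemma bounded_bilinear_matrix_mult:
  "bounded_bilinear ((**) :: real ^ 'n ^ 'm \<Rightarrow> real ^ 'k ^ 'n \<Rightarrow> real ^ 'k ^ 'm)"
proof
  show "\<exists>K. \<forall>(a :: real ^ 'n ^ 'm) (b :: real ^ 'k ^ 'n). norm (a ** b) \<le> norm a * norm b * K"
    by (intro exI[of _ 1] allI) (simp only: norm_matrix_mult_le mult_1_right)
qed (simp_all add: vec_eq_iff matrix_matrix_mult_def algebra_simps sum.distrib sum_distrib_left)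

lemmas tendsto_matrix_mult [tendsto_intros] = bounded_bilinear.tendsto[OF bounded_bilinear_matrix_mult]
lemmas continuous_on_matrix_mult [continuous_intros] = bounded_bilinear.continuous_on[OF bounded_bilinear_matrix_mult]

lemma bounded_bilinear_matrix_vector_mult:
  "bounded_bilinear ((*v) :: real ^ 'n ^ 'm \<Rightarrow> real ^ 'n \<Rightarrow> real ^ 'm)"
proof
  show "\<exists>K. \<forall>(a :: real ^ 'n ^ 'm) (b :: real ^ 'n). norm (a *v b) \<le> norm a * norm b * K"
    by (intro exI[of _ 1] allI) (simp only: norm_matrix_vector_le mult_1_right)
qed (simp_all add: vec_eq_iff matrix_vector_mult_def algebra_simps sum.distrib sum_distrib_left)

lemmas tendsto_matrix_vector_mult [tendsto_intros] =
  bounded_bilinear.tendsto[OF bounded_bilinear_matrix_vector_mult]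

lemma bounded_linear_transpose: "bounded_linear (transpose :: real ^ 'n ^ 'm \<Rightarrow> real ^ 'm ^ 'n)"
proof (rule bounded_linear_intro[of _ 1])
  show "norm (transpose A) \<le> norm A * 1" for A :: "real ^ 'n ^ 'm" by (simp add: norm_transpose)
qed (simp_all add: vec_eq_iff transpose_def)

lemmas tendsto_transpose [tendsto_intros] = bounded_linear.tendsto[OF bounded_linear_transpose]
lemmas continuous_on_transpose [continuous_intros] = bounded_linear.continuous_on[OF bounded_linear_transpose]

lemma continuous_on_det: "continuous_on S (det :: real ^ 'n ^ 'n \<Rightarrow> real)"
  unfolding det_def by (intro continuous_intros)

lemma tendsto_det [tendsto_intros]:
  fixes f :: "'a \<Rightarrow> real ^ 'n ^ 'n"
  shows "(f \<longlongrightarrow> A) F \<Longrightarrow> ((\<lambda>x. det (f x)) \<longlongrightarrow> det A) F"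
  unfolding det_def by (intro tendsto_intros)

lemma det_bounded_on_cball: "\<exists>C. \<forall>A :: real ^ 'n ^ 'n. norm A \<le> \<rho> \<longrightarrow> \<bar>det A\<bar> \<le> C"
proof -
  have "bounded ((det :: real ^ 'n ^ 'n \<Rightarrow> real) ` cball 0 \<rho>)"
    by (intro compact_imp_bounded compact_continuous_image continuous_on_det compact_cball)
  then obtain C where "\<forall>x\<in>cball 0 \<rho>. \<bar>det (x :: real ^ 'n ^ 'n)\<bar> \<le> C" by (auto simp: bounded_iff)
  then show ?thesis by (intro exI[of _ C]) simp
qed

lemma norm_matrix_le_columns:
  fixes A :: "real ^ 'n ^ 'm"
  assumes "\<And>j. norm (column j A) \<le> \<rho>"
  shows "norm A \<le> real CARD('m) * (real CARD('n) * \<rho>)"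
proof -
  have "norm (A $ i) \<le> real CARD('n) * \<rho>" for i
  proof -
    have "norm (A $ i) \<le> (\<Sum>j\<in>UNIV. \<bar>A $ i $ j\<bar>)" by (rule norm_le_l1_cart)
    also have "\<dots> \<le> (\<Sum>j\<in>(UNIV :: 'n set). \<rho>)"
    proof (rule sum_mono)
      fix j show "\<bar>A $ i $ j\<bar> \<le> \<rho>"
        using component_le_norm_cart[of "column j A" i] assms[of j] by (simp add: column_def)
    qed
    finally show ?thesis by simp
  qed
  then have "(\<Sum>i\<in>UNIV. norm (A $ i)) \<le> (\<Sum>i\<in>(UNIV :: 'm set). real CARD('n) * \<rho>)"
    by (intro sum_mono)
  moreover have "norm A \<le> (\<Sum>i\<in>UNIV. norm (A $ i))"
    unfolding norm_vec_def[of A] by (rule L2_set_le_sum) simp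
  ultimately show ?thesis by simp
qed

lemma matrix_inv_works:
  fixes A :: "real ^ 'n ^ 'n"
  assumes "det A \<noteq> 0"
  shows "A ** matrix_inv A = mat 1" "matrix_inv A ** A = mat 1"
proof -
  have "\<exists>B. A ** B = mat 1 \<and> B ** A = mat 1"
    using assms unfolding invertible_det_nz[symmetric] invertible_def .
  from someI_ex[OF this] show "A ** matrix_inv A = mat 1" "matrix_inv A ** A = mat 1"
    unfolding matrix_inv_def by blast+
qed

section \<open>Integer matrices\<close>

definition int_matrix :: "real ^ 'n ^ 'm \<Rightarrow> bool" where
  "int_matrix A \<longleftrightarrow> (\<forall>i j. A $ i $ j \<in> \<int>)"

lemma SL_int_iff: "\<gamma> \<in> SL_int \<longleftrightarrow> int_matrix \<gamma> \<and> det \<gamma> = 1"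
  by (auto simp: SL_int_def int_matrix_def)

lemma int_matrix_mult: "int_matrix A \<Longrightarrow> int_matrix B \<Longrightarrow> int_matrix (A ** B)"
  by (auto simp: int_matrix_def matrix_matrix_mult_def intro!: Ints_sum Ints_mult)

lemma int_matrix_add: "int_matrix A \<Longrightarrow> int_matrix B \<Longrightarrow> int_matrix (A + B)"
  by (auto simp: int_matrix_def)

lemma int_matrix_mat_1: "int_matrix (mat 1)"
  by (auto simp: int_matrix_def mat_def)

lemma int_matrix_vector: "int_matrix A \<Longrightarrow> z \<in> int_vecs \<Longrightarrow> A *v z \<in> int_vecs"
  by (auto simp: int_matrix_def int_vecs_def matrix_vector_mult_def intro!: Ints_sum Ints_mult)

lemma det_int_matrix: "int_matrix A \<Longrightarrow> det A \<in> \<int>"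
  by (auto simp: int_matrix_def det_def intro!: Ints_sum Ints_mult Ints_prod)

lemma finite_vec_image:
  assumes "\<And>i. finite (S i)"
  shows "finite {v :: 'a ^ 'n. \<forall>i. v $ i \<in> S i}"
proof -
  have "{v :: 'a ^ 'n. \<forall>i. v $ i \<in> S i} \<subseteq> (\<lambda>f. \<chi> i. f i) ` PiE UNIV S"
  proof
    fix v :: "'a ^ 'n" assume "v \<in> {v. \<forall>i. v $ i \<in> S i}"
    then have "($) v \<in> PiE UNIV S" by auto
    moreover have "v = (\<chi> i. v $ i)" by simp
    ultimately show "v \<in> (\<lambda>f. \<chi> i. f i) ` PiE UNIV S" by (intro rev_image_eqI[where x = "($) v"])
  qed
  moreover have "finite (PiE (UNIV :: 'n set) S)" by (rule finite_PiE) (use assms in auto)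
  ultimately show ?thesis by (meson finite_imageI finite_subset)
qed

lemma finite_int_vecs_bounded: "finite {z :: real ^ 'n. z \<in> int_vecs \<and> norm z \<le> \<rho>}"
proof (rule finite_subset)
  show "{z :: real ^ 'n. z \<in> int_vecs \<and> norm z \<le> \<rho>} \<subseteq> {z. \<forall>i. z $ i \<in> {k \<in> \<int>. \<bar>k\<bar> \<le> \<rho>}}"
    by (auto simp: int_vecs_def intro: order_trans[OF component_le_norm_cart])
  show "finite {z :: real ^ 'n. \<forall>i. z $ i \<in> {k \<in> \<int>. \<bar>k\<bar> \<le> \<rho>}}"
    by (intro finite_vec_image finite_abs_int_segment)
qed

lemma finite_int_matrix_bounded:
  "finite {A :: real ^ 'n ^ 'm. int_matrix A \<and> (\<forall>i j. \<bar>A $ i $ j\<bar> \<le> \<rho>)}"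
proof -
  have "{A :: real ^ 'n ^ 'm. int_matrix A \<and> (\<forall>i j. \<bar>A $ i $ j\<bar> \<le> \<rho>)} =
      {A. \<forall>i. A $ i \<in> {v. \<forall>j. v $ j \<in> {k \<in> \<int>. \<bar>k\<bar> \<le> \<rho>}}}"
    by (auto simp: int_matrix_def)
  then show ?thesis by (simp only:) (intro finite_vec_image finite_abs_int_segment)
qed

text \<open>\<open>W\<close> is the adjugate, read off Cramer's rule: its entries are determinants
  of integer matrices and hence integers.\<close>

lemma int_matrix_adjugate:
  fixes A :: "real ^ 'n ^ 'n"
  assumes A: "int_matrix A" and d: "det A \<noteq> 0"
  shows "\<exists>W. int_matrix W \<and> W ** A = det A *\<^sub>R mat 1"
proof -
  define W where "W = (\<chi> k l. det (\<chi> i j. if j = k then axis l 1 $ i else A $ i $ j))"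
  have W: "int_matrix W"
    unfolding int_matrix_def W_def using A
    by (auto intro!: det_int_matrix simp: int_matrix_def axis_def)
  have "A *v ((1 / det A) *\<^sub>R column l W) = axis l 1" for l
    unfolding cramer[OF d] by (simp add: vec_eq_iff W_def column_def)
  then have "column l (A ** ((1 / det A) *\<^sub>R W)) = column l (mat 1)" for l
    by (simp add: vec_eq_iff column_def matrix_matrix_mult_def matrix_vector_mult_def mat_def axis_def)
  then have "A ** ((1 / det A) *\<^sub>R W) = mat 1"
    by (simp add: vec_eq_iff column_def)
  then have "((1 / det A) *\<^sub>R W) ** A = mat 1" by (simp only: matrix_left_right_inverse)
  then have "det A *\<^sub>R (((1 / det A) *\<^sub>R W) ** A) = det A *\<^sub>R mat 1" by simp
  then have "W ** A = det A *\<^sub>R mat 1"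
    using d bounded_bilinear.scaleR_left[OF bounded_bilinear_matrix_mult, of "1 / det A" W A] by simp
  with W show ?thesis by blast
qed

text \<open>
  If \<open>A \<equiv> A\<^sub>0\<close> modulo the common determinant \<open>\<delta>\<close>, say \<open>A = A\<^sub>0 + \<delta> X\<close>, then
  \<open>A = (1 + X adj(A\<^sub>0)) A\<^sub>0\<close>. So there are only finitely many classes of integer matrices of
  bounded determinant.
\<close>

lemma int_matrix_congruent:
  fixes A A\<^sub>0 :: "real ^ 'n ^ 'n"
  assumes A0: "int_matrix A\<^sub>0" and X: "int_matrix X"
    and d: "det A = det A\<^sub>0" "det A\<^sub>0 \<noteq> 0" and eq: "A = A\<^sub>0 + det A\<^sub>0 *\<^sub>R X"
  shows "\<exists>\<gamma>\<in>SL_int. A = \<gamma> ** A\<^sub>0"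
proof -
  obtain W where W: "int_matrix W" "W ** A\<^sub>0 = det A\<^sub>0 *\<^sub>R mat 1"
    using int_matrix_adjugate[OF A0 d(2)] by blast
  define \<gamma> where "\<gamma> = mat 1 + X ** W"
  have "\<gamma> ** A\<^sub>0 = A\<^sub>0 + X ** (W ** A\<^sub>0)"
    unfolding \<gamma>_def
    by (simp add: bounded_bilinear.add_left[OF bounded_bilinear_matrix_mult] matrix_mul_assoc)
  also have "\<dots> = A"
    unfolding W eq by (simp add: bounded_bilinear.scaleR_right[OF bounded_bilinear_matrix_mult])
  finally have g: "A = \<gamma> ** A\<^sub>0" ..
  then have "det \<gamma> = 1" using d by (simp add: det_mul)
  moreover have "int_matrix \<gamma>"
    unfolding \<gamma>_def by (intro int_matrix_add int_matrix_mat_1 int_matrix_mult X W)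
  ultimately show ?thesis using g by (auto simp: SL_int_iff)
qed

lemma finite_int_matrix_classes:
  "\<exists>\<R> :: (real ^ 'n ^ 'n) set. finite \<R> \<and> (\<forall>A\<in>\<R>. det A \<noteq> 0) \<and>
     (\<forall>A. int_matrix A \<longrightarrow> det A \<noteq> 0 \<longrightarrow> \<bar>det A\<bar> \<le> C \<longrightarrow> (\<exists>A\<^sub>0\<in>\<R>. \<exists>\<gamma>\<in>SL_int. A = \<gamma> ** A\<^sub>0))"
proof -
  define \<A> where "\<A> = {A :: real ^ 'n ^ 'n. int_matrix A \<and> det A \<noteq> 0 \<and> \<bar>det A\<bar> \<le> C}"
  \<comment> \<open>The determinant and the entries reduced modulo it. The residues are bounded by
    \<bar>det A\<bar>, so \<open>cls\<close> takes finitely many values on \<open>\<A>\<close>;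
    matrices with equal values are congruent modulo their common determinant.\<close>
  define cls :: "real ^ 'n ^ 'n \<Rightarrow> real \<times> (real ^ 'n ^ 'n)" where
    "cls A = (det A, \<chi> i j. A $ i $ j - det A * of_int \<lfloor>A $ i $ j / det A\<rfloor>)" for A
  have "cls ` \<A> \<subseteq> {k \<in> \<int>. \<bar>k\<bar> \<le> C} \<times> {A. int_matrix A \<and> (\<forall>i j. \<bar>A $ i $ j\<bar> \<le> C)}"
  proof
    fix p assume "p \<in> cls ` \<A>"
    then obtain A where A: "int_matrix A" "det A \<noteq> 0" "\<bar>det A\<bar> \<le> C" and p: "p = cls A"
      by (auto simp: \<A>_def)
    have "\<bar>A $ i $ j - det A * of_int \<lfloor>A $ i $ j / det A\<rfloor>\<bar> \<le> C" for i j
    proof -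
      have "A $ i $ j - det A * of_int \<lfloor>A $ i $ j / det A\<rfloor> = det A * frac (A $ i $ j / det A)"
        using A(2) by (simp add: frac_def algebra_simps)
      moreover have "\<bar>frac (A $ i $ j / det A)\<bar> \<le> 1"
        using frac_ge_0[of "A $ i $ j / det A"] frac_lt_1[of "A $ i $ j / det A"] by linarith
      then have "\<bar>det A\<bar> * \<bar>frac (A $ i $ j / det A)\<bar> \<le> C * 1"
        using A(3) by (intro mult_mono) auto
      ultimately show ?thesis by (simp add: abs_mult)
    qed
    moreover have "A $ i $ j - det A * of_int \<lfloor>A $ i $ j / det A\<rfloor> \<in> \<int>" for i j
      using A(1) det_int_matrix[OF A(1)] by (auto simp: int_matrix_def)
    ultimately show "p \<in> {k \<in> \<int>. \<bar>k\<bar> \<le> C} \<times> {A. int_matrix A \<and> (\<forall>i j. \<bar>A $ i $ j\<bar> \<le> C)}"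
      using A(3) det_int_matrix[OF A(1)] by (simp add: p cls_def int_matrix_def)
  qed
  then have fin: "finite (cls ` \<A>)"
    by (rule finite_subset) (intro finite_cartesian_product finite_abs_int_segment finite_int_matrix_bounded)
  define \<R> where "\<R> = inv_into \<A> cls ` cls ` \<A>"
  have R: "\<R> \<subseteq> \<A>" unfolding \<R>_def by (auto intro: inv_into_into)
  have "\<exists>A\<^sub>0\<in>\<R>. \<exists>\<gamma>\<in>SL_int. A = \<gamma> ** A\<^sub>0" if A: "A \<in> \<A>" for A
  proof
    define A\<^sub>0 where "A\<^sub>0 = inv_into \<A> cls (cls A)"
    show R0: "A\<^sub>0 \<in> \<R>" unfolding \<R>_def A\<^sub>0_def using A by blast
    then have A0: "int_matrix A\<^sub>0" "det A\<^sub>0 \<noteq> 0" using R by (auto simp: \<A>_def)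
    have "cls A\<^sub>0 = cls A" unfolding A\<^sub>0_def using A by (simp add: f_inv_into_f)
    then have d: "det A = det A\<^sub>0" and m: "A\<^sub>0 $ i $ j - det A\<^sub>0 * of_int \<lfloor>A\<^sub>0 $ i $ j / det A\<^sub>0\<rfloor> =
        A $ i $ j - det A\<^sub>0 * of_int \<lfloor>A $ i $ j / det A\<^sub>0\<rfloor>" for i j
      by (auto simp: cls_def vec_eq_iff)
    define X :: "real ^ 'n ^ 'n" where "X = (\<chi> i j. of_int (\<lfloor>A $ i $ j / det A\<^sub>0\<rfloor> - \<lfloor>A\<^sub>0 $ i $ j / det A\<^sub>0\<rfloor>))"
    have "int_matrix X" by (auto simp: int_matrix_def X_def)
    moreover have "A = A\<^sub>0 + det A\<^sub>0 *\<^sub>R X"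
      using m by (simp add: vec_eq_iff X_def algebra_simps)
    ultimately show "\<exists>\<gamma>\<in>SL_int. A = \<gamma> ** A\<^sub>0"
      using int_matrix_congruent[OF A0(1) _ d A0(2)] by blast
  qed
  then show ?thesis
    using fin R by (intro exI[of _ \<R>]) (auto simp: \<R>_def \<A>_def)
qed

text \<open>
  If all short vectors of a lattice were orthogonal to \<open>u\<close>, contracting the direction of \<open>u\<close> and
  expanding its orthogonal complement would yield a lattice that is too sparse for its covolume.
\<close>

lemma short_vectors_not_in_hyperplane:
  fixes M :: "real ^ 'd ^ 'd::finite"
  defines "r \<equiv> critical_radius TYPE('d)"
  assumes M: "det M = 1" and adm: "admissible (r / 2) M" and u: "norm u = 1"
  shows "\<exists>z\<in>int_vecs. norm (M *v z) < 2 * r * 3 ^ (CARD('d) - 1) \<and> u \<bullet> (M *v z) \<noteq> 0"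
proof (rule ccontr)
  assume "\<not> ?thesis"
  then have perp: "u \<bullet> (M *v z) = 0" if "z \<in> int_vecs" "norm (M *v z) < 2 * r * 3 ^ (CARD('d) - 1)" for z
    using that by blast
  have r: "0 < r" unfolding r_def by (rule critical_radius_pos)
  define p :: real where "p = 3 ^ (CARD('d) - 1)"
  have p: "1 \<le> p" unfolding p_def by (rule one_le_power) simp
  define k :: 'd where "k = undefined"
  obtain K where K: "orthogonal_matrix K" "K *v axis k 1 = u"
    using orthogonal_matrix_exists_basis[OF u] by blast
  \<comment> \<open>The factor \<open>1 / p\<close> in the direction of \<open>u\<close> makes up
    for the factors 3 in all others, so the determinant is 1. Vectors shorter than
    \<open>2 * r * p\<close> lie in the hyperplane and grow from at least \<open>r / 2\<close> to at
    least \<open>3 / 2 * r\<close>; the others shrink at most by the factor \<open>p\<close> and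
    keep length \<open>2 * r\<close>. Both exceed \<open>r\<close>.\<close>
  define D :: "real ^ 'd ^ 'd" where "D = (\<chi> i j. if i = j then (if i = k then 1 / p else 3) else 0)"
  have "det D = (\<Prod>i\<in>UNIV. if i = k then 1 / p else 3)"
    by (subst det_diagonal) (auto simp: D_def)
  also have "\<dots> = 1" by (subst prod.remove[of _ k]) (simp_all add: card_Diff_singleton p_def)
  finally have "det D = 1" .
  moreover have "\<bar>det K\<bar> = 1" using det_orthogonal_matrix[OF K(1)] by auto
  ultimately have det: "\<bar>det (D ** transpose K ** M)\<bar> = 1" using M by (simp add: det_mul det_transpose abs_mult)
  have "admissible (3 / 2 * r) (D ** transpose K ** M)"
    unfolding admissible_def
  proof (intro ballI impI)
    fix z :: "real ^ 'd" assume z: "z \<in> int_vecs" "z \<noteq> 0"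
    define v where "v = M *v z"
    define y where "y = transpose K *v v"
    have "orthogonal_transformation ((*v) (transpose K))"
      using K(1) by (simp add: orthogonal_transformation_matrix orthogonal_matrix_transpose)
    then have ny: "norm y = norm v" unfolding y_def by (rule orthogonal_transformation_norm)
    have yk: "y $ k = u \<bullet> v"
      unfolding y_def K(2)[symmetric] matrix_vector_mult_basis
      by (simp add: inner_vec_def column_def matrix_vector_mult_def transpose_def del: transpose_matrix_vector)
    have Dy: "(D *v y) $ i = (if i = k then 1 / p else 3) * y $ i" for i
      by (simp add: D_def matrix_vector_mult_def if_distrib[of "\<lambda>x. x * _"] cong: if_cong)
    have v: "r / 2 \<le> norm v" unfolding v_def using admissibleD[OF adm z] .
    have "3 / 2 * r \<le> norm (D *v y)"
    proof (cases "norm v < 2 * r * p")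
      case True
      then have "y $ k = 0" unfolding yk using perp[OF z(1)] by (simp add: v_def p_def)
      then have "D *v y = 3 *\<^sub>R y" by (auto simp: vec_eq_iff Dy)
      then show ?thesis using v ny by simp
    next
      case False
      have "norm ((1 / p) *\<^sub>R y) \<le> norm (D *v y)"
      proof (rule norm_le_componentwise_cart)
        fix i
        have "1 / p \<le> (if i = k then 1 / p else 3)"
          using p by (auto simp: divide_le_eq)
        then have "1 / p * \<bar>y $ i\<bar> \<le> (if i = k then 1 / p else 3) * \<bar>y $ i\<bar>"
          by (rule mult_right_mono) simp
        then show "norm (((1 / p) *\<^sub>R y) $ i) \<le> norm ((D *v y) $ i)"
          using p by (simp add: Dy abs_mult split: if_splits)
      qed
      moreover have "norm ((1 / p) *\<^sub>R y) = norm v / p" using p by (simp add: ny)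
      moreover have "2 * r \<le> norm v / p" using False p by (simp add: field_simps)
      ultimately show ?thesis using r by linarith
    qed
    then show "3 / 2 * r \<le> norm ((D ** transpose K ** M) *v z)"
      by (simp only: y_def v_def matrix_vector_mul_assoc matrix_mul_assoc)
  qed
  then have "3 / 2 * r \<le> r"
    unfolding r_def by (rule admissible_le_critical_radius) (use det in auto)
  then show False using r by simp
qed

text \<open>The short vectors span the space, but an independent choice among them need not generate
  the lattice. Its integer coordinates are kept as the columns of \<open>A\<close>, whose
  determinant is up to sign the index of the sublattice.\<close>

lemma short_independent_vectors:
  fixes M :: "real ^ 'd ^ 'd::finite"
  defines "r \<equiv> critical_radius TYPE('d)"
  assumes M: "det M = 1" and adm: "admissible (r / 2) M"
  shows "\<exists>A. int_matrix A \<and> det A \<noteq> 0 \<and> (\<forall>j. norm (column j (M ** A)) \<le> 2 * r * 3 ^ (CARD('d) - 1))"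
proof -
  let ?R = "2 * r * 3 ^ (CARD('d) - 1)"
  define T where "T = {M *v z | z. z \<in> int_vecs \<and> norm (M *v z) < ?R}"
  have "span T = UNIV"
  proof (rule ccontr)
    assume "span T \<noteq> UNIV"
    then obtain a where a: "a \<noteq> 0" "\<forall>x\<in>span T. a \<bullet> x = 0"
      using span_not_UNIV_orthogonal by blast
    have "norm (a /\<^sub>R norm a) = 1" using a(1) by simp
    from short_vectors_not_in_hyperplane[OF M adm[unfolded r_def] this]
    obtain z where z: "z \<in> int_vecs" "norm (M *v z) < ?R" "(a /\<^sub>R norm a) \<bullet> (M *v z) \<noteq> 0"
      unfolding r_def by blast
    then have "M *v z \<in> T" by (auto simp: T_def)
    then have "a \<bullet> (M *v z) = 0" using a(2) span_base by blast
    then show False using z(3) by simp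
  qed
  obtain B where B: "B \<subseteq> T" "independent B" "T \<subseteq> span B" "card B = dim T"
    using basis_exists by blast
  have span: "span B = UNIV"
    using span_minimal[OF B(3) subspace_span] \<open>span T = UNIV\<close> by blast
  have "card B = CARD('d)"
    using B(4) dim_span[of T] unfolding \<open>span T = UNIV\<close> by simp
  then obtain b where b: "bij_betw b (UNIV :: 'd set) B"
    using finite_same_card_bij[OF finite_class.finite_UNIV finiteI_independent[OF B(2)]] by auto
  have "\<exists>z. z \<in> int_vecs \<and> norm (M *v z) < ?R \<and> b j = M *v z" for j
    using B(1) bij_betw_apply[OF b, of j] by (auto simp: T_def)
  then obtain zf where zf: "\<And>j. zf j \<in> int_vecs" "\<And>j. norm (M *v zf j) < ?R" "\<And>j. b j = M *v zf j"
    by metis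
  define A :: "real ^ 'd ^ 'd" where "A = (\<chi> i j. zf j $ i)"
  have col: "column j (M ** A) = b j" for j
    by (simp add: zf A_def column_def matrix_matrix_mult_def matrix_vector_mult_def)
  have "columns (M ** A) = B"
    using b by (auto simp: columns_def col bij_betw_def)
  then obtain C where "M ** A ** C = mat 1"
    using span matrix_right_invertible_span_columns[of "M ** A"] by (auto simp: span_vec_eq)
  then have "det (M ** A ** C) = 1" by simp
  then have "det (M ** A) \<noteq> 0" by (auto simp: det_mul)
  then have "det A \<noteq> 0" by (simp add: det_mul)
  moreover have "int_matrix A" using zf(1) by (auto simp: int_matrix_def A_def int_vecs_def)
  moreover have "norm (column j (M ** A)) \<le> ?R" for j
    unfolding col zf(3) using zf(2)[of j] by simp
  ultimately show ?thesis by blast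
qed

text \<open>A form of Mahler's compactness criterion. \<open>M ** A\<close> is bounded, hence so is
  \<open>det A\<close>, and \<open>A = \<gamma> ** A\<^sub>0\<close> with finitely many possible
  \<open>A\<^sub>0\<close>; so \<open>M ** \<gamma> = (M ** A) ** matrix_inv A\<^sub>0\<close> is
  bounded as well.\<close>

lemma admissible_bounded_representative:
  "\<exists>R>0. \<forall>M :: real ^ 'd ^ 'd::finite. det M = 1 \<longrightarrow> admissible (critical_radius TYPE('d) / 2) M \<longrightarrow>
     (\<exists>\<gamma>\<in>SL_int. norm (M ** \<gamma>) \<le> R)"
proof -
  let ?r = "critical_radius TYPE('d)"
  define \<rho> where "\<rho> = real CARD('d) * (real CARD('d) * (2 * ?r * 3 ^ (CARD('d) - 1)))"
  obtain C where C: "\<And>A :: real ^ 'd ^ 'd. norm A \<le> \<rho> \<Longrightarrow> \<bar>det A\<bar> \<le> C"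
    using det_bounded_on_cball by metis
  obtain \<R> :: "(real ^ 'd ^ 'd) set" where R: "finite \<R>" "\<forall>A\<in>\<R>. det A \<noteq> 0"
    "\<And>A. int_matrix A \<Longrightarrow> det A \<noteq> 0 \<Longrightarrow> \<bar>det A\<bar> \<le> C \<Longrightarrow> \<exists>A\<^sub>0\<in>\<R>. \<exists>\<gamma>\<in>SL_int. A = \<gamma> ** A\<^sub>0"
    using finite_int_matrix_classes[of C] by metis
  obtain b where b: "\<And>A. A \<in> \<R> \<Longrightarrow> norm (matrix_inv A) \<le> b"
    using finite_imp_bounded[OF finite_imageI[OF R(1), of matrix_inv]] by (auto simp: bounded_iff)
  have "\<exists>\<gamma>\<in>SL_int. norm (M ** \<gamma>) \<le> \<bar>\<rho> * b\<bar> + 1"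
    if M: "det M = 1" "admissible (?r / 2) M" for M :: "real ^ 'd ^ 'd"
  proof -
    obtain A where A: "int_matrix A" "det A \<noteq> 0"
      "\<And>j. norm (column j (M ** A)) \<le> 2 * ?r * 3 ^ (CARD('d) - 1)"
      using short_independent_vectors[OF M] by blast
    have n: "norm (M ** A) \<le> \<rho>" unfolding \<rho>_def by (rule norm_matrix_le_columns[OF A(3)])
    have "\<bar>det A\<bar> \<le> C" using C[OF n] M(1) by (simp add: det_mul)
    then obtain A\<^sub>0 \<gamma> where g: "A\<^sub>0 \<in> \<R>" "\<gamma> \<in> SL_int" "A = \<gamma> ** A\<^sub>0"
      using R(3)[OF A(1,2)] by blast
    have "det A\<^sub>0 \<noteq> 0" using R(2) g(1) by blast
    then have "A ** matrix_inv A\<^sub>0 = \<gamma>"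
      unfolding g(3) by (simp add: matrix_mul_assoc[symmetric] matrix_inv_works)
    then have "M ** \<gamma> = (M ** A) ** matrix_inv A\<^sub>0" by (simp add: matrix_mul_assoc[symmetric])
    then have "norm (M ** \<gamma>) \<le> norm (M ** A) * norm (matrix_inv A\<^sub>0)" by (simp add: norm_matrix_mult_le)
    also have "\<dots> \<le> \<rho> * b" using n b[OF g(1)] by (intro mult_mono) (auto intro: order_trans[OF norm_ge_zero])
    finally show ?thesis using g(2) by (intro bexI[of _ \<gamma>]) auto
  qed
  then show ?thesis by (intro exI[of _ "\<bar>\<rho> * b\<bar> + 1"]) auto
qed

subsection \<open>Critical lattices are extreme\<close>

text \<open>A permutation other than the identity moves at least two indices; after one factor of
  its product is differentiated, another still sits at a zero entry of \<open>mat 1\<close>. Only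
  the diagonal product contributes.\<close>

lemma has_derivative_det_mat_1: "(det has_derivative trace) (at (mat 1 :: real ^ 'n ^ 'n))"
proof -
  let ?P = "{p. p permutes (UNIV :: 'n set)}"
  let ?I = "mat 1 :: real ^ 'n ^ 'n"
  have comp: "((\<lambda>A :: real ^ 'n ^ 'n. A $ i $ j) has_derivative (\<lambda>H. H $ i $ j)) (at A)" for i j A
    by (intro bounded_linear_imp_has_derivative bounded_linear_compose[OF bounded_linear_vec_nth] bounded_linear_vec_nth)
  have "((\<lambda>A :: real ^ 'n ^ 'n. \<Sum>p\<in>?P. of_int (sign p) * (\<Prod>i\<in>UNIV. A $ i $ p i)) has_derivative
      (\<lambda>H. \<Sum>p\<in>?P. of_int (sign p) * (\<Sum>i\<in>UNIV. H $ i $ p i * (\<Prod>j\<in>UNIV - {i}. ?I $ j $ p j)))) (at ?I)"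
    by (intro has_derivative_sum has_derivative_mult_right has_derivative_prod comp)
  moreover have "(\<Sum>p\<in>?P. of_int (sign p) * (\<Sum>i\<in>UNIV. H $ i $ p i * (\<Prod>j\<in>UNIV - {i}. ?I $ j $ p j))) = trace H"
    for H :: "real ^ 'n ^ 'n"
  proof -
    have zero: "of_int (sign p) * (\<Sum>i\<in>UNIV. H $ i $ p i * (\<Prod>j\<in>UNIV - {i}. ?I $ j $ p j)) = 0"
      if p: "p \<in> ?P - {id}" for p
    proof -
      have bij: "bij p" using p by (auto simp: permutes_bij)
      have "(\<Prod>j\<in>UNIV - {i}. ?I $ j $ p j) = 0" for i
      proof -
        obtain a where a: "p a \<noteq> a" using p by (auto simp: fun_eq_iff)
        then have "p (p a) \<noteq> p a" using bij by (metis bij_is_inj injD)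
        then have "\<exists>j\<in>UNIV - {i}. p j \<noteq> j" using a by (cases "a = i") auto
        then obtain j where "j \<in> UNIV - {i}" "p j \<noteq> j" by blast
        then show ?thesis by (intro prod_zero) (auto simp: mat_def intro!: bexI[of _ j])
      qed
      then show ?thesis by (simp only: mult_zero_right sum.neutral_const)
    qed
    have "(\<Sum>p\<in>?P. of_int (sign p) * (\<Sum>i\<in>UNIV. H $ i $ p i * (\<Prod>j\<in>UNIV - {i}. ?I $ j $ p j))) =
      (\<Sum>p\<in>{id}. of_int (sign p) * (\<Sum>i\<in>UNIV. H $ i $ p i * (\<Prod>j\<in>UNIV - {i}. ?I $ j $ p j)))"
      by (rule sum.mono_neutral_right) (use zero in \<open>auto simp: finite_permutations permutes_id\<close>)
    also have "\<dots> = trace H" by (simp add: trace_def mat_def)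
    finally show ?thesis .
  qed
  ultimately show ?thesis unfolding det_def[abs_def] by (simp only:)
qed

lemma det_first_order:
  "((\<lambda>Q :: real ^ 'n ^ 'n. (det (mat 1 + Q) - 1 - trace Q) / norm Q) \<longlongrightarrow> 0) (at 0)"
proof -
  have "((\<lambda>Q :: real ^ 'n ^ 'n. norm (det (mat 1 + Q) - det (mat 1 :: real ^ 'n ^ 'n) - trace Q) / norm Q) \<longlongrightarrow> 0) (at 0)"
    using has_derivative_det_mat_1 unfolding has_derivative_at by blast
  then have "((\<lambda>Q :: real ^ 'n ^ 'n. norm ((det (mat 1 + Q) - 1 - trace Q) / norm Q)) \<longlongrightarrow> 0) (at 0)"
    by (simp add: norm_divide)
  then show ?thesis by (rule tendsto_norm_zero_cancel)
qed

text \<open>Allows t^2 to be split off from \<open>det (mat 1 + t *\<^sub>R Q) - 1\<close> within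
  polynomials, so that a second-order coefficient is available with only first derivatives at
  hand.\<close>

lemma det_linear_poly:
  fixes Q :: "real ^ 'n ^ 'n"
  shows "\<exists>P. \<forall>t. poly P t = det (mat 1 + t *\<^sub>R Q)"
proof
  let ?I = "mat 1 :: real ^ 'n ^ 'n"
  show "\<forall>t. poly (\<Sum>p\<in>{p. p permutes (UNIV :: 'n set)}. smult (of_int (sign p)) (\<Prod>i\<in>UNIV. [:?I $ i $ p i, Q $ i $ p i:])) t =
      det (mat 1 + t *\<^sub>R Q)"
    by (simp add: det_def poly_sum poly_prod)
qed

lemma trace_scaleR: "trace (c *\<^sub>R A) = c * trace (A :: real ^ 'n ^ 'n)"
  by (simp add: trace_def sum_distrib_left)

lemma trace_mult_self_symmetric:
  fixes Q :: "real ^ 'n ^ 'n"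
  assumes "transpose Q = Q"
  shows "trace (Q ** Q) = (norm Q)\<^sup>2"
proof -
  have "Q $ j $ i = Q $ i $ j" for i j
    using assms by (metis transpose_def vec_lambda_beta)
  then show ?thesis
    by (simp add: trace_def matrix_matrix_mult_def norm_vec_def L2_set_def sum_nonneg power2_eq_square)
qed

text \<open>
  Write \<open>p(t) = det(1 + tQ)\<close>. Then \<open>p(t) p(-t) = det(1 - t\<^sup>2 Q\<^sup>2)\<close>, so the first-order expansion of
  the determinant already yields the quadratic coefficient \<open>- tr(Q\<^sup>2) / 2 < 0\<close> of \<open>p\<close>.
\<close>

lemma det_symmetric_traceless_less_1:
  fixes Q :: "real ^ 'n ^ 'n"
  assumes sym: "transpose Q = Q" and tr: "trace Q = 0" and Q: "Q \<noteq> 0"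
  shows "\<forall>\<^sub>F t in at_right 0. det (mat 1 + t *\<^sub>R Q) < 1"
proof -
  obtain P where P: "\<And>t. poly P t = det (mat 1 + t *\<^sub>R Q)" using det_linear_poly by blast
  obtain a P' where a: "P = pCons a P'" by (cases P)
  obtain b S where b: "P' = pCons b S" by (cases P')
  have "a = 1" using P[of 0] by (simp add: a)
  have "((\<lambda>t. det (mat 1 + t *\<^sub>R Q)) has_derivative (\<lambda>t. trace (t *\<^sub>R Q))) (at 0)"
  proof (rule has_derivative_compose[of "\<lambda>t. mat 1 + t *\<^sub>R Q" "\<lambda>t. t *\<^sub>R Q" 0 UNIV det trace])
    show "((\<lambda>t. mat 1 + t *\<^sub>R Q) has_derivative (\<lambda>t. t *\<^sub>R Q)) (at 0)"
      by (auto intro!: derivative_eq_intros)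
    show "(det has_derivative trace) (at (mat 1 + 0 *\<^sub>R Q))"
      using has_derivative_det_mat_1 by simp
  qed
  then have "(poly P has_real_derivative 0) (at 0)"
    unfolding has_field_derivative_def by (simp add: P[abs_def] trace_scaleR tr lambda_zero)
  then have "poly (pderiv P) 0 = 0" using poly_DERIV DERIV_unique by blast
  then have "b = 0" by (simp add: a b pderiv_pCons)
  \<comment> \<open>The constant coefficient is \<open>det (mat 1)\<close> and the linear one is the
    trace of \<open>Q\<close>. The rest is divisible by t^2, and the sign of \<open>S\<close> at 0
    decides.\<close>
  then have PS: "det (mat 1 + t *\<^sub>R Q) = 1 + t\<^sup>2 * poly S t" for t
    using P[of t] \<open>a = 1\<close> by (simp add: a b power2_eq_square)
  define N where "N = - (Q ** Q)"
  have prod: "(1 + t\<^sup>2 * poly S t) * (1 + t\<^sup>2 * poly S (- t)) = det (mat 1 + t\<^sup>2 *\<^sub>R N)" for t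
  proof -
    interpret mm: bounded_bilinear "(**) :: real ^ 'n ^ 'n \<Rightarrow> real ^ 'n ^ 'n \<Rightarrow> real ^ 'n ^ 'n"
      by (rule bounded_bilinear_matrix_mult)
    have "(mat 1 + t *\<^sub>R Q) ** (mat 1 + (- t) *\<^sub>R Q) = mat 1 + t\<^sup>2 *\<^sub>R N"
      by (simp add: N_def mm.add_left mm.diff_right mm.scaleR_left mm.scaleR_right power2_eq_square
          scaleR_right_diff_distrib scaleR_right_distrib)
    then have "det (mat 1 + t *\<^sub>R Q) * det (mat 1 + (- t) *\<^sub>R Q) = det (mat 1 + t\<^sup>2 *\<^sub>R N)"
      by (simp only: det_mul[symmetric])
    then show ?thesis unfolding PS by (simp only: power2_minus)
  qed
  have "Q ** Q \<noteq> 0"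
  proof
    assume "Q ** Q = 0"
    then have "(norm Q)\<^sup>2 = 0" using trace_mult_self_symmetric[OF sym] by (simp add: trace_def)
    then show False using Q by simp
  qed
  then have N: "N \<noteq> 0" by (simp add: N_def)
  \<comment> \<open>The first-order expansion is used along \<open>t\<^sup>2 *\<^sub>R N\<close>.
    Divided by t^2, the product formula turns it into
    \<open>poly S t + poly S (- t) - trace N\<close> up to O(t^2), hence
    \<open>2 * poly S 0 = trace N\<close>.\<close>
  have "((\<lambda>t. (det (mat 1 + t\<^sup>2 *\<^sub>R N) - 1 - trace (t\<^sup>2 *\<^sub>R N)) / norm (t\<^sup>2 *\<^sub>R N)) \<longlongrightarrow> 0) (at_right 0)"
  proof (rule filterlim_compose[OF det_first_order])
    have "((\<lambda>t :: real. t\<^sup>2 *\<^sub>R N) \<longlongrightarrow> 0\<^sup>2 *\<^sub>R N) (at_right 0)" by (intro tendsto_intros)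
    moreover have "\<forall>\<^sub>F t in at_right 0. t\<^sup>2 *\<^sub>R N \<noteq> 0"
      using N by (intro eventually_at_rightI[of 0 1]) auto
    ultimately show "filterlim (\<lambda>t :: real. t\<^sup>2 *\<^sub>R N) (at 0) (at_right 0)"
      by (intro filterlim_atI) simp_all
  qed
  then have "((\<lambda>t. (det (mat 1 + t\<^sup>2 *\<^sub>R N) - 1 - trace (t\<^sup>2 *\<^sub>R N)) / norm (t\<^sup>2 *\<^sub>R N) * norm N) \<longlongrightarrow> 0 * norm N) (at_right 0)"
    by (intro tendsto_intros)
  moreover have "(det (mat 1 + t\<^sup>2 *\<^sub>R N) - 1 - trace (t\<^sup>2 *\<^sub>R N)) / norm (t\<^sup>2 *\<^sub>R N) * norm N =
      poly S t + poly S (- t) + t\<^sup>2 * poly S t * poly S (- t) - trace N" if "t > 0" for t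
    using that N unfolding prod[symmetric] trace_scaleR
    by (simp add: field_simps power2_eq_square)
  then have "\<forall>\<^sub>F t in at_right 0. (det (mat 1 + t\<^sup>2 *\<^sub>R N) - 1 - trace (t\<^sup>2 *\<^sub>R N)) / norm (t\<^sup>2 *\<^sub>R N) * norm N =
      poly S t + poly S (- t) + t\<^sup>2 * poly S t * poly S (- t) - trace N"
    by (intro eventually_at_rightI[of 0 1]) auto
  ultimately have "((\<lambda>t. poly S t + poly S (- t) + t\<^sup>2 * poly S t * poly S (- t) - trace N) \<longlongrightarrow> 0 * norm N) (at_right 0)"
    by (rule Lim_transform_eventually)
  moreover have "((\<lambda>t. poly S t + poly S (- t) + t\<^sup>2 * poly S t * poly S (- t) - trace N) \<longlongrightarrow>
      poly S 0 + poly S (- 0) + 0\<^sup>2 * poly S 0 * poly S (- 0) - trace N) (at_right 0)"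
    by (intro tendsto_intros tendsto_poly)
  ultimately have "poly S 0 + poly S (- 0) + 0\<^sup>2 * poly S 0 * poly S (- 0) - trace N = 0 * norm N"
    by (intro tendsto_unique[rotated -1]) auto
  then have "2 * poly S 0 = - (norm Q)\<^sup>2"
    using trace_mult_self_symmetric[OF sym] by (simp add: N_def trace_def sum_negf)
  then have "poly S 0 < 0" using Q by (smt (verit) zero_less_norm_iff zero_less_power)
  moreover have "((\<lambda>t. poly S t) \<longlongrightarrow> poly S 0) (at_right 0)" by (intro tendsto_intros tendsto_poly)
  ultimately have "\<forall>\<^sub>F t in at_right 0. poly S t < 0" by (rule order_tendstoD[rotated])
  moreover have "\<forall>\<^sub>F t :: real in at_right 0. t > 0" by (simp add: eventually_at_right_less)
  ultimately show ?thesis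
    by eventually_elim (simp add: PS mult_pos_neg)
qed

text \<open>The lengths of lattice vectors are discrete, so the next one above \<open>r\<close> is a
  definite distance away. Thus a sufficiently small perturbation cannot bring vectors longer than
  \<open>r\<close> below \<open>r\<close>.\<close>

lemma admissible_gap:
  fixes M :: "real ^ 'd ^ 'd::finite"
  assumes "det M \<noteq> 0"
  shows "\<exists>g>0. \<forall>z\<in>int_vecs. r < norm (M *v z) \<longrightarrow> r + g \<le> norm (M *v z)"
proof -
  obtain B where B: "0 < B" "\<And>x. B * norm x \<le> norm (M *v x)"
    using linear_inj_bounded_below_pos[OF matrix_vector_mul_linear inj_matrix_vector_mult, of M] assms
    unfolding invertible_det_nz by blast
  define Z where "Z = {z. z \<in> int_vecs \<and> norm (M *v z) \<le> r + 1}"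
  have "Z \<subseteq> {z. z \<in> int_vecs \<and> norm z \<le> (r + 1) / B}"
  proof
    fix z assume z: "z \<in> Z"
    then have "B * norm z \<le> r + 1" using B(2)[of z] by (simp add: Z_def)
    then show "z \<in> {z. z \<in> int_vecs \<and> norm z \<le> (r + 1) / B}"
      using z B(1) by (simp add: Z_def field_simps)
  qed
  then have fin: "finite Z" using finite_int_vecs_bounded finite_subset by blast
  \<comment> \<open>Adding \<open>r + 1\<close> makes the minimum exist and covers the vectors
    longer than that.\<close>
  define L where "L = insert (r + 1) {x \<in> (\<lambda>z. norm (M *v z)) ` Z. r < x}"
  have L: "finite L" "L \<noteq> {}" "\<And>x. x \<in> L \<Longrightarrow> r < x" using fin by (auto simp: L_def)
  have "r < Min L" using L by simp
  moreover have "Min L \<le> norm (M *v z)" if "z \<in> int_vecs" "r < norm (M *v z)" for z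
  proof (cases "norm (M *v z) \<le> r + 1")
    case True
    then show ?thesis using that L(1) by (intro Min_le) (auto simp: L_def Z_def)
  next
    case False
    moreover have "Min L \<le> r + 1" using L(1) by (intro Min_le) (auto simp: L_def)
    ultimately show ?thesis by linarith
  qed
  ultimately show ?thesis by (intro exI[of _ "Min L - r"]) auto
qed

text \<open>
  The theorem of Korkine and Zolotareff: otherwise \<open>(1 + tQ) M\<close> would, for small \<open>t > 0\<close>, still be
  admissible but have determinant less than 1.
\<close>

lemma critical_lattice_extreme:
  fixes M Q :: "real ^ 'd ^ 'd::finite"
  defines "r \<equiv> critical_radius TYPE('d)"
  assumes M: "det M = 1" and adm: "admissible r M"
    and Q: "transpose Q = Q" "trace Q = 0" "Q \<noteq> 0"
  shows "\<exists>z\<in>int_vecs. norm (M *v z) = r \<and> (M *v z) \<bullet> (Q *v (M *v z)) < 0"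
proof (rule ccontr)
  assume "\<not> ?thesis"
  then have nn: "0 \<le> (M *v z) \<bullet> (Q *v (M *v z))" if "z \<in> int_vecs" "norm (M *v z) = r" for z
    using that by force
  have r: "0 < r" unfolding r_def by (rule critical_radius_pos)
  obtain g where g: "0 < g" "\<And>z. z \<in> int_vecs \<Longrightarrow> r < norm (M *v z) \<Longrightarrow> r + g \<le> norm (M *v z)"
    using admissible_gap[of M r] M by auto
  \<comment> \<open>A vector of length at least \<open>r + g\<close> keeps at least the fraction
    \<open>1 - t * norm Q\<close> of it; the bound \<open>g / (r + g)\<close> is exactly what leaves
    length \<open>r\<close>.\<close>
  have "((\<lambda>t. t * norm Q) \<longlongrightarrow> 0 * norm Q) (at_right 0)" by (intro tendsto_intros)
  then have "\<forall>\<^sub>F t in at_right 0. t * norm Q < g / (r + g)"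
    using g(1) r by (intro order_tendstoD) auto
  moreover have "((\<lambda>t. det (mat 1 + t *\<^sub>R Q)) \<longlongrightarrow> det (mat 1 + 0 *\<^sub>R Q)) (at_right 0)"
    by (intro tendsto_intros)
  then have "\<forall>\<^sub>F t in at_right 0. 0 < det (mat 1 + t *\<^sub>R Q)" by (intro order_tendstoD) auto
  moreover have "\<forall>\<^sub>F t :: real in at_right 0. t > 0" by (simp add: eventually_at_right_less)
  ultimately have "\<forall>\<^sub>F t in at_right 0. t * norm Q < g / (r + g) \<and> 0 < det (mat 1 + t *\<^sub>R Q) \<and>
      0 < t \<and> det (mat 1 + t *\<^sub>R Q) < 1"
    using det_symmetric_traceless_less_1[OF Q] by eventually_elim blast
  then obtain t where t: "t * norm Q < g / (r + g)" "0 < det (mat 1 + t *\<^sub>R Q)" "0 < t"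
      "det (mat 1 + t *\<^sub>R Q) < 1"
    using eventually_happens'[OF trivial_limit_at_right_real] by blast
  have "admissible r ((mat 1 + t *\<^sub>R Q) ** M)"
    unfolding admissible_def
  proof (intro ballI impI)
    fix z :: "real ^ 'd" assume z: "z \<in> int_vecs" "z \<noteq> 0"
    define v where "v = M *v z"
    have eq: "((mat 1 + t *\<^sub>R Q) ** M) *v z = v + t *\<^sub>R (Q *v v)"
      by (simp add: v_def matrix_vector_mul_assoc[symmetric] matrix_vector_mult_add_rdistrib scaleR_matrix_vector_assoc)
    show "r \<le> norm (((mat 1 + t *\<^sub>R Q) ** M) *v z)"
    proof (cases "norm v = r")
      case True
      \<comment> \<open>A minimal vector has no length to spare: the linear term is nonnegative by
        assumption, and the quadratic one is a square.\<close>
      have "r\<^sup>2 \<le> (norm v)\<^sup>2 + 2 * t * (v \<bullet> (Q *v v)) + t\<^sup>2 * (norm (Q *v v))\<^sup>2"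
        using nn[OF z(1)] t(3) True by (simp add: v_def)
      also have "\<dots> = (norm (v + t *\<^sub>R (Q *v v)))\<^sup>2"
        by (simp add: power2_norm_eq_inner inner_add_left inner_add_right inner_commute algebra_simps)
          (simp add: power2_eq_square)
      finally show ?thesis unfolding eq by (rule power2_le_imp_le) simp
    next
      case False
      then have v: "r + g \<le> norm v"
        using g(2)[OF z(1)] admissibleD[OF adm z] by (simp add: v_def)
      have "norm (t *\<^sub>R (Q *v v)) \<le> t * norm Q * norm v"
        using norm_matrix_vector_le[of Q v] t(3) by (simp add: mult.assoc)
      then have "norm v - t * norm Q * norm v \<le> norm (v + t *\<^sub>R (Q *v v))"
        using norm_triangle_ineq2[of v "- (t *\<^sub>R (Q *v v))"] by simp
      moreover have "r \<le> norm v - t * norm Q * norm v"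
      proof -
        have "g / (r + g) < 1" using r g(1) by (simp add: field_simps)
        then have "t * norm Q \<le> 1" using t(1) by linarith
        have "r = (1 - g / (r + g)) * (r + g)" using r g(1) by (simp add: field_simps)
        also have "\<dots> \<le> (1 - t * norm Q) * norm v"
          using t(1) v r g(1) \<open>t * norm Q \<le> 1\<close> by (intro mult_mono) auto
        finally show ?thesis by (simp add: algebra_simps)
      qed
      ultimately show ?thesis unfolding eq by linarith
    qed
  qed
  moreover have det: "det ((mat 1 + t *\<^sub>R Q) ** M) = det (mat 1 + t *\<^sub>R Q)" using M by (simp add: det_mul)
  ultimately have "r ^ CARD('d) \<le> det (mat 1 + t *\<^sub>R Q) * r ^ CARD('d)"
    using admissible_power_le_det[of r "(mat 1 + t *\<^sub>R Q) ** M"] t(2) r by (simp add: r_def)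
  then have "1 \<le> det (mat 1 + t *\<^sub>R Q)" using r by simp
  then show False using t(4) by simp
qed

subsection \<open>Rigidity of nearly critical lattices\<close>

lemma admissible_mult_SL_int:
  assumes "\<gamma> \<in> SL_int" "admissible c M"
  shows "admissible c (M ** \<gamma>)"
  unfolding admissible_def
proof (intro ballI impI)
  fix z :: "real ^ 'a" assume z: "z \<in> int_vecs" "z \<noteq> 0"
  have g: "int_matrix \<gamma>" "det \<gamma> = 1" using assms(1) by (auto simp: SL_int_iff)
  have "invertible \<gamma>" using g(2) by (simp add: invertible_det_nz)
  then have "\<gamma> *v z \<noteq> 0"
    using z(2) inj_matrix_vector_mult by (metis injD matrix_vector_mult_0_right)
  moreover have "\<gamma> *v z \<in> int_vecs" using g(1) z(1) by (rule int_matrix_vector)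
  ultimately show "c \<le> norm ((M ** \<gamma>) *v z)"
    using admissibleD[OF assms(2), of "\<gamma> *v z"] by (simp add: matrix_vector_mul_assoc)
qed

lemma LIMSEQ_null_squeeze:
  fixes a b :: "nat \<Rightarrow> real"
  assumes "\<And>n. 0 \<le> a n" "\<And>n. a n \<le> b n" "b \<longlonglongrightarrow> 0"
  shows "a \<longlonglongrightarrow> 0"
  by (rule tendsto_sandwich[OF _ _ tendsto_const assms(3)]) (use assms(1,2) in auto)

lemma tendsto_trace [tendsto_intros]:
  fixes f :: "'a \<Rightarrow> real ^ 'n ^ 'n"
  shows "(f \<longlongrightarrow> A) F \<Longrightarrow> ((\<lambda>x. trace (f x)) \<longlongrightarrow> trace A) F"
  unfolding trace_def by (intro tendsto_intros)

lemma norm_mult_vector_sq: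
  fixes g :: "real ^ 'n ^ 'n"
  shows "(norm (g *v v))\<^sup>2 = (norm v)\<^sup>2 + v \<bullet> ((transpose g ** g - mat 1) *v v)"
proof -
  have "(norm (g *v v))\<^sup>2 = v \<bullet> ((transpose g ** g) *v v)"
    by (metis dot_lmul_matrix inner_commute matrix_vector_mul_assoc power2_norm_eq_inner transpose_matrix_vector)
  then show ?thesis
    by (simp add: matrix_vector_mult_diff_rdistrib inner_diff_right power2_norm_eq_inner)
qed

text \<open>If no \<open>C\<close> works, there are \<open>g n\<close> tending to 1 whose Gram
  defect \<open>Q n\<close> exceeds growing multiples of \<open>\<epsilon> n\<close>. After
  normalization a subsequence has a limit \<open>V\<close> of norm 1 that is symmetric, traceless
  and nonnegative on all minimal vectors, against \<open>critical_lattice_extreme\<close>.\<close>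

lemma critical_lattice_isolated:
  fixes M :: "real ^ 'd ^ 'd::finite"
  defines "r \<equiv> critical_radius TYPE('d)"
  assumes M: "det M = 1" and adm: "admissible r M"
  shows "\<exists>q>0. \<exists>C. \<forall>\<epsilon> g. 0 \<le> \<epsilon> \<longrightarrow> det g = 1 \<longrightarrow> norm (g - mat 1) < q \<longrightarrow>
    admissible (r - \<epsilon>) (g ** M) \<longrightarrow> norm (transpose g ** g - mat 1) \<le> C * \<epsilon>"
proof (rule ccontr)
  assume neg: "\<not> ?thesis"
  have r: "0 < r" unfolding r_def by (rule critical_radius_pos)
  have "\<exists>\<epsilon> g. 0 \<le> \<epsilon> \<and> det g = 1 \<and> norm (g - mat 1) < 1 / real (Suc n) \<and>
      admissible (r - \<epsilon>) (g ** M) \<and> real (Suc n) * \<epsilon> < norm (transpose g ** g - mat 1)" for n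
  proof (rule ccontr)
    assume *: "\<nexists>\<epsilon> g. 0 \<le> \<epsilon> \<and> det g = 1 \<and> norm (g - mat 1) < 1 / real (Suc n) \<and>
      admissible (r - \<epsilon>) (g ** M) \<and> real (Suc n) * \<epsilon> < norm (transpose g ** g - mat 1)"
    have "norm (transpose g ** g - mat 1) \<le> real (Suc n) * \<epsilon>"
      if "0 \<le> \<epsilon>" "det g = 1" "norm (g - mat 1) < 1 / real (Suc n)" "admissible (r - \<epsilon>) (g ** M)" for \<epsilon> g
      using * that by (meson not_le_imp_less)
    moreover have "0 < 1 / real (Suc n)" by simp
    ultimately show False using neg by blast
  qed
  then obtain \<epsilon> g where e: "\<And>n. 0 \<le> \<epsilon> n" and det: "\<And>n. det (g n) = 1"
    and close: "\<And>n. norm (g n - mat 1) < 1 / real (Suc n)" and ad: "\<And>n. admissible (r - \<epsilon> n) (g n ** M)"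
    and big: "\<And>n. real (Suc n) * \<epsilon> n < norm (transpose (g n) ** g n - mat 1)"
    by metis
  define Q where "Q n = transpose (g n) ** g n - mat 1" for n
  have Qpos: "0 < norm (Q n)" for n
  proof -
    have "0 \<le> real (Suc n) * \<epsilon> n" using e[of n] by simp
    then show ?thesis using big[of n] unfolding Q_def by linarith
  qed
  have "(\<lambda>n. norm (g n - mat 1)) \<longlonglongrightarrow> 0"
    by (rule LIMSEQ_null_squeeze[OF norm_ge_zero less_imp_le[OF close] LIMSEQ_Suc[OF lim_1_over_n]])
  then have g1: "g \<longlonglongrightarrow> mat 1" using tendsto_norm_zero_iff LIM_zero_iff by blast
  have "Q \<longlonglongrightarrow> transpose (mat 1) ** mat 1 - mat 1"
    unfolding Q_def by (intro tendsto_intros g1)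
  then have Q0: "Q \<longlonglongrightarrow> 0" by simp
  define U where "U n = Q n /\<^sub>R norm (Q n)" for n
  have "U n \<in> sphere 0 1" for n using Qpos[of n] by (simp add: U_def)
  then obtain V s where V: "V \<in> sphere 0 1" and s: "strict_mono s" and lim: "(U \<circ> s) \<longlonglongrightarrow> V"
    using compact_sphere[of "0 :: real ^ 'd ^ 'd" 1] unfolding compact_def by metis
  note sub = LIMSEQ_subseq_LIMSEQ[OF _ s, unfolded comp_def]
  have limU: "(\<lambda>n. U (s n)) \<longlonglongrightarrow> V" using lim by (simp add: comp_def)
  have "transpose (U n) = U n" for n
  proof -
    have "transpose (Q n) = Q n"
      unfolding Q_def by (simp add: bounded_linear.linear[OF bounded_linear_transpose, THEN linear_diff] matrix_transpose_mul)
    then show ?thesis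
      unfolding U_def by (simp add: bounded_linear.linear[OF bounded_linear_transpose, THEN linear_scale])
  qed
  then have "(\<lambda>n. U (s n)) \<longlonglongrightarrow> transpose V"
    using tendsto_transpose[OF limU] by simp
  then have symV: "transpose V = V" using limU LIMSEQ_unique by blast
  \<comment> \<open>\<open>mat 1 + Q n\<close> has determinant 1, so the first-order expansion says
    that the trace of \<open>Q n\<close> is negligible against its norm.\<close>
  have "(\<lambda>n. (det (mat 1 + Q (s n)) - 1 - trace (Q (s n))) / norm (Q (s n))) \<longlonglongrightarrow> 0"
  proof (rule filterlim_compose[OF det_first_order])
    show "filterlim (\<lambda>n. Q (s n)) (at 0) sequentially"
      using sub[OF Q0] Qpos by (intro filterlim_atI) (auto intro!: always_eventually)
  qed
  moreover have "det (mat 1 + Q n) = 1" for n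
    unfolding Q_def by (simp add: det_mul det_transpose det)
  ultimately have "(\<lambda>n. - trace (U (s n))) \<longlonglongrightarrow> 0"
    by (simp add: U_def trace_scaleR field_simps)
  moreover have "(\<lambda>n. - trace (U (s n))) \<longlonglongrightarrow> - trace V" by (intro tendsto_intros limU)
  ultimately have "0 = - trace V" by (rule LIMSEQ_unique)
  then have trV: "trace V = 0" by simp
  have "0 \<le> (M *v z) \<bullet> (V *v (M *v z))" if z: "z \<in> int_vecs" "norm (M *v z) = r" for z
  proof -
    define v where "v = M *v z"
    have "z \<noteq> 0" using z(2) r by auto
    \<comment> \<open>A minimal vector is shortened by at most \<open>\<epsilon> n\<close>, which
      costs at most \<open>2 * r * \<epsilon> n\<close> in the square. Division by
      \<open>norm (Q n)\<close>, which exceeds \<open>real (Suc n) * \<epsilon> n\<close>, makes the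
      loss vanish in the limit.\<close>
    have low: "- 2 * r / real (Suc n) \<le> v \<bullet> (U n *v v)" for n
    proof -
      have "r - \<epsilon> n \<le> norm (g n *v v)"
        using admissibleD[OF ad z(1) \<open>z \<noteq> 0\<close>, of n] by (simp add: v_def matrix_vector_mul_assoc)
      then have "r\<^sup>2 - 2 * r * \<epsilon> n \<le> (norm (g n *v v))\<^sup>2"
      proof (cases "\<epsilon> n \<le> r")
        case True
        then have "(r - \<epsilon> n)\<^sup>2 \<le> (norm (g n *v v))\<^sup>2"
          using \<open>r - \<epsilon> n \<le> norm (g n *v v)\<close> by (intro power_mono) auto
        then show ?thesis using zero_le_power2[of "\<epsilon> n"] unfolding power2_diff by linarith
      next
        case False
        then have "r * r \<le> r * \<epsilon> n" using r by (intro mult_left_mono) auto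
        moreover have "0 \<le> r * \<epsilon> n" using r e by simp
        ultimately have "r\<^sup>2 - 2 * r * \<epsilon> n \<le> 0" by (simp add: power2_eq_square)
        then show ?thesis using zero_le_power2[of "norm (g n *v v)"] by linarith
      qed
      then have "- 2 * r * \<epsilon> n \<le> v \<bullet> (Q n *v v)"
        unfolding norm_mult_vector_sq[of "g n" v] Q_def using z(2) by (simp add: v_def)
      moreover have "\<epsilon> n \<le> norm (Q n) / real (Suc n)"
        using big[of n] unfolding Q_def by (simp add: field_simps del: of_nat_Suc)
      then have "- 2 * r * (norm (Q n) / real (Suc n)) \<le> - 2 * r * \<epsilon> n"
        using r by (intro mult_left_mono_neg) auto
      ultimately have "- 2 * r * (norm (Q n) / real (Suc n)) \<le> v \<bullet> (Q n *v v)" by linarith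
      then have "- 2 * r * (norm (Q n) / real (Suc n)) / norm (Q n) \<le> v \<bullet> (Q n *v v) / norm (Q n)"
        using Qpos[of n] by (intro divide_right_mono) auto
      moreover have "- 2 * r * (norm (Q n) / real (Suc n)) / norm (Q n) = - 2 * r / real (Suc n)"
        using Qpos[of n] by (simp add: field_simps del: of_nat_Suc)
      moreover have "v \<bullet> (Q n *v v) / norm (Q n) = v \<bullet> (U n *v v)"
        by (simp add: U_def scaleR_matrix_vector_assoc[symmetric] divide_inverse mult.commute)
      ultimately show ?thesis by simp
    qed
    have "(\<lambda>n. v \<bullet> (U (s n) *v v)) \<longlonglongrightarrow> v \<bullet> (V *v v)"
      by (intro tendsto_intros limU)
    moreover have "(\<lambda>n. - 2 * r / real (Suc n)) \<longlonglongrightarrow> 0"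
      by (intro LIMSEQ_Suc[OF lim_const_over_n])
    from sub[OF this] have "(\<lambda>n. - 2 * r / real (Suc (s n))) \<longlonglongrightarrow> 0" .
    ultimately show ?thesis unfolding v_def[symmetric]
      using low by (intro tendsto_le[OF sequentially_bot]) (auto intro: always_eventually)
  qed
  moreover have "V \<noteq> 0" using V by auto
  ultimately show False
    using critical_lattice_extreme[OF M adm[unfolded r_def] symV trV] unfolding r_def by (meson not_le)
qed

lemma admissible_limit:
  assumes lim: "X \<longlonglongrightarrow> M" "c \<longlonglongrightarrow> c\<^sub>0" and adm: "\<And>n. admissible (c n) (X n)"
  shows "admissible c\<^sub>0 M"
  unfolding admissible_def
proof (intro ballI impI)
  fix z :: "real ^ 'a" assume z: "z \<in> int_vecs" "z \<noteq> 0"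
  have "(\<lambda>n. norm (X n *v z)) \<longlonglongrightarrow> norm (M *v z)" by (intro tendsto_intros lim)
  with lim(2) show "c\<^sub>0 \<le> norm (M *v z)"
    by (rule LIMSEQ_le) (use admissibleD[OF adm z] in auto)
qed

lemma norm_inverse_near_identity:
  fixes g g' :: "real ^ 'n ^ 'n"
  assumes g: "norm (g - mat 1) \<le> 1 / 2" and inv: "g ** g' = mat 1"
  shows "norm g' \<le> real CARD('n) * (real CARD('n) * 2)"
proof (rule norm_matrix_le_columns)
  fix j
  define x where "x = column j g'"
  have "g *v x = axis j 1"
    unfolding x_def matrix_vector_mult_basis[symmetric] matrix_vector_mul_assoc inv by simp
  moreover have "g *v x = x + (g - mat 1) *v x" by (simp add: matrix_vector_mult_diff_rdistrib)
  ultimately have "norm x - norm ((g - mat 1) *v x) \<le> 1"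
    using norm_triangle_ineq2[of x "- ((g - mat 1) *v x)"] by simp
  moreover have "norm ((g - mat 1) *v x) \<le> 1 / 2 * norm x"
    using norm_matrix_vector_le[of "g - mat 1" x] mult_right_mono[OF g norm_ge_zero[of x]] by linarith
  ultimately show "norm (column j g') \<le> 2" unfolding x_def[symmetric] by linarith
qed

text \<open>Both \<open>M\<close> and \<open>h ** M\<close> are compared with one critical lattice,
  a limit of bounded representatives. If \<open>g\<close> leads from it to \<open>M\<close>, the
  Gram defects of \<open>g\<close> and \<open>h ** g\<close> are at most a multiple of \<epsilon>,
  and they differ by \<open>transpose g ** (transpose h ** h - mat 1) ** g\<close>. Compactness
  makes the constants uniform in \<open>M\<close>.\<close>

lemma near_critical_rigid:
  fixes r :: real
  defines "r \<equiv> critical_radius TYPE('d::finite)"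
  shows "\<exists>q>0. \<exists>C>0. \<forall>\<epsilon> (M :: real ^ 'd ^ 'd) h. 0 \<le> \<epsilon> \<longrightarrow> \<epsilon> < q \<longrightarrow> det M = 1 \<longrightarrow> det h = 1 \<longrightarrow>
    norm (h - mat 1) < q \<longrightarrow> admissible (r - \<epsilon>) M \<longrightarrow> admissible (r - \<epsilon>) (h ** M) \<longrightarrow>
    norm (transpose h ** h - mat 1) \<le> C * \<epsilon>"
proof (rule ccontr)
  assume neg: "\<not> ?thesis"
  have r: "0 < r" unfolding r_def by (rule critical_radius_pos)
  define qn where "qn n = min (r / 2) (1 / real (Suc n))" for n
  have qn: "0 < qn n" "qn n \<le> r / 2" "qn n \<le> 1 / real (Suc n)" for n
    using r by (auto simp: qn_def)
  obtain R where R: "\<And>M :: real ^ 'd ^ 'd. det M = 1 \<Longrightarrow> admissible (r / 2) M \<Longrightarrow> \<exists>\<gamma>\<in>SL_int. norm (M ** \<gamma>) \<le> R"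
    using admissible_bounded_representative[where 'd = 'd] unfolding r_def by metis
  have "\<exists>\<epsilon> (M :: real ^ 'd ^ 'd) h. 0 \<le> \<epsilon> \<and> \<epsilon> < qn n \<and> det M = 1 \<and> det h = 1 \<and> norm (h - mat 1) < qn n \<and>
      admissible (r - \<epsilon>) M \<and> admissible (r - \<epsilon>) (h ** M) \<and>
      real (Suc n) * \<epsilon> < norm (transpose h ** h - mat 1) \<and> norm M \<le> R" for n
  proof -
    have n: "0 < real (Suc n)" by simp
    have "\<exists>\<epsilon> (M :: real ^ 'd ^ 'd) h. \<not> (0 \<le> \<epsilon> \<longrightarrow> \<epsilon> < qn n \<longrightarrow> det M = 1 \<longrightarrow> det h = 1 \<longrightarrow>
      norm (h - mat 1) < qn n \<longrightarrow> admissible (r - \<epsilon>) M \<longrightarrow> admissible (r - \<epsilon>) (h ** M) \<longrightarrow>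
      norm (transpose h ** h - mat 1) \<le> real (Suc n) * \<epsilon>)"
      using neg qn(1)[of n] n by blast
    then obtain \<epsilon> h and M :: "real ^ 'd ^ 'd" where *: "0 \<le> \<epsilon>" "\<epsilon> < qn n" "det M = 1" "det h = 1" "norm (h - mat 1) < qn n"
      "admissible (r - \<epsilon>) M" "admissible (r - \<epsilon>) (h ** M)"
      "real (Suc n) * \<epsilon> < norm (transpose h ** h - mat 1)"
      unfolding not_imp not_le by blast
    have "admissible (r / 2) M"
      unfolding admissible_def
    proof (intro ballI impI)
      fix z :: "real ^ 'd" assume "z \<in> int_vecs" "z \<noteq> 0"
      then show "r / 2 \<le> norm (M *v z)" using admissibleD[OF *(6)] *(2) qn(2)[of n] by force
    qed
    then obtain \<gamma> where g: "\<gamma> \<in> SL_int" "norm (M ** \<gamma>) \<le> R" using R *(3) by blast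
    \<comment> \<open>Passing to another basis of the lattice changes neither \<open>h\<close> nor
      admissibility, so the counterexamples may be taken from a bounded set.\<close>
    have "det (M ** \<gamma>) = 1" using *(3) g(1) by (simp add: det_mul SL_int_iff)
    moreover have "admissible (r - \<epsilon>) (M ** \<gamma>)" "admissible (r - \<epsilon>) (h ** (M ** \<gamma>))"
      using admissible_mult_SL_int[OF g(1)] *(6,7) by (auto simp: matrix_mul_assoc)
    ultimately show ?thesis using * g(2) by blast
  qed
  then obtain \<epsilon> h and X :: "nat \<Rightarrow> real ^ 'd ^ 'd" where e: "\<And>n. 0 \<le> \<epsilon> n" "\<And>n. \<epsilon> n < qn n"
    and det: "\<And>n. det (X n) = 1" "\<And>n. det (h n) = 1" and close: "\<And>n. norm (h n - mat 1) < qn n"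
    and ad: "\<And>n. admissible (r - \<epsilon> n) (X n)" "\<And>n. admissible (r - \<epsilon> n) (h n ** X n)"
    and big: "\<And>n. real (Suc n) * \<epsilon> n < norm (transpose (h n) ** h n - mat 1)" and bnd: "\<And>n. norm (X n) \<le> R"
    by metis
  have q0: "qn \<longlonglongrightarrow> 0"
    by (rule LIMSEQ_null_squeeze[OF less_imp_le[OF qn(1)] qn(3) LIMSEQ_Suc[OF lim_1_over_n]])
  have "(\<lambda>n. norm (h n - mat 1)) \<longlonglongrightarrow> 0"
    by (rule LIMSEQ_null_squeeze[OF norm_ge_zero less_imp_le[OF close] q0])
  then have h1: "h \<longlonglongrightarrow> mat 1" using tendsto_norm_zero_iff LIM_zero_iff by blast
  have e0: "\<epsilon> \<longlonglongrightarrow> 0"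
    by (rule LIMSEQ_null_squeeze[OF e(1) less_imp_le[OF e(2)] q0])
  have "X n \<in> cball 0 R" for n using bnd by simp
  then obtain M s where s: "strict_mono s" and lim: "(X \<circ> s) \<longlonglongrightarrow> M"
    using compact_cball[of "0 :: real ^ 'd ^ 'd" R] unfolding compact_def by metis
  note sub = LIMSEQ_subseq_LIMSEQ[OF _ s, unfolded comp_def]
  have limX: "(\<lambda>n. X (s n)) \<longlonglongrightarrow> M" using lim by (simp add: comp_def)
  have "(\<lambda>n. r - \<epsilon> (s n)) \<longlonglongrightarrow> r - 0" by (intro tendsto_intros sub[OF e0])
  from admissible_limit[OF limX this] have admM: "admissible r M" using ad(1) by simp
  have "(\<lambda>n. det (X (s n))) \<longlonglongrightarrow> det M" by (intro tendsto_intros limX)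
  then have detM: "det M = 1" unfolding det by (rule LIMSEQ_unique[OF tendsto_const, symmetric])
  obtain q C where q: "0 < q" and C: "\<And>\<epsilon> g. 0 \<le> \<epsilon> \<Longrightarrow> det g = 1 \<Longrightarrow> norm (g - mat 1) < q \<Longrightarrow>
    admissible (r - \<epsilon>) (g ** M) \<Longrightarrow> norm (transpose g ** g - mat 1) \<le> C * \<epsilon>"
    using critical_lattice_isolated[OF detM] admM unfolding r_def by metis
  define M' where "M' = matrix_inv M"
  have inv: "M ** M' = mat 1" "M' ** M = mat 1" using matrix_inv_works[of M] detM by (auto simp: M'_def)
  have detM': "det M' = 1" using arg_cong[OF inv(1), of det] detM by (simp add: det_mul)
  define g where "g n = X (s n) ** M'" for n
  have "(\<lambda>n. g n) \<longlonglongrightarrow> M ** M'" unfolding g_def by (intro tendsto_intros limX)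
  then have g1: "(\<lambda>n. g n) \<longlonglongrightarrow> mat 1" by (simp add: inv)
  have "(\<lambda>n. h (s n) ** g n) \<longlonglongrightarrow> mat 1 ** mat 1" by (intro tendsto_intros g1 sub[OF h1])
  then have hg1: "(\<lambda>n. h (s n) ** g n) \<longlonglongrightarrow> mat 1" by simp
  define D where "D = real CARD('d) * (real CARD('d) * 2)"
  have "\<forall>\<^sub>F n in sequentially. dist (g n) (mat 1) < min q (1 / 2)"
    using q by (intro tendstoD[OF g1]) simp
  moreover have "\<forall>\<^sub>F n in sequentially. dist (h (s n) ** g n) (mat 1) < q"
    by (intro tendstoD[OF hg1] q)
  \<comment> \<open>Undoing the conjugation by \<open>g n\<close> costs the norm of its inverse
    twice, at most \<open>D * D\<close>; the constants of the counterexamples outgrow the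
    result.\<close>
  moreover have "\<forall>\<^sub>F n in sequentially. D * (2 * C) * D < real (Suc n)"
    using eventually_gt_at_top[of "nat \<lceil>D * (2 * C) * D\<rceil>"] by eventually_elim linarith
  ultimately have "\<forall>\<^sub>F n in sequentially. False"
  proof eventually_elim
    case (elim n)
    let ?H = "transpose (h (s n)) ** h (s n) - mat 1"
    have gM: "g n ** M = X (s n)" unfolding g_def by (simp add: matrix_mul_assoc[symmetric] inv)
    have detg: "det (g n) = 1" unfolding g_def by (simp add: det_mul det detM')
    have a: "norm (transpose (g n) ** g n - mat 1) \<le> C * \<epsilon> (s n)"
      using elim(1) ad(1) e(1) detg by (intro C) (simp_all add: dist_norm gM)
    have b: "norm (transpose (h (s n) ** g n) ** (h (s n) ** g n) - mat 1) \<le> C * \<epsilon> (s n)"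
    proof (rule C[OF e(1)])
      show "norm (h (s n) ** g n - mat 1) < q" using elim(2) by (simp add: dist_norm)
      show "admissible (r - \<epsilon> (s n)) (h (s n) ** g n ** M)"
        using ad(2)[of "s n"] unfolding gM[symmetric] by (simp only: matrix_mul_assoc)
    qed (simp add: det_mul detg det)
    interpret mm: bounded_bilinear "(**) :: real ^ 'd ^ 'd \<Rightarrow> real ^ 'd ^ 'd \<Rightarrow> real ^ 'd ^ 'd"
      by (rule bounded_bilinear_matrix_mult)
    have eq: "transpose (g n) ** ?H ** g n = (transpose (h (s n) ** g n) ** (h (s n) ** g n) - mat 1) -
        (transpose (g n) ** g n - mat 1)"
      by (simp add: mm.diff_left mm.diff_right matrix_transpose_mul matrix_mul_assoc)
    have c: "norm (transpose (g n) ** ?H ** g n) \<le> 2 * C * \<epsilon> (s n)"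
      unfolding eq using norm_triangle_ineq4[of "transpose (h (s n) ** g n) ** (h (s n) ** g n) - mat 1"
        "transpose (g n) ** g n - mat 1"] a b by linarith
    define g' where "g' = matrix_inv (g n)"
    have inv': "g n ** g' = mat 1" using matrix_inv_works[of "g n"] detg by (simp add: g'_def)
    have g': "norm g' \<le> D" unfolding D_def
      by (rule norm_inverse_near_identity[OF _ inv']) (use elim(1) in \<open>simp add: dist_norm\<close>)
    have tr: "transpose g' ** transpose (g n) = mat 1"
      using inv' by (metis matrix_transpose_mul transpose_mat)
    define Y where "Y = transpose (g n) ** ?H ** g n"
    have H: "?H = transpose g' ** Y ** g'"
    proof -
      have "transpose g' ** Y ** g' = (transpose g' ** transpose (g n)) ** ?H ** (g n ** g')"
        unfolding Y_def by (simp only: matrix_mul_assoc)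
      then show ?thesis by (simp only: tr inv' matrix_mul_lid matrix_mul_rid)
    qed
    have "norm ?H = norm (transpose g' ** Y ** g')" by (rule arg_cong[OF H])
    also have "\<dots> \<le> norm (transpose g' ** Y) * norm g'" by (rule norm_matrix_mult_le)
    also have "\<dots> \<le> (norm (transpose g') * norm Y) * norm g'"
      by (intro mult_right_mono norm_matrix_mult_le norm_ge_zero)
    also have "\<dots> \<le> (D * (2 * C * \<epsilon> (s n))) * D"
    proof -
      have D: "0 \<le> D" by (simp add: D_def)
      have Y: "norm Y \<le> 2 * C * \<epsilon> (s n)" using c by (simp only: Y_def)
      then have C: "0 \<le> 2 * C * \<epsilon> (s n)" using norm_ge_zero[of Y] by linarith
      show ?thesis
        unfolding norm_transpose
        by (rule mult_mono[OF mult_mono[OF g' Y D norm_ge_zero] g' mult_nonneg_nonneg[OF D C] norm_ge_zero])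
    qed
    also have "\<dots> = (D * (2 * C) * D) * \<epsilon> (s n)" by simp
    also have "\<dots> \<le> real (Suc (s n)) * \<epsilon> (s n)"
    proof (rule mult_right_mono)
      have "real (Suc n) \<le> real (Suc (s n))" using seq_suble[OF s, of n] by simp
      then show "D * (2 * C) * D \<le> real (Suc (s n))" using elim(3) by linarith
    qed (use e in simp)
    finally show False using big[of "s n"] by linarith
  qed
  then show False by simp
qed

subsection \<open>The critical locus\<close>

lemma SL_int_inverse:
  assumes "\<gamma> \<in> SL_int"
  shows "\<exists>\<gamma>'\<in>SL_int. \<gamma> ** \<gamma>' = mat 1 \<and> \<gamma>' ** \<gamma> = mat 1"
proof -
  have g: "int_matrix \<gamma>" "det \<gamma> = 1" using assms by (auto simp: SL_int_iff)
  then obtain W where W: "int_matrix W" "W ** \<gamma> = mat 1"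
    using int_matrix_adjugate[of \<gamma>] by auto
  have "det W = 1" using arg_cong[OF W(2), of det] g(2) by (simp add: det_mul)
  then show ?thesis using W matrix_left_right_inverse[of W \<gamma>] by (auto simp: SL_int_iff)
qed

lemma SL_int_mult: "\<gamma> \<in> SL_int \<Longrightarrow> \<gamma>' \<in> SL_int \<Longrightarrow> \<gamma> ** \<gamma>' \<in> SL_int"
  by (simp add: SL_int_iff int_matrix_mult det_mul)

lemma SO_real_iff: "k \<in> SO_real \<longleftrightarrow> transpose k ** k = mat 1 \<and> det k = 1"
  by (simp add: SO_real_def orthogonal_matrix)

text \<open>Compactness is used for matrices: \<open>K\<close> contains a representative of every
  critical lattice. A matrix of \<open>K\<close> near \<open>G\<close> is \<open>k ** G\<close> with
  \<open>k\<close> a rotation, by rigidity with \<epsilon> = 0, so each set of a finite subcover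
  accounts for one orbit.\<close>

lemma critical_lattices_finite:
  "\<exists>\<G> :: (real ^ 'd ^ 'd::finite) set. finite \<G> \<and> (\<forall>G\<in>\<G>. det G = 1) \<and>
     (\<forall>M. det M = 1 \<longrightarrow> admissible (critical_radius TYPE('d)) M \<longrightarrow>
        (\<exists>G\<in>\<G>. \<exists>k\<in>SO_real. \<exists>\<gamma>\<in>SL_int. M = k ** G ** \<gamma>))"
proof -
  define r where "r = critical_radius TYPE('d)"
  have r: "0 < r" unfolding r_def by (rule critical_radius_pos)
  obtain R where R: "\<And>M :: real ^ 'd ^ 'd. det M = 1 \<Longrightarrow> admissible (r / 2) M \<Longrightarrow> \<exists>\<gamma>\<in>SL_int. norm (M ** \<gamma>) \<le> R"
    using admissible_bounded_representative[where 'd = 'd] unfolding r_def by metis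
  define K where "K = {M :: real ^ 'd ^ 'd. det M = 1 \<and> admissible r M \<and> norm M \<le> R}"
  have K: "compact K"
    unfolding compact_eq_bounded_closed
  proof
    show "bounded K" by (auto simp: K_def bounded_iff)
    show "closed K"
      unfolding closed_sequential_limits
    proof (intro allI impI, elim conjE)
      fix X M assume X: "\<forall>n. X n \<in> K" and lim: "X \<longlonglongrightarrow> M"
      have "(\<lambda>n. det (X n)) \<longlonglongrightarrow> det M" by (intro tendsto_intros lim)
      moreover have "det (X n) = 1" for n using X by (simp add: K_def)
      ultimately have "det M = 1" by (simp add: LIMSEQ_const_iff)
      moreover have "admissible r M"
        by (rule admissible_limit[OF lim tendsto_const]) (use X in \<open>simp add: K_def\<close>)
      moreover have "norm M \<le> R"
        by (rule LIMSEQ_le_const2[OF tendsto_norm[OF lim]]) (use X in \<open>auto simp: K_def\<close>)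
      ultimately show "M \<in> K" by (simp add: K_def)
    qed
  qed
  have "\<exists>q>0. \<forall>g. det g = 1 \<longrightarrow> norm (g - mat 1) < q \<longrightarrow> admissible r (g ** M) \<longrightarrow> g \<in> SO_real"
    if M: "M \<in> K" for M
  proof -
    have "det M = 1" "admissible (critical_radius TYPE('d)) M" using M by (auto simp: K_def r_def)
    from critical_lattice_isolated[OF this]
    obtain q C where q: "0 < q" and C: "\<forall>\<epsilon> g. 0 \<le> \<epsilon> \<longrightarrow> det g = 1 \<longrightarrow> norm (g - mat 1) < q \<longrightarrow>
      admissible (r - \<epsilon>) (g ** M) \<longrightarrow> norm (transpose g ** g - mat 1) \<le> C * \<epsilon>"
      unfolding r_def by blast
    have "g \<in> SO_real" if "det g = 1" "norm (g - mat 1) < q" "admissible r (g ** M)" for g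
      using C[rule_format, of 0 g] that by (simp add: SO_real_iff)
    then show ?thesis using q by blast
  qed
  then obtain q where q: "\<And>M. M \<in> K \<Longrightarrow> 0 < q M" "\<And>M g. M \<in> K \<Longrightarrow> det g = 1 \<Longrightarrow> norm (g - mat 1) < q M \<Longrightarrow>
      admissible r (g ** M) \<Longrightarrow> g \<in> SO_real"
    by metis
  define O' where "O' M = {X. norm (X ** matrix_inv M - mat 1) < q M}" for M
  have "open (O' M)" for M
    unfolding O'_def by (intro open_Collect_less continuous_intros)
  moreover have "K \<subseteq> (\<Union>M\<in>K. O' M)"
  proof
    fix M assume M: "M \<in> K"
    then have "M ** matrix_inv M = mat 1" by (intro matrix_inv_works) (simp add: K_def)
    then have "M \<in> O' M" using q(1)[OF M] by (simp add: O'_def)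
    then show "M \<in> (\<Union>M\<in>K. O' M)" using M by blast
  qed
  ultimately obtain \<G> where G: "\<G> \<subseteq> K" "finite \<G>" "K \<subseteq> (\<Union>M\<in>\<G>. O' M)"
    using compactE_image[OF K, of K O'] by metis
  have "\<exists>G\<in>\<G>. \<exists>k\<in>SO_real. \<exists>\<gamma>\<in>SL_int. M = k ** G ** \<gamma>" if M: "det M = 1" "admissible r M" for M
  proof -
    have "admissible (r / 2) M"
      unfolding admissible_def using admissibleD[OF M(2)] r by force
    then obtain \<gamma> where g: "\<gamma> \<in> SL_int" "norm (M ** \<gamma>) \<le> R" using R M(1) by blast
    have "det (M ** \<gamma>) = 1" using M(1) g(1) by (simp add: det_mul SL_int_iff)
    then have "M ** \<gamma> \<in> K" using g admissible_mult_SL_int[OF g(1) M(2)] by (simp add: K_def)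
    then obtain G where G': "G \<in> \<G>" "M ** \<gamma> \<in> O' G" using G(3) by blast
    have GK: "G \<in> K" using G(1) G'(1) by blast
    then have inv: "G ** matrix_inv G = mat 1" "matrix_inv G ** G = mat 1"
      using matrix_inv_works[of G] by (auto simp: K_def)
    define k where "k = M ** \<gamma> ** matrix_inv G"
    have kG: "k ** G = M ** \<gamma>"
      unfolding k_def using inv(2) by (simp add: matrix_mul_assoc[symmetric])
    have "det (k ** G) = 1" unfolding kG by fact
    then have "det k = 1" using GK by (simp add: det_mul K_def)
    moreover have "norm (k - mat 1) < q G" using G'(2) by (simp add: O'_def k_def)
    moreover have "admissible r (k ** G)"
      unfolding kG by (rule admissible_mult_SL_int[OF g(1) M(2)])
    ultimately have "k \<in> SO_real" using q(2)[OF GK] by blast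
    moreover obtain \<gamma>' where "\<gamma>' \<in> SL_int" "\<gamma> ** \<gamma>' = mat 1" using SL_int_inverse[OF g(1)] by blast
    moreover then have "M = k ** G ** \<gamma>'" unfolding kG by (simp add: matrix_mul_assoc[symmetric])
    ultimately show ?thesis using G'(1) by blast
  qed
  moreover have "\<forall>G\<in>\<G>. det G = 1" using G(1) by (auto simp: K_def)
  ultimately show ?thesis using G(2) unfolding r_def by blast
qed

lemma mat_1_SL_int: "mat 1 \<in> SL_int"
  by (simp add: SL_int_iff int_matrix_mat_1)

lemma lat_coset_mult_SL_int:
  assumes "\<gamma> \<in> SL_int"
  shows "lat_coset (g ** \<gamma>) = lat_coset g"
proof -
  obtain \<gamma>' where g': "\<gamma>' \<in> SL_int" "\<gamma> ** \<gamma>' = mat 1" using SL_int_inverse[OF assms] by blast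
  show ?thesis
  proof (intro equalityI subsetI)
    fix x assume "x \<in> lat_coset (g ** \<gamma>)"
    then obtain \<delta> where "\<delta> \<in> SL_int" "x = g ** \<gamma> ** \<delta>" by (auto simp: lat_coset_def)
    then have "x = g ** (\<gamma> ** \<delta>)" "\<gamma> ** \<delta> \<in> SL_int"
      using SL_int_mult[OF assms] by (auto simp: matrix_mul_assoc)
    then show "x \<in> lat_coset g" by (auto simp: lat_coset_def)
  next
    fix x assume "x \<in> lat_coset g"
    then obtain \<delta> where d: "\<delta> \<in> SL_int" "x = g ** \<delta>" by (auto simp: lat_coset_def)
    have "g ** \<gamma> ** (\<gamma>' ** \<delta>) = g ** (\<gamma> ** \<gamma>') ** \<delta>" by (simp only: matrix_mul_assoc)
    then have "x = g ** \<gamma> ** (\<gamma>' ** \<delta>)" using d g'(2) by simp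
    then show "x \<in> lat_coset (g ** \<gamma>)" using SL_int_mult[OF g'(1) d(1)] by (auto simp: lat_coset_def)
  qed
qed

lemma lat_act_coset: "lat_act k (lat_coset g) = lat_coset (k ** g)"
  by (auto simp: lat_act_def lat_coset_def matrix_mul_assoc image_iff) (metis matrix_mul_assoc)

lemma critical_locus_admissible:
  assumes "x \<in> critical_locus"
  shows "\<exists>M :: real ^ 'd ^ 'd::finite. x = lat_coset M \<and> det M = 1 \<and> admissible (critical_radius TYPE('d)) M"
proof -
  obtain M where M: "x = lat_coset M" "det M = 1"
    and x: "\<And>v. v \<in> lattice_at x \<Longrightarrow> v \<noteq> 0 \<Longrightarrow> critical_radius TYPE('d) \<le> norm v"
    using assms unfolding critical_locus_def lat_space_def SL_real_def by force
  have "M \<in> x" unfolding M(1) lat_coset_def using mat_1_SL_int by (auto intro!: exI[of _ "mat 1"])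
  have "critical_radius TYPE('d) \<le> norm (M *v z)" if z: "z \<in> int_vecs" "z \<noteq> 0" for z
  proof (rule x)
    show "M *v z \<in> lattice_at x"
      using \<open>M \<in> x\<close> z(1) unfolding lattice_at_def lattice_of_def by blast
    have "inj ((*v) M)" using M(2) by (intro inj_matrix_vector_mult) (simp add: invertible_det_nz)
    then show "M *v z \<noteq> 0" using z(2) by (metis injD matrix_vector_mult_0_right)
  qed
  then show ?thesis using M unfolding admissible_def by blast
qed

lemma critical_locus_subset_orbits:
  "\<exists>\<G> :: (real ^ 'd ^ 'd::finite) set. finite \<G> \<and> (\<forall>G\<in>\<G>. det G = 1) \<and>
     critical_locus \<subseteq> (\<Union>G\<in>\<G>. lat_orbit SO_real (lat_coset G))"
proof -
  obtain \<G> :: "(real ^ 'd ^ 'd) set" where G: "finite \<G>" "\<forall>G\<in>\<G>. det G = 1"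
    "\<And>M. det M = 1 \<Longrightarrow> admissible (critical_radius TYPE('d)) M \<Longrightarrow> \<exists>G\<in>\<G>. \<exists>k\<in>SO_real. \<exists>\<gamma>\<in>SL_int. M = k ** G ** \<gamma>"
    using critical_lattices_finite by metis
  have "x \<in> (\<Union>G\<in>\<G>. lat_orbit SO_real (lat_coset G))" if x: "x \<in> critical_locus" for x
  proof -
    obtain M where M: "x = lat_coset M" "det M = 1" "admissible (critical_radius TYPE('d)) M"
      using critical_locus_admissible[OF x] by blast
    obtain G k \<gamma> where "G \<in> \<G>" "k \<in> SO_real" "\<gamma> \<in> SL_int" "M = k ** G ** \<gamma>" using G(3)[OF M(2,3)] by blast
    moreover then have "x = lat_act k (lat_coset G)" using M(1) by (simp add: lat_coset_mult_SL_int lat_act_coset)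
    ultimately show ?thesis unfolding lat_orbit_def by blast
  qed
  then show ?thesis using G(1,2) by blast
qed

lemma Union_lat_orbit:
  "\<Union> (lat_orbit SO_real (lat_coset G)) = {k ** G ** \<gamma> | k \<gamma>. k \<in> SO_real \<and> \<gamma> \<in> SL_int}"
  unfolding lat_orbit_def lat_act_coset by (auto simp: lat_coset_def)

lemma SO_real_mult: "k \<in> SO_real \<Longrightarrow> k' \<in> SO_real \<Longrightarrow> k ** k' \<in> SO_real"
  by (simp add: SO_real_def orthogonal_matrix_mul det_mul)

lemma norm_SO_real_le:
  fixes k :: "real ^ 'd ^ 'd"
  assumes "k \<in> SO_real"
  shows "norm k \<le> real CARD('d) * (real CARD('d) * 1)"
  using assms by (intro norm_matrix_le_columns) (simp add: SO_real_def orthogonal_matrix_orthonormal_columns)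

text \<open>
  Near \<open>p\<close> the preimage in \<open>SL\<^sub>d(\<real>)\<close> of the orbit is cut out by the Gram matrix, since only finitely
  many of the discretely many sheets \<open>SO(d) G \<gamma>\<close> come close to \<open>p\<close>.
\<close>

lemma orbit_preimage_local:
  fixes G p :: "real ^ 'd ^ 'd::finite"
  assumes G: "det G = 1" and p: "p \<in> \<Union> (lat_orbit SO_real (lat_coset G))"
  shows "\<exists>U. open U \<and> p \<in> U \<and>
    (\<forall>Y\<in>U. Y \<in> \<Union> (lat_orbit SO_real (lat_coset G)) \<longleftrightarrow> transpose Y ** Y = transpose p ** p)"
proof -
  let ?S = "\<Union> (lat_orbit SO_real (lat_coset G))"
  define G' where "G' = matrix_inv G"
  have inv: "G ** G' = mat 1" "G' ** G = mat 1" using matrix_inv_works[of G] G by (auto simp: G'_def)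
  \<comment> \<open>Bounds \<open>\<gamma> = G' ** (transpose k ** Y)\<close> when
    \<open>Y = k ** G ** \<gamma>\<close> lies in the ball of radius
    \<open>norm p + 1\<close>.\<close>
  define b where "b = norm G' * ((real CARD('d) * (real CARD('d) * 1)) * (norm p + 1))"
  define \<Gamma> where "\<Gamma> = {A :: real ^ 'd ^ 'd. int_matrix A \<and> (\<forall>i j. \<bar>A $ i $ j\<bar> \<le> b)}"
  have fin: "finite \<Gamma>" unfolding \<Gamma>_def by (rule finite_int_matrix_bounded)
  define gram where "gram Y = transpose Y ** Y" for Y :: "real ^ 'd ^ 'd"
  have gram_k: "gram (k ** Y) = gram Y" if "k \<in> SO_real" for k Y
  proof -
    have "gram (k ** Y) = transpose Y ** (transpose k ** k) ** Y"
      by (simp only: gram_def matrix_transpose_mul matrix_mul_assoc)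
    then show ?thesis using that by (simp add: SO_real_iff gram_def)
  qed
  have gram_S: "gram Y \<in> (\<lambda>\<gamma>. gram (G ** \<gamma>)) ` \<Gamma>" if Y: "Y \<in> ?S" "norm Y < norm p + 1" for Y
  proof -
    obtain k \<gamma> where k: "k \<in> SO_real" and g: "\<gamma> \<in> SL_int" and eq: "Y = k ** G ** \<gamma>"
      using Y(1) unfolding Union_lat_orbit by blast
    have "\<gamma> = G' ** (transpose k ** Y)"
    proof -
      have "G' ** (transpose k ** Y) = G' ** ((transpose k ** k) ** (G ** \<gamma>))"
        unfolding eq by (simp only: matrix_mul_assoc)
      also have "\<dots> = (G' ** G) ** \<gamma>" using k by (simp add: SO_real_iff matrix_mul_assoc)
      finally show ?thesis by (simp add: inv)
    qed
    then have "norm \<gamma> \<le> norm G' * norm (transpose k ** Y)" by (simp add: norm_matrix_mult_le)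
    also have "\<dots> \<le> norm G' * (norm (transpose k) * norm Y)"
      by (intro mult_left_mono norm_matrix_mult_le norm_ge_zero)
    also have "\<dots> \<le> b"
      unfolding b_def norm_transpose using norm_SO_real_le[OF k] Y(2)
      by (intro mult_left_mono mult_mono) auto
    finally have "\<bar>\<gamma> $ i $ j\<bar> \<le> b" for i j
      using component_le_norm_cart[of "\<gamma> $ i" j] Finite_Cartesian_Product.norm_nth_le[of \<gamma> i] by linarith
    then have "\<gamma> \<in> \<Gamma>" using g by (simp add: \<Gamma>_def SL_int_iff)
    moreover have "gram Y = gram (G ** \<gamma>)"
      unfolding eq matrix_mul_assoc[symmetric] by (rule gram_k[OF k])
    ultimately show ?thesis by blast
  qed
  have cont: "continuous_on UNIV gram" unfolding gram_def by (intro continuous_intros)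
  \<comment> \<open>Removing the finitely many other Gram matrices excludes the other sheets. The
    Gram matrix fixes \<open>Y\<close> only up to O(d), and \<open>0 < det Y\<close> reduces this to
    SO(d).\<close>
  define U where "U = ball 0 (norm p + 1) \<inter> {Y. 0 < det Y} \<inter> gram -` (- ((\<lambda>\<gamma>. gram (G ** \<gamma>)) ` \<Gamma> - {gram p}))"
  obtain k\<^sub>0 \<gamma>\<^sub>0 where k0: "k\<^sub>0 \<in> SO_real" "\<gamma>\<^sub>0 \<in> SL_int" "p = k\<^sub>0 ** G ** \<gamma>\<^sub>0"
    using p unfolding Union_lat_orbit by blast
  have detp: "det p = 1" using k0 G by (simp add: det_mul SO_real_def SL_int_iff)
  have "open (gram -` (- ((\<lambda>\<gamma>. gram (G ** \<gamma>)) ` \<Gamma> - {gram p})))"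
    by (rule open_vimage[OF open_Compl[OF finite_imp_closed] cont]) (simp add: fin)
  moreover have "open {Y :: real ^ 'd ^ 'd. 0 < det Y}"
    by (intro open_Collect_less continuous_on_const continuous_on_det)
  ultimately have "open U" unfolding U_def by (intro open_Int open_ball)
  moreover have "p \<in> U" by (simp add: U_def detp)
  moreover have "Y \<in> ?S \<longleftrightarrow> gram Y = gram p" if Y: "Y \<in> U" for Y
  proof
    assume "Y \<in> ?S"
    then have "gram Y \<in> (\<lambda>\<gamma>. gram (G ** \<gamma>)) ` \<Gamma>" using Y by (intro gram_S) (auto simp: U_def)
    then show "gram Y = gram p" using Y by (auto simp: U_def)
  next
    assume eq: "gram Y = gram p"
    define p' where "p' = matrix_inv p"
    have pp: "p ** p' = mat 1" "p' ** p = mat 1" using matrix_inv_works[of p] detp by (auto simp: p'_def)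
    define k where "k = Y ** p'"
    have kp: "k ** p = Y" unfolding k_def by (simp add: matrix_mul_assoc[symmetric] pp)
    have "det Y * det Y = 1"
      using arg_cong[OF eq, of det] detp by (simp add: gram_def det_mul det_transpose)
    moreover have "0 < det Y" using Y by (simp add: U_def)
    ultimately have "det Y = 1" by (metis abs_of_pos abs_mult_self_eq mult_cancel_left2 one_neq_neg_one real_sqrt_abs2 real_sqrt_one)
    then have "det k = 1" using arg_cong[OF kp, of det] detp by (simp add: det_mul)
    moreover have "transpose k ** k = mat 1"
    proof -
      have "transpose k ** k = transpose p' ** gram Y ** p'"
        by (simp only: k_def gram_def matrix_transpose_mul matrix_mul_assoc)
      also have "\<dots> = transpose (p ** p') ** (p ** p')"
        unfolding eq by (simp only: gram_def matrix_transpose_mul matrix_mul_assoc)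
      finally show ?thesis by (simp add: pp)
    qed
    ultimately have "k ** k\<^sub>0 \<in> SO_real" using SO_real_mult[OF _ k0(1)] by (simp add: SO_real_iff)
    moreover have "Y = (k ** k\<^sub>0) ** G ** \<gamma>\<^sub>0"
      using kp unfolding k0(3) by (simp only: matrix_mul_assoc)
    ultimately show "Y \<in> ?S" unfolding Union_lat_orbit using k0(2) by blast
  qed
  ultimately show ?thesis unfolding gram_def by blast
qed

subsection \<open>Orbits as submanifolds\<close>

text \<open>Needed for the inverse of a chart to be C^1, since its derivative is known pointwise as
  an inverse. A lower bound \<open>c\<close> for \<open>T y\<^sub>0\<close> persists as
  \<open>c / 2\<close> for nearby \<open>y\<close> and controls the difference of the solutions of
  \<open>T y x = e\<close>.\<close>

lemma continuous_on_blinfun_inv: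
  fixes T :: "'b::metric_space \<Rightarrow> 'a::euclidean_space \<Rightarrow>\<^sub>L 'a"
  assumes cont: "continuous_on V T" and bij: "\<And>y. y \<in> V \<Longrightarrow> bij (blinfun_apply (T y))"
  shows "continuous_on V (\<lambda>y. Blinfun (inv (blinfun_apply (T y))))"
proof (rule continuous_on_blinfun_componentwise)
  fix e :: 'a
  have lin: "linear (blinfun_apply (T y))" for y by (rule bounded_linear.linear[OF blinfun.bounded_linear_right])
  define u where "u y = inv (blinfun_apply (T y)) e" for y
  have bl: "bounded_linear (inv (blinfun_apply (T y)))" if "y \<in> V" for y
    using lin bij[OF that] by (simp add: linear_conv_bounded_linear[symmetric] inj_linear_imp_inv_linear bij_is_inj)
  have Tu: "T y (u y) = e" if "y \<in> V" for y
    unfolding u_def using bij[OF that] by (simp add: bij_is_surj surj_f_inv_f)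
  have "continuous_on V u"
    unfolding continuous_on_def
  proof
    fix y\<^sub>0 assume y0: "y\<^sub>0 \<in> V"
    obtain c where c: "0 < c" "\<And>x. c * norm x \<le> norm (T y\<^sub>0 x)"
      using linear_inj_bounded_below_pos[OF lin bij_is_inj[OF bij[OF y0]]] by blast
    have T: "(T \<longlongrightarrow> T y\<^sub>0) (at y\<^sub>0 within V)" using cont y0 by (simp add: continuous_on_def)
    have "((\<lambda>y. norm (T y - T y\<^sub>0)) \<longlongrightarrow> norm (T y\<^sub>0 - T y\<^sub>0)) (at y\<^sub>0 within V)" by (intro tendsto_intros T)
    then have "\<forall>\<^sub>F y in at y\<^sub>0 within V. norm (T y - T y\<^sub>0) < c / 2"
      using c(1) by (intro order_tendstoD) auto
    moreover have "\<forall>\<^sub>F y in at y\<^sub>0 within V. y \<in> V" by (simp add: eventually_at_filter)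
    ultimately have "\<forall>\<^sub>F y in at y\<^sub>0 within V. norm (u y - u y\<^sub>0) \<le> 2 / c * norm (e - T y (u y\<^sub>0))"
    proof eventually_elim
      case (elim y)
      define x where "x = u y - u y\<^sub>0"
      have "norm (T y x) = norm (e - T y (u y\<^sub>0))"
        unfolding x_def using Tu[OF elim(2)] by (simp add: blinfun.diff_right)
      moreover have "c * norm x - c / 2 * norm x \<le> norm (T y x)"
      proof -
        have "norm ((T y - T y\<^sub>0) x) \<le> norm (T y - T y\<^sub>0) * norm x" by (rule norm_blinfun)
        also have "\<dots> \<le> c / 2 * norm x" using elim(1) by (intro mult_right_mono) auto
        finally have "norm (T y x - T y\<^sub>0 x) \<le> c / 2 * norm x" by (simp add: blinfun.diff_left)
        then show ?thesis using c(2)[of x] norm_triangle_sub[of "T y\<^sub>0 x" "T y x"]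
          by (simp add: norm_minus_commute)
      qed
      ultimately have "c / 2 * norm x \<le> norm (e - T y (u y\<^sub>0))" by linarith
      then show ?case using c(1) unfolding x_def[symmetric] by (simp add: field_simps)
    qed
    moreover have "((\<lambda>y. 2 / c * norm (e - T y (u y\<^sub>0))) \<longlongrightarrow> 2 / c * norm (e - T y\<^sub>0 (u y\<^sub>0))) (at y\<^sub>0 within V)"
      by (intro tendsto_intros T)
    then have "((\<lambda>y. 2 / c * norm (e - T y (u y\<^sub>0))) \<longlongrightarrow> 0) (at y\<^sub>0 within V)" by (simp add: Tu[OF y0])
    ultimately have "((\<lambda>y. u y - u y\<^sub>0) \<longlongrightarrow> 0) (at y\<^sub>0 within V)"
      by (rule Lim_null_comparison)
    then show "(u \<longlongrightarrow> u y\<^sub>0) (at y\<^sub>0 within V)" by (rule LIM_zero_cancel)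
  qed
  moreover have "blinfun_apply (Blinfun (inv (blinfun_apply (T y)))) e = u y" if "y \<in> V" for y
    using bl[OF that] by (simp add: bounded_linear_Blinfun_apply u_def)
  ultimately show "continuous_on V (\<lambda>y. blinfun_apply (Blinfun (inv (blinfun_apply (T y)))) e)"
    by (subst continuous_on_cong[OF refl]) auto
qed

lemma subspace_skew: "subspace {A :: real ^ 'd ^ 'd. transpose A = - A}"
proof -
  have "linear (\<lambda>A :: real ^ 'd ^ 'd. transpose A + A)"
    by (intro linear_compose_add bounded_linear.linear[OF bounded_linear_transpose] linear_ident)
  from linear_subspace_kernel[OF this] show ?thesis unfolding eq_neg_iff_add_eq_0 .
qed

text \<open>
  With \<open>X = Y p\<inverse>\<close>, the map \<open>Y \<mapsto> (X\<^sup>T X - 1) / 2 + (X - X\<^sup>T) / 2\<close> has derivative \<open>H \<mapsto> H p\<inverse>\<close> at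
  \<open>p\<close>, and its symmetric part vanishes exactly on the matrices with the Gram matrix of \<open>p\<close>.
\<close>

lemma Gram_level_set_chart:
  fixes p :: "real ^ 'd ^ 'd::finite"
  assumes p: "det p \<noteq> 0" and U0: "open U\<^sub>0" "p \<in> U\<^sub>0"
    and S: "\<And>Y. Y \<in> U\<^sub>0 \<Longrightarrow> Y \<in> S \<longleftrightarrow> transpose Y ** Y = transpose p ** p"
  shows "\<exists>U V \<phi> \<psi>. open U \<and> p \<in> U \<and> open V \<and> homeomorphism U V \<phi> \<psi> \<and> C1_map_on U \<phi> \<and> C1_map_on V \<psi> \<and>
    \<phi> ` (S \<inter> U) = V \<inter> {A. transpose A = - A}"
proof -
  define p' where "p' = matrix_inv p"
  have pp: "p ** p' = mat 1" "p' ** p = mat 1" using matrix_inv_works[OF p] by (auto simp: p'_def)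
  define \<phi> where "\<phi> Y = (1 / 2) *\<^sub>R (transpose (Y ** p') ** (Y ** p') - mat 1) + (1 / 2) *\<^sub>R (Y ** p' - transpose (Y ** p'))"
    for Y :: "real ^ 'd ^ 'd"
  define D where "D Y H = (1 / 2) *\<^sub>R (transpose (Y ** p') ** (H ** p') + transpose (H ** p') ** (Y ** p')) +
      (1 / 2) *\<^sub>R (H ** p' - transpose (H ** p'))" for Y H :: "real ^ 'd ^ 'd"
  have right: "((\<lambda>Y :: real ^ 'd ^ 'd. Y ** p') has_derivative (\<lambda>H. H ** p')) (at Y)" for Y
    by (intro bounded_linear_imp_has_derivative bounded_bilinear.bounded_linear_left[OF bounded_bilinear_matrix_mult])
  note trans = bounded_linear.has_derivative[OF bounded_linear_transpose right]
  have der: "(\<phi> has_derivative D Y) (at Y)" for Y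
  proof -
    have "(\<phi> has_derivative (\<lambda>H. (1 / 2) *\<^sub>R (transpose (Y ** p') ** (H ** p') + transpose (H ** p') ** (Y ** p') - 0) +
      (1 / 2) *\<^sub>R (H ** p' - transpose (H ** p')))) (at Y)"
      unfolding \<phi>_def
      by (intro has_derivative_add has_derivative_scaleR_right has_derivative_diff has_derivative_const
          bounded_bilinear.FDERIV[OF bounded_bilinear_matrix_mult trans right] right trans)
    then show ?thesis by (simp add: D_def[abs_def])
  qed
  define f' where "f' Y = Blinfun (D Y)" for Y
  have f': "blinfun_apply (f' Y) = D Y" for Y
    unfolding f'_def using has_derivative_bounded_linear[OF der] by (rule bounded_linear_Blinfun_apply)
  have contf: "continuous_on A f'" for A
    by (rule continuous_on_blinfun_componentwise) (unfold f' D_def, intro continuous_intros)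
  have Dp: "D p H = H ** p'" for H
  proof -
    have "(1 / 2) *\<^sub>R (Z + Z') + (1 / 2) *\<^sub>R (Z - Z') = Z" for Z Z' :: "real ^ 'd ^ 'd"
      by (simp add: vec_eq_iff field_simps)
    then show ?thesis unfolding D_def pp transpose_mat matrix_mul_lid matrix_mul_rid .
  qed
  define invf where "invf = Blinfun (\<lambda>K :: real ^ 'd ^ 'd. K ** p)"
  have invf: "blinfun_apply invf K = K ** p" for K
    unfolding invf_def
    by (subst bounded_linear_Blinfun_apply) (intro bounded_bilinear.bounded_linear_left[OF bounded_bilinear_matrix_mult], simp)
  have inv0: "invf o\<^sub>L f' p = id_blinfun"
    by (rule blinfun_eqI) (simp add: f' Dp invf matrix_mul_assoc[symmetric] pp)
  have derf: "(\<phi> has_derivative blinfun_apply (f' Y)) (at Y)" for Y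
    unfolding f' by (rule der)
  show ?thesis
  proof (rule inverse_function_theorem[OF U0(1) derf contf U0(2) inv0])
    fix U V \<psi> \<psi>'
    assume U: "open U" "U \<subseteq> U\<^sub>0" "p \<in> U" "open V" and "\<phi> p \<in> V" and hom: "homeomorphism U V \<phi> \<psi>"
      and \<psi>: "\<And>y. y \<in> V \<Longrightarrow> (\<psi> has_derivative \<psi>' y) (at y)" "\<And>y. y \<in> V \<Longrightarrow> \<psi>' y = inv (blinfun_apply (f' (\<psi> y)))"
        "\<And>y. y \<in> V \<Longrightarrow> bij (blinfun_apply (f' (\<psi> y)))"
    have "C1_map_on U \<phi>"
      unfolding C1_map_on_def by (intro exI[of _ f'] conjI ballI derf contf)
    moreover have "C1_map_on V \<psi>"
      unfolding C1_map_on_def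
    proof (intro exI conjI ballI)
      have "continuous_on V (f' \<circ> \<psi>)"
        by (rule continuous_on_compose[OF homeomorphism_cont2[OF hom] contf])
      then show "continuous_on V (\<lambda>y. Blinfun (inv (blinfun_apply (f' (\<psi> y)))))"
        by (intro continuous_on_blinfun_inv \<psi>(3)) (simp_all add: comp_def)
      show "(\<psi> has_derivative blinfun_apply (Blinfun (inv (blinfun_apply (f' (\<psi> y)))))) (at y)" if "y \<in> V" for y
        using \<psi>(1)[OF that] has_derivative_bounded_linear[OF \<psi>(1)[OF that]]
        by (simp add: \<psi>(2)[OF that] bounded_linear_Blinfun_apply)
    qed
    moreover have "\<phi> ` (S \<inter> U) = V \<inter> {A. transpose A = - A}"
    proof -
      have sym: "\<phi> Y + transpose (\<phi> Y) = transpose (Y ** p') ** (Y ** p') - mat 1" for Y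
      proof -
        have tl: "transpose (A + B) = transpose A + transpose B" "transpose (A - B) = transpose A - transpose B"
          "transpose (c *\<^sub>R A) = c *\<^sub>R transpose A" for A B :: "real ^ 'd ^ 'd" and c
          by (simp_all add: transpose_def vec_eq_iff)
        have "transpose (transpose X ** X) = transpose X ** X" for X :: "real ^ 'd ^ 'd"
          by (simp add: matrix_transpose_mul)
        then show ?thesis
          unfolding \<phi>_def tl transpose_mat transpose_transpose
          by (simp add: vec_eq_iff algebra_simps)
      qed
      have skew_iff: "transpose (\<phi> Y) = - \<phi> Y \<longleftrightarrow> transpose Y ** Y = transpose p ** p" for Y
      proof -
        have "transpose (\<phi> Y) = - \<phi> Y \<longleftrightarrow> \<phi> Y + transpose (\<phi> Y) = 0" 
          unfolding eq_neg_iff_add_eq_0 add.commute[of "\<phi> Y"] ..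
        also have "\<dots> \<longleftrightarrow> transpose (Y ** p') ** (Y ** p') = mat 1" unfolding sym by simp
        also have "\<dots> \<longleftrightarrow> transpose Y ** Y = transpose p ** p"
        proof
          assume *: "transpose (Y ** p') ** (Y ** p') = mat 1"
          have "transpose Y ** Y = transpose (Y ** p' ** p) ** (Y ** p' ** p)"
            by (simp add: matrix_mul_assoc[symmetric] pp)
          also have "\<dots> = transpose p ** (transpose (Y ** p') ** (Y ** p')) ** p"
            by (simp only: matrix_transpose_mul matrix_mul_assoc)
          finally show "transpose Y ** Y = transpose p ** p" by (simp add: *)
        next
          assume *: "transpose Y ** Y = transpose p ** p"
          have "transpose (Y ** p') ** (Y ** p') = transpose p' ** (transpose Y ** Y) ** p'"
            by (simp only: matrix_transpose_mul matrix_mul_assoc)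
          also have "\<dots> = transpose (p ** p') ** (p ** p')"
            unfolding * by (simp only: matrix_transpose_mul matrix_mul_assoc)
          finally show "transpose (Y ** p') ** (Y ** p') = mat 1" by (simp add: pp)
        qed
        finally show ?thesis .
      qed
      have "S \<inter> U = {Y \<in> U. transpose (\<phi> Y) = - \<phi> Y}" using S U(2) skew_iff by blast
      moreover have "\<phi> ` U = V" using hom by (simp add: homeomorphism_def)
      ultimately show ?thesis by auto
    qed
    ultimately show ?thesis using U hom by blast
  qed
qed

lemma det_orbit_preimage:
  fixes G :: "real ^ 'd ^ 'd::finite"
  assumes "det G = 1" "p \<in> \<Union> (lat_orbit SO_real (lat_coset G))"
  shows "det p = 1"
  using assms unfolding Union_lat_orbit by (auto simp: det_mul SO_real_def SL_int_iff)

lemma lat_submanifold_orbit: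
  fixes G :: "real ^ 'd ^ 'd::finite"
  assumes G: "det G = 1"
  shows "lat_submanifold (lat_orbit SO_real (lat_coset G))"
proof -
  have "lat_orbit SO_real (lat_coset G) \<subseteq> lat_space"
    using G unfolding lat_orbit_def lat_act_coset lat_space_def
    by (auto simp: SL_real_def SO_real_def det_mul)
  moreover have "C1_submanifold (dim {A :: real ^ 'd ^ 'd. transpose A = - A}) (\<Union> (lat_orbit SO_real (lat_coset G)))"
    unfolding C1_submanifold_def
  proof
    fix p assume p: "p \<in> \<Union> (lat_orbit SO_real (lat_coset G))"
    have dp: "det p \<noteq> 0" using det_orbit_preimage[OF G p] by simp
    obtain U\<^sub>0 where U0: "open U\<^sub>0" "p \<in> U\<^sub>0"
      "\<And>Y. Y \<in> U\<^sub>0 \<Longrightarrow> Y \<in> \<Union> (lat_orbit SO_real (lat_coset G)) \<longleftrightarrow> transpose Y ** Y = transpose p ** p"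
      using orbit_preimage_local[OF G p] by blast
    from Gram_level_set_chart[OF dp U0]
    show "\<exists>U V \<phi> \<psi> W. open U \<and> p \<in> U \<and> open V \<and> homeomorphism U V \<phi> \<psi> \<and> C1_map_on U \<phi> \<and> C1_map_on V \<psi> \<and>
        subspace W \<and> dim W = dim {A :: real ^ 'd ^ 'd. transpose A = - A} \<and>
        \<phi> ` (\<Union> (lat_orbit SO_real (lat_coset G)) \<inter> U) = V \<inter> W"
      using subspace_skew by blast
  qed
  ultimately show ?thesis unfolding lat_submanifold_def by blast
qed

text \<open>By the local description the Gram matrix is constant along a curve in the preimage.
  Differentiation at 0 gives \<open>transpose g ** v + transpose v ** g = 0\<close>, to be
  multiplied by \<open>transpose g'\<close> on the left and \<open>g'\<close> on the right.\<close>

lemma tangent_orbit_skew: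
  fixes G g :: "real ^ 'd ^ 'd::finite"
  assumes G: "det G = 1" and g: "g \<in> \<Union> (lat_orbit SO_real (lat_coset G))"
    and v: "v \<in> lat_tangent (lat_orbit SO_real (lat_coset G)) g" and inv: "g ** g' = mat 1"
  shows "transpose (v ** g') = - (v ** g')"
proof -
  let ?S = "\<Union> (lat_orbit SO_real (lat_coset G))"
  obtain U where U: "open U" "g \<in> U" "\<And>Y. Y \<in> U \<Longrightarrow> Y \<in> ?S \<longleftrightarrow> transpose Y ** Y = transpose g ** g"
    using orbit_preimage_local[OF G g] by blast
  obtain \<epsilon> c where e: "0 < \<epsilon>" and c: "c ` {-\<epsilon><..<\<epsilon>} \<subseteq> ?S" "c 0 = g" "(c has_vector_derivative v) (at 0)"
    using v unfolding lat_tangent_def tangent_space_def by blast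
  have "continuous (at 0) c" using c(3) by (rule has_vector_derivative_continuous)
  then have "\<forall>\<^sub>F t in at 0. c t \<in> U"
    using U(1,2) c(2) unfolding continuous_at by (intro topological_tendstoD) auto
  then have "\<forall>\<^sub>F t in nhds 0. c t \<in> U" using U(2) c(2) by (simp add: eventually_nhds_conv_at)
  moreover have "\<forall>\<^sub>F t in nhds 0. t \<in> {-\<epsilon><..<\<epsilon>}" using e by (intro eventually_nhds_in_open) auto
  ultimately have ev: "\<forall>\<^sub>F t in nhds 0. transpose (c t) ** c t = transpose g ** g"
  proof eventually_elim
    case (elim t)
    then have "c t \<in> ?S" using c(1) by blast
    then show ?case using U(3)[OF elim(1)] by blast
  qed
  have "((\<lambda>t. transpose (c t) ** c t) has_vector_derivative (transpose (c 0) ** v + transpose v ** c 0)) (at 0)"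
    by (intro bounded_bilinear.has_vector_derivative[OF bounded_bilinear_matrix_mult]
        bounded_linear.has_vector_derivative[OF bounded_linear_transpose] c(3))
  moreover have "((\<lambda>t. transpose (c t) ** c t) has_vector_derivative 0) (at 0)"
  proof -
    obtain A where A: "open A" "0 \<in> A" "\<forall>t\<in>A. transpose (c t) ** c t = transpose g ** g"
      using ev unfolding eventually_nhds by blast
    show ?thesis
      by (rule has_vector_derivative_transform_within_open[OF has_vector_derivative_const A(1,2)])
        (use A(3) in simp)
  qed
  ultimately have "transpose (c 0) ** v + transpose v ** c 0 = 0" by (rule vector_derivative_unique_at)
  then have 0: "transpose g ** v + transpose v ** g = 0" unfolding c(2) .
  have "transpose g' ** (transpose g ** v + transpose v ** g) ** g' = 0"
    unfolding 0 by (simp add: bounded_bilinear.zero_left[OF bounded_bilinear_matrix_mult]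
        bounded_bilinear.zero_right[OF bounded_bilinear_matrix_mult])
  then have "(transpose g' ** transpose g) ** (v ** g') + (transpose g' ** transpose v) ** (g ** g') = 0"
    by (simp add: matrix_add_ldistrib bounded_bilinear.add_left[OF bounded_bilinear_matrix_mult] matrix_mul_assoc)
  moreover have "transpose g' ** transpose g = mat 1" using inv by (metis matrix_transpose_mul transpose_mat)
  ultimately have "v ** g' + transpose (v ** g') = 0" by (simp add: inv matrix_transpose_mul)
  then show ?thesis by (simp add: add_eq_0_iff)
qed

subsection \<open>Transversality\<close>

lemma block_mat_simps [simp]:
  "block_mat P Q R S $ Inl a $ Inl b = P $ a $ b"
  "block_mat P Q R S $ Inl a $ Inr b' = Q $ a $ b'"
  "block_mat P Q R S $ Inr a' $ Inl b = R $ a' $ b"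
  "block_mat P Q R S $ Inr a' $ Inr b' = S $ a' $ b'"
  by (simp_all add: block_mat_def)

lemma block_vec_simps [simp]: "block_vec u v $ Inl a = u $ a" "block_vec u v $ Inr b = v $ b"
  by (simp_all add: block_vec_def)

lemma block_mat_eq_iff: "A = B \<longleftrightarrow> (\<forall>a b. A $ Inl a $ Inl b = B $ Inl a $ Inl b) \<and>
    (\<forall>a b. A $ Inl a $ Inr b = B $ Inl a $ Inr b) \<and> (\<forall>a b. A $ Inr a $ Inl b = B $ Inr a $ Inl b) \<and>
    (\<forall>a b. A $ Inr a $ Inr b = B $ Inr a $ Inr b)"
  for A B :: "'x ^ ('m::finite + 'n::finite) ^ ('m + 'n)"
  unfolding vec_eq_iff split_sum_all by blast

lemma sum_UNIV_sum:
  "sum f (UNIV :: ('a::finite + 'b::finite) set) = (\<Sum>a\<in>UNIV. f (Inl a)) + (\<Sum>b\<in>UNIV. f (Inr b))"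
  unfolding UNIV_Plus_UNIV[symmetric] by (subst sum.Plus) (simp_all add: comp_def)

lemma prod_UNIV_sum:
  "prod f (UNIV :: ('a::finite + 'b::finite) set) = (\<Prod>a\<in>UNIV. f (Inl a)) * (\<Prod>b\<in>UNIV. f (Inr b))"
  unfolding UNIV_Plus_UNIV[symmetric] by (subst prod.Plus) (simp_all add: comp_def)

lemma block_mat_mult:
  "block_mat P Q R S ** block_mat P' Q' R' S' =
    block_mat (P ** P' + Q ** R') (P ** Q' + Q ** S') (R ** P' + S ** R') (R ** Q' + S ** S')"
  by (simp add: block_mat_eq_iff) (simp add: matrix_matrix_mult_def sum_UNIV_sum)

lemma block_mat_vec: "block_mat P Q R S *v block_vec u v = block_vec (P *v u + Q *v v) (R *v u + S *v v)"
  by (simp add: vec_eq_iff split_sum_all) (simp add: matrix_vector_mult_def sum_UNIV_sum)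

lemma transpose_block_mat:
  "transpose (block_mat P Q R S) = block_mat (transpose P) (transpose R) (transpose Q) (transpose S)"
  by (simp add: block_mat_eq_iff) (simp add: transpose_def)

lemma mat_scalar_mult: "mat c ** A = c *\<^sub>R A" "A ** mat d = d *\<^sub>R A" for A :: "real ^ 'n ^ 'm"
  by (simp_all add: vec_eq_iff matrix_matrix_mult_def mat_def if_distrib[of "\<lambda>x. x * _"]
      if_distrib[of "\<lambda>x. _ * x"] cong: if_cong)

lemma mat_scalar_vec: "mat c *v v = c *\<^sub>R v" for v :: "real ^ 'n"
  by (simp add: vec_eq_iff matrix_vector_mult_def mat_def if_distrib[of "\<lambda>x. x * _"] cong: if_cong)

lemma scaleR_mat_1: "c *\<^sub>R mat 1 = (mat c :: real ^ 'n ^ 'n)"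
  by (simp add: vec_eq_iff mat_def)

lemma block_mat_1: "block_mat (mat 1) 0 0 (mat 1) = mat 1"
  by (simp add: block_mat_eq_iff) (simp add: mat_def)

lemma continuous_on_block_mat [continuous_intros]:
  assumes "continuous_on T P" "continuous_on T Q" "continuous_on T R" "continuous_on T S"
  shows "continuous_on T (\<lambda>x. block_mat (P x) (Q x) (R x) (S x))"
  unfolding block_mat_def
proof (intro continuous_on_vec_lambda)
  fix i j
  show "continuous_on T (\<lambda>x. case i of
        Inl a \<Rightarrow> (case j of Inl b \<Rightarrow> P x $ a $ b | Inr b \<Rightarrow> Q x $ a $ b)
      | Inr a \<Rightarrow> (case j of Inl b \<Rightarrow> R x $ a $ b | Inr b \<Rightarrow> S x $ a $ b))"
    using assms by (cases i; cases j) (auto intro!: continuous_intros)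
qed

section \<open>The flow, the expanding horospherical group and their commutation relation\<close>

definition flow :: "real \<Rightarrow> real ^ ('m::finite + 'n::finite) ^ ('m + 'n)" where
  "flow s = block_mat (mat (exp (s / real CARD('m)))) 0 0 (mat (exp (- s / real CARD('n))))"

definition horo :: "real ^ 'n::finite ^ 'm::finite \<Rightarrow> real ^ ('m + 'n) ^ ('m + 'n)" where
  "horo A = block_mat (mat 1) A 0 (mat 1)"

lemma F_group_eq: "F_group = range flow"
  by (auto simp: F_group_def flow_def)

lemma H_group_eq: "H_group = range horo"
  by (auto simp: H_group_def horo_def)

lemma flow_0: "flow 0 = mat 1"
  by (simp add: flow_def block_mat_1)

lemma horo_0: "horo 0 = mat 1"
  by (simp add: horo_def block_mat_1)

lemma flow_add: "flow (s + t) = flow s ** flow t"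
  by (simp add: flow_def block_mat_mult mat_scalar_mult block_mat_eq_iff)
    (simp add: mat_def add_divide_distrib exp_add[symmetric] exp_diff[symmetric] diff_divide_distrib)

lemma horo_add: "horo (A + B) = horo A ** horo B"
  by (simp add: horo_def block_mat_mult add.commute)

text \<open>The flow dilates \<open>H\<close> by one scalar, the same in all directions. Balls of
  matrices are thus rescaled to balls, which lets the radius of Bob's ball determine a moment of
  time.\<close>

lemma flow_horo:
  fixes A :: "real ^ 'n::finite ^ 'm::finite"
  shows "flow s ** horo A = horo (exp ((1 / real CARD('m) + 1 / real CARD('n)) * s) *\<^sub>R A) ** flow s"
proof -
  have "exp ((1 / real CARD('m) + 1 / real CARD('n)) * s) * exp (- s / real CARD('n)) = exp (s / real CARD('m))"
    by (simp add: exp_add[symmetric] algebra_simps)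
  then show ?thesis
    by (simp add: flow_def horo_def block_mat_mult mat_scalar_mult scaleR_mat_1 mult.commute)
qed

lemma det_flow: "det (flow s :: real ^ ('m::finite + 'n::finite) ^ ('m + 'n)) = 1"
proof -
  have "det (flow s :: real ^ ('m + 'n) ^ ('m + 'n)) = (\<Prod>i\<in>UNIV. (flow s :: real ^ ('m + 'n) ^ ('m + 'n)) $ i $ i)"
  proof (rule det_diagonal)
    fix i j :: "'m + 'n" assume "i \<noteq> j"
    then show "(flow s :: real ^ ('m + 'n) ^ ('m + 'n)) $ i $ j = 0"
      by (cases i; cases j) (auto simp: flow_def mat_def)
  qed
  also have "\<dots> = exp (s / real CARD('m)) ^ CARD('m) * exp (- s / real CARD('n)) ^ CARD('n)"
    by (simp add: prod_UNIV_sum flow_def mat_def)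
  also have "\<dots> = 1"
    by (simp add: exp_of_nat_mult[symmetric] exp_minus_inverse)
  finally show ?thesis .
qed

text \<open>Conjugation by \<open>flow s\<close> contracts \<open>horo A\<close> to the identity as \<open>s \<rightarrow> -\<infinity>\<close>.\<close>

lemma det_horo: "det (horo A :: real ^ ('m::finite + 'n::finite) ^ ('m + 'n)) = 1"
proof -
  let ?c = "1 / real CARD('m) + 1 / real CARD('n)"
  have c: "0 < ?c" by (simp add: add_pos_pos)
  have const: "det (horo (t *\<^sub>R A)) = det (horo A)" if "0 < t" for t
  proof -
    have "exp (?c * (ln t / ?c)) = t" using that c by simp
    then show ?thesis
      using arg_cong[OF flow_horo[of "ln t / ?c" A], of det] by (simp add: det_mul det_flow)
  qed
  have "continuous_on UNIV (\<lambda>t. det (horo (t *\<^sub>R A)))"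
    unfolding horo_def by (intro continuous_on_compose2[OF continuous_on_det[of UNIV]] continuous_intros) auto
  then have "isCont (\<lambda>t. det (horo (t *\<^sub>R A))) 0" by (simp add: continuous_on_eq_continuous_at)
  then have "((\<lambda>t. det (horo (t *\<^sub>R A))) \<longlongrightarrow> det (horo (0 *\<^sub>R A))) (at 0)" by (rule isContD)
  then have "((\<lambda>t. det (horo (t *\<^sub>R A))) \<longlongrightarrow> 1) (at_right 0)"
    by (simp add: horo_0 filterlim_at_split)
  moreover have "((\<lambda>t. det (horo (t *\<^sub>R A))) \<longlongrightarrow> det (horo A)) (at_right 0)"
    by (rule tendsto_eventually) (use const in \<open>auto intro!: eventually_at_rightI[of 0 1]\<close>)
  ultimately show ?thesis using tendsto_unique trivial_limit_at_right_real by blast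
qed

text \<open>Everything is read off after multiplication by \<open>g'\<close> on the right: tangent
  vectors of the orbit become skew, those of the leaf of \<open>F\<close> diagonal. The generator of
  \<open>F\<close> has nonzero diagonal entries, so it is not skew; the block matrix
  \<open>N\<close> minus a diagonal one still has off-diagonal entries that are not the negatives of
  their mirror images.\<close>

lemma transversal_orbit:
  fixes G :: "real ^ ('m::finite + 'n::finite) ^ ('m + 'n)"
  assumes G: "det G = 1"
  shows "transversal F_group H_group (lat_orbit SO_real (lat_coset G))"
  unfolding transversal_def
proof (intro conjI ballI)
  let ?Z = "lat_orbit SO_real (lat_coset G)"
  show "lat_submanifold ?Z" using G by (rule lat_submanifold_orbit)
  fix x g assume x: "x \<in> ?Z" "g \<in> x"
  then have g: "g \<in> \<Union> ?Z" by blast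
  define g' where "g' = matrix_inv g"
  have inv: "g ** g' = mat 1" "g' ** g = mat 1"
    using matrix_inv_works[of g] det_orbit_preimage[OF G g] by (auto simp: g'_def)
  have skew: "(v ** g') $ j $ i = - (v ** g') $ i $ j" if "v \<in> lat_tangent ?Z g" for v i j
  proof -
    have "transpose (v ** g') $ i $ j = (- (v ** g')) $ i $ j"
      by (simp only: tangent_orbit_skew[OF G g that inv(1)])
    then show ?thesis by (simp only: transpose_def vec_lambda_beta vector_uminus_component)
  qed
  have tangentI: "N ** g \<in> orbit_tangent K g"
    if der: "\<And>t. (c has_vector_derivative c' t) (at t)" and cont: "continuous_on UNIV c'"
      and c: "\<And>t. c t \<in> K" "c 0 = mat 1" "c' 0 = N" for c c' N and K :: "(real ^ ('m + 'n) ^ ('m + 'n)) set"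
    unfolding orbit_tangent_def tangent_space_def
  proof (intro CollectI exI conjI)
    have d: "((\<lambda>t. c t ** g) has_vector_derivative c' t ** g) (at t)" for t
      by (rule bounded_linear.has_vector_derivative[OF
          bounded_bilinear.bounded_linear_left[OF bounded_bilinear_matrix_mult] der])
    show "(0 :: real) < 1" by simp
    have "continuous_on {-1<..<1} (\<lambda>t. c' t ** g)"
      by (intro continuous_intros continuous_on_subset[OF cont]) auto
    then show "(\<lambda>t. c t ** g) C1_differentiable_on {-1<..<1}"
      unfolding C1_differentiable_on_def using d by (intro exI[of _ "\<lambda>t. c' t ** g"]) blast
    show "(\<lambda>t. c t ** g) ` {-1<..<1} \<subseteq> (\<lambda>h. h ** g) ` K" using c(1) by blast
    show "c 0 ** g = g" by (simp add: c)
    show "((\<lambda>t. c t ** g) has_vector_derivative N ** g) (at 0)" using d[of 0] by (simp add: c)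
  qed
  have cancel: "N ** g ** g' = N" for N by (simp add: matrix_mul_assoc[symmetric] inv)
  have vdI: "(f has_vector_derivative f') (at t)"
    if "\<And>i j. ((\<lambda>t. f t $ i $ j) has_vector_derivative f' $ i $ j) (at t)"
    for f :: "real \<Rightarrow> real ^ ('m + 'n) ^ ('m + 'n)" and f' t
    unfolding has_vector_derivative_def has_derivative_componentwise_within[of f]
  proof
    fix b :: "real ^ ('m + 'n) ^ ('m + 'n)" assume "b \<in> Basis"
    then obtain i j where b: "b = axis i (axis j 1)" by (auto simp: Basis_vec_def)
    have "x \<bullet> b = x $ i $ j" for x by (simp add: b inner_axis)
    then show "((\<lambda>t. f t \<bullet> b) has_derivative (\<lambda>s. (s *\<^sub>R f') \<bullet> b)) (at t)"
      using that[of i j] by (simp add: has_vector_derivative_def)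
  qed
  define D :: "real \<Rightarrow> real ^ ('m + 'n) ^ ('m + 'n)" where
    "D t = block_mat ((exp (t / real CARD('m)) / real CARD('m)) *\<^sub>R mat 1) 0 0
       ((- exp (- t / real CARD('n)) / real CARD('n)) *\<^sub>R mat 1)" for t
  have "D 0 ** g \<in> orbit_tangent F_group g"
  proof (rule tangentI[where c = flow and c' = D])
    show "((flow :: real \<Rightarrow> real ^ ('m + 'n) ^ ('m + 'n)) has_vector_derivative D t) (at t)" for t
    proof (rule vdI)
      fix i j :: "'m + 'n"
      show "((\<lambda>t. (flow t :: real ^ ('m + 'n) ^ ('m + 'n)) $ i $ j) has_vector_derivative D t $ i $ j) (at t)"
        by (cases i; cases j) (auto simp: flow_def D_def mat_def has_real_derivative_iff_has_vector_derivative[symmetric]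
            intro!: derivative_eq_intros)
    qed
    show "continuous_on UNIV D"
      unfolding D_def by (intro continuous_intros) auto
  qed (auto simp: F_group_eq flow_0)
  moreover have "D 0 ** g \<notin> lat_tangent ?Z g"
  proof
    assume "D 0 ** g \<in> lat_tangent ?Z g"
    from skew[OF this, of "Inl undefined" "Inl undefined"] show False
      by (simp add: cancel D_def mat_def)
  qed
  ultimately show "\<not> orbit_tangent F_group g \<subseteq> lat_tangent ?Z g" by blast
  \<comment> \<open>With all entries equal to 1, the arbitrary indices \<open>undefined\<close> can
    serve as witnesses below.\<close>
  define A :: "real ^ 'n ^ 'm" where "A = (\<chi> i j. 1)"
  define N :: "real ^ ('m + 'n) ^ ('m + 'n)" where "N = block_mat 0 A 0 0"
  have "N ** g \<in> orbit_tangent H_group g"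
  proof (rule tangentI[where c = "\<lambda>t. horo (t *\<^sub>R A)" and c' = "\<lambda>_. N"])
    show "((\<lambda>t. horo (t *\<^sub>R A)) has_vector_derivative N) (at t)" for t
    proof (rule vdI)
      fix i j :: "'m + 'n"
      show "((\<lambda>t. horo (t *\<^sub>R A) $ i $ j) has_vector_derivative N $ i $ j) (at t)"
        by (cases i; cases j) (auto simp: horo_def N_def A_def has_real_derivative_iff_has_vector_derivative[symmetric]
            intro!: derivative_eq_intros)
    qed
  qed (auto simp: H_group_eq horo_0)
  moreover have "N ** g \<noteq> u + v" if u: "u \<in> lat_tangent ?Z g" and v: "v \<in> orbit_tangent F_group g" for u v
  proof
    assume "N ** g = u + v"
    then have "N ** g ** g' = u ** g' + v ** g'"
      by (simp add: bounded_bilinear.add_left[OF bounded_bilinear_matrix_mult])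
    then have eq: "N $ i $ j = (u ** g') $ i $ j + (v ** g') $ i $ j" for i j by (simp add: cancel)
    obtain \<epsilon> c where e: "0 < \<epsilon>" and c: "c ` {-\<epsilon><..<\<epsilon>} \<subseteq> (\<lambda>h. h ** g) ` F_group" "(c has_vector_derivative v) (at 0)"
      using v unfolding orbit_tangent_def tangent_space_def by blast
    have off: "(v ** g') $ i $ j = 0" if ij: "i \<noteq> j" for i j
    proof -
      have z: "(c t ** g') $ i $ j = 0" if "t \<in> {-\<epsilon><..<\<epsilon>}" for t
      proof -
        have "c t \<in> (\<lambda>h. h ** g) ` range flow" using c(1) that unfolding F_group_eq by (rule subsetD[OF _ imageI])
        then obtain s where s: "c t = flow s ** g" by (elim imageE rangeE) simp
        have "(flow s :: real ^ ('m + 'n) ^ ('m + 'n)) $ i $ j = 0"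
          using ij by (cases i; cases j) (auto simp: flow_def mat_def)
        then show ?thesis unfolding s cancel .
      qed
      have "((\<lambda>t. c t ** g') has_vector_derivative v ** g') (at 0)"
        by (rule bounded_linear.has_vector_derivative[OF
            bounded_bilinear.bounded_linear_left[OF bounded_bilinear_matrix_mult] c(2)])
      then have "((\<lambda>t. (c t ** g') $ i) has_vector_derivative (v ** g') $ i) (at 0)"
        by (rule bounded_linear.has_vector_derivative[OF bounded_linear_vec_nth])
      then have "((\<lambda>t. (c t ** g') $ i $ j) has_vector_derivative (v ** g') $ i $ j) (at 0)"
        by (rule bounded_linear.has_vector_derivative[OF bounded_linear_vec_nth])
      moreover have "((\<lambda>t. (c t ** g') $ i $ j) has_vector_derivative 0) (at 0)"
      proof (rule has_vector_derivative_transform_within_open)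
        show "((\<lambda>t. 0) has_vector_derivative 0) (at 0)" by (rule has_vector_derivative_const)
        show "open {-\<epsilon><..<\<epsilon>}" "0 \<in> {-\<epsilon><..<\<epsilon>}" using e by simp_all
        show "0 = (c t ** g') $ i $ j" if "t \<in> {-\<epsilon><..<\<epsilon>}" for t using z[OF that] ..
      qed
      ultimately show ?thesis by (rule vector_derivative_unique_at)
    qed
    have "N $ Inl undefined $ Inr undefined = - N $ Inr undefined $ Inl undefined"
      using skew[OF u, of "Inr undefined" "Inl undefined"] off[OF Inl_not_Inr, of undefined undefined]
        off[OF Inr_not_Inl, of undefined undefined]
        eq[of "Inl undefined" "Inr undefined"]
        eq[of "Inr undefined" "Inl undefined"] by linarith
    then show False by (simp add: N_def A_def)
  qed
  ultimately show "\<not> orbit_tangent H_group g \<subseteq> {u + v | u v. u \<in> lat_tangent ?Z g \<and> v \<in> orbit_tangent F_group g}"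
    by blast
qed

subsection \<open>Dirichlet improvable matrices\<close>

lemma flow_horo_near_identity:
  assumes "0 < q"
  shows "\<exists>\<delta>>0. \<forall>\<sigma> (B :: real ^ 'n::finite ^ 'm::finite). \<bar>\<sigma>\<bar> \<le> \<delta> \<longrightarrow> norm B \<le> \<delta> \<longrightarrow>
    norm (flow \<sigma> ** horo B - mat 1) < q"
proof -
  let ?f = "\<lambda>x :: real \<times> (real ^ 'n ^ 'm). flow (fst x) ** horo (snd x)"
  have "continuous_on UNIV ?f"
    unfolding flow_def horo_def scaleR_mat_1[of "exp _", symmetric] by (intro continuous_intros) auto
  then have "isCont ?f (0, 0)" by (simp add: continuous_on_eq_continuous_at)
  then obtain d where d: "0 < d" "\<And>x. dist x (0, 0) < d \<Longrightarrow> dist (?f x) (?f (0, 0)) < q"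
    using assms unfolding continuous_at_eps_delta by blast
  have "norm (flow \<sigma> ** horo B - mat 1) < q" if "\<bar>\<sigma>\<bar> \<le> d / 3" "norm B \<le> d / 3" for \<sigma> and B :: "real ^ 'n ^ 'm"
  proof -
    have "dist (\<sigma>, B) (0, 0) \<le> \<bar>\<sigma>\<bar> + norm B"
      using norm_Pair_le[of \<sigma> B] by (simp add: dist_norm)
    then have "dist (\<sigma>, B) (0, 0) < d" using that d(1) by linarith
    from d(2)[OF this] show ?thesis by (simp add: dist_norm flow_0 horo_0)
  qed
  then show ?thesis using d(1) by (intro exI[of _ "d / 3"]) auto
qed

text \<open>The upper right block of the Gram matrix of \<open>h\<close> is \<open>B\<close> times a
  scalar between exp(-2) and exp 2. This is transversality of \<open>H\<close> modulo
  \<open>F\<close> as an inequality: \<sigma> enters only through that scalar.\<close>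

lemma norm_le_Gram_flow_horo:
  fixes B :: "real ^ 'n::finite ^ 'm::finite"
  assumes \<sigma>: "\<bar>\<sigma>\<bar> \<le> 1" and h: "h = flow \<sigma> ** horo B"
  shows "norm B \<le> real CARD('m) * (real CARD('n) * exp 2) * norm (transpose h ** h - mat 1)"
proof -
  let ?N = "norm (transpose h ** h - mat 1)"
  have entry: "\<bar>B $ a $ b\<bar> \<le> exp 2 * ?N" for a b
  proof -
    have "(transpose h ** h) $ Inl a $ Inr b = exp (2 * \<sigma> / real CARD('m)) * B $ a $ b"
      unfolding h flow_def horo_def
      by (simp add: block_mat_mult transpose_block_mat mat_scalar_mult transpose_mat scaleR_mat_1)
        (simp add: transpose_def exp_add[symmetric] field_simps)
    moreover have "mat 1 $ Inl a $ Inr b = (0 :: real)" by (simp add: mat_def)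
    ultimately have "\<bar>exp (2 * \<sigma> / real CARD('m)) * B $ a $ b\<bar> = \<bar>(transpose h ** h - mat 1) $ Inl a $ Inr b\<bar>"
      by simp
    also have "\<dots> \<le> ?N"
      using component_le_norm_cart[of "(transpose h ** h - mat 1) $ Inl a" "Inr b"]
        Finite_Cartesian_Product.norm_nth_le[of "transpose h ** h - mat 1" "Inl a"] by linarith
    finally have le: "exp (2 * \<sigma> / real CARD('m)) * \<bar>B $ a $ b\<bar> \<le> ?N" by (simp add: abs_mult)
    have "- 2 \<le> 2 * \<sigma> / real CARD('m)"
    proof -
      have "1 \<le> real CARD('m)" by (simp add: Suc_leI)
      then have "- real CARD('m) \<le> \<sigma>" using \<sigma> by linarith
      then show ?thesis by (simp add: field_simps)
    qed
    then have "exp (- 2) * \<bar>B $ a $ b\<bar> \<le> exp (2 * \<sigma> / real CARD('m)) * \<bar>B $ a $ b\<bar>"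
      by (intro mult_right_mono) auto
    then have "exp (- 2) * \<bar>B $ a $ b\<bar> \<le> ?N" using le by linarith
    then have "exp 2 * (exp (- 2) * \<bar>B $ a $ b\<bar>) \<le> exp 2 * ?N" by (intro mult_left_mono) auto
    then show ?thesis by (simp add: mult.assoc[symmetric] exp_add[symmetric])
  qed
  have "norm (B $ a) \<le> real CARD('n) * (exp 2 * ?N)" for a
  proof -
    have "norm (B $ a) \<le> (\<Sum>b\<in>UNIV. \<bar>B $ a $ b\<bar>)" by (rule norm_le_l1_cart)
    also have "\<dots> \<le> (\<Sum>b\<in>(UNIV :: 'n set). exp 2 * ?N)" by (intro sum_mono entry)
    finally show ?thesis by simp
  qed
  then have "(\<Sum>a\<in>UNIV. norm (B $ a)) \<le> (\<Sum>a\<in>(UNIV :: 'm set). real CARD('n) * (exp 2 * ?N))"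
    by (intro sum_mono)
  moreover have "norm B \<le> (\<Sum>a\<in>UNIV. norm (B $ a))"
    unfolding norm_vec_def[of B] by (rule L2_set_le_sum) simp
  ultimately show ?thesis by (simp add: mult.assoc)
qed

text \<open>The two trajectories differ by \<open>h = flow \<sigma> ** horo D\<close>, where
  \<open>D\<close> is the difference of the matrices magnified up to time \<open>s\<close>. The
  times only have to be \<delta>-close: \<open>D\<close> is controlled without controlling \<sigma>
  any further.\<close>

lemma near_critical_times:
  fixes r :: real
  defines "r \<equiv> critical_radius TYPE('m::finite + 'n::finite)"
  shows "\<exists>\<delta>>0. \<exists>C>0. \<forall>\<epsilon> s \<sigma> (A :: real ^ 'n ^ 'm) A'. 0 \<le> \<epsilon> \<longrightarrow> \<epsilon> < \<delta> \<longrightarrow> \<bar>\<sigma>\<bar> \<le> \<delta> \<longrightarrow>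
    exp ((1 / real CARD('m) + 1 / real CARD('n)) * s) * norm (A' - A) \<le> \<delta> \<longrightarrow>
    admissible (r - \<epsilon>) (flow s ** horo A) \<longrightarrow> admissible (r - \<epsilon>) (flow (s + \<sigma>) ** horo A') \<longrightarrow>
    exp ((1 / real CARD('m) + 1 / real CARD('n)) * s) * norm (A' - A) \<le> C * \<epsilon>"
proof -
  obtain q C where q: "0 < q" "0 < C"
    and rigid: "\<And>\<epsilon> (M :: real ^ ('m + 'n) ^ ('m + 'n)) h. 0 \<le> \<epsilon> \<Longrightarrow> \<epsilon> < q \<Longrightarrow> det M = 1 \<Longrightarrow> det h = 1 \<Longrightarrow>
      norm (h - mat 1) < q \<Longrightarrow> admissible (r - \<epsilon>) M \<Longrightarrow> admissible (r - \<epsilon>) (h ** M) \<Longrightarrow>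
      norm (transpose h ** h - mat 1) \<le> C * \<epsilon>"
    using near_critical_rigid[where 'd = "'m + 'n"] unfolding r_def by metis
  obtain d where d: "0 < d"
    "\<And>\<sigma> (B :: real ^ 'n ^ 'm). \<bar>\<sigma>\<bar> \<le> d \<Longrightarrow> norm B \<le> d \<Longrightarrow> norm (flow \<sigma> ** horo B - mat 1) < q"
    using flow_horo_near_identity[OF q(1)] by metis
  define \<delta> where "\<delta> = min (min d q) 1"
  define K where "K = real CARD('m) * (real CARD('n) * exp 2)"
  have K: "0 < K" by (simp add: K_def)
  let ?c = "1 / real CARD('m) + 1 / real CARD('n)"
  have "exp (?c * s) * norm (A' - A) \<le> K * C * \<epsilon>"
    if e: "0 \<le> \<epsilon>" "\<epsilon> < \<delta>" and \<sigma>: "\<bar>\<sigma>\<bar> \<le> \<delta>" and B: "exp (?c * s) * norm (A' - A) \<le> \<delta>"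
      and adm: "admissible (r - \<epsilon>) (flow s ** horo A)" "admissible (r - \<epsilon>) (flow (s + \<sigma>) ** horo A')"
    for \<epsilon> s \<sigma> and A A' :: "real ^ 'n ^ 'm"
  proof -
    define D where "D = exp (?c * s) *\<^sub>R (A' - A)"
    have nD: "norm D = exp (?c * s) * norm (A' - A)" by (simp add: D_def)
    define h where "h = flow \<sigma> ** horo D"
    have "flow (s + \<sigma>) ** horo A' = flow \<sigma> ** (flow s ** horo (A' - A)) ** horo A"
      by (simp add: add.commute[of s] flow_add matrix_mul_assoc[symmetric] horo_add[symmetric])
    also have "\<dots> = h ** (flow s ** horo A)"
      unfolding flow_horo[of s "A' - A"] h_def D_def by (simp only: matrix_mul_assoc)
    finally have eq: "flow (s + \<sigma>) ** horo A' = h ** (flow s ** horo A)" .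
    have gram: "norm (transpose h ** h - mat 1) \<le> C * \<epsilon>"
    proof (rule rigid[where M = "flow s ** horo A", OF e(1)])
      show "\<epsilon> < q" using e(2) by (simp add: \<delta>_def)
      show "norm (h - mat 1) < q" unfolding h_def using \<sigma> B by (intro d) (auto simp: \<delta>_def nD)
      show "admissible (r - \<epsilon>) (h ** (flow s ** horo A))" using adm(2) unfolding eq .
    qed (simp_all add: adm(1) det_mul det_flow det_horo h_def)
    have "norm D \<le> K * norm (transpose h ** h - mat 1)"
      unfolding K_def by (rule norm_le_Gram_flow_horo[OF _ h_def]) (use \<sigma> in \<open>simp add: \<delta>_def\<close>)
    also have "\<dots> \<le> K * (C * \<epsilon>)" using gram K by (intro mult_left_mono) auto
    finally show ?thesis by (simp add: nD mult.assoc)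
  qed
  moreover have "0 < \<delta>" using d(1) q(1) by (simp add: \<delta>_def)
  moreover have "0 < K * C" using K q(2) by simp
  ultimately show ?thesis by blast
qed

text \<open>One direction of Dani's correspondence between Dirichlet improvability and trajectories,
  at time n ln t, when the flow scales the two blocks by t^(n/m) and 1/t. The quotient
  \<open>c = (r - \<epsilon>) / r\<close> turns lattice vectors shorter than
  \<open>r - \<epsilon>\<close> into points of the ball of radius \<open>r\<close>.\<close>

lemma D_hat_if_not_near_critical:
  fixes A :: "real ^ 'n::finite ^ 'm::finite"
  defines "r \<equiv> critical_radius TYPE('m + 'n)"
  assumes \<epsilon>: "0 < \<epsilon>" "\<epsilon> < r" and ev: "\<forall>\<^sub>F s in at_top. \<not> admissible (r - \<epsilon>) (flow s ** horo A)"
  shows "A \<in> D_hat"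
proof -
  have r: "0 < r" unfolding r_def by (rule critical_radius_pos)
  define c where "c = (r - \<epsilon>) / r"
  have c: "0 < c" "c < 1" using \<epsilon> r by (auto simp: c_def)
  let ?m = "real CARD('m)" and ?n = "real CARD('n)"
  have "filterlim (\<lambda>t. ?n * ln t) at_top at_top"
    by (intro filterlim_tendsto_pos_mult_at_top[OF tendsto_const] ln_at_top) simp
  then have "\<forall>\<^sub>F t in at_top. \<not> admissible (r - \<epsilon>) (flow (?n * ln t) ** horo A)"
    by (rule eventually_compose_filterlim[OF ev])
  moreover have "filterlim (\<lambda>t. exp (?n * ln t / ?m)) at_top at_top"
  proof -
    have "filterlim (\<lambda>t. ?n / ?m * ln t) at_top at_top"
      by (intro filterlim_tendsto_pos_mult_at_top[OF tendsto_const] ln_at_top) simp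
    then show ?thesis by (intro filterlim_compose[OF exp_at_top]) simp
  qed
  then have "\<forall>\<^sub>F t in at_top. r < exp (?n * ln t / ?m)" by (simp add: filterlim_at_top_dense)
  moreover have "\<forall>\<^sub>F t :: real in at_top. 0 < t" by (rule eventually_gt_at_top)
  ultimately have "\<forall>\<^sub>F t in at_top. \<exists>q\<in>int_vecs - {0}. \<exists>p\<in>int_vecs.
      block_vec (A *v q - p) q \<in> (\<lambda>w. block_mat (mat (c * t powr (- (?n / ?m)))) 0 0 (mat t) *v w) ` ball 0 r"
  proof eventually_elim
    case (elim t)
    obtain z :: "real ^ ('m + 'n)" where z: "z \<in> int_vecs" "z \<noteq> 0" "norm ((flow (?n * ln t) ** horo A) *v z) < r - \<epsilon>"
      using elim(1) unfolding admissible_def by (auto simp: not_le)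
    define u where "u = (\<chi> a. z $ Inl a)"
    define q where "q = (\<chi> b. z $ Inr b)"
    have zb: "z = block_vec u q" by (simp add: vec_eq_iff split_sum_all u_def q_def)
    have ints: "u \<in> int_vecs" "q \<in> int_vecs" using z(1) by (simp_all add: int_vecs_def u_def q_def)
    define e where "e = exp (?n * ln t / ?m)"
    have e: "r < e" "0 < e" using elim(2) by (simp_all add: e_def)
    have et: "t powr (- (?n / ?m)) = 1 / e" using elim(3) by (simp add: powr_def e_def exp_minus_inverse field_simps exp_minus)
    have "exp (- (?n * ln t) / ?n) = 1 / t" using elim(3) by (simp add: exp_minus inverse_eq_divide)
    then have fl: "(flow (?n * ln t) ** horo A) *v z = block_vec (e *\<^sub>R (A *v q + u)) ((1 / t) *\<^sub>R q)"
      unfolding zb flow_def horo_def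
      by (simp add: block_mat_mult mat_scalar_mult block_mat_vec mat_scalar_vec e_def
          scaleR_matrix_vector_assoc[symmetric] scaleR_add_right add.commute)
    \<comment> \<open>A nonzero integer vector with \<open>q = 0\<close> would be stretched by
      \<open>e\<close> beyond \<open>r\<close>; this is where \<open>t\<close> has to be
      large.\<close>
    have "q \<noteq> 0"
    proof
      assume q0: "q = 0"
      then have "u \<noteq> 0" using z(2) zb by (auto simp: vec_eq_iff split_sum_all)
      then obtain a where "u $ a \<noteq> 0" by (auto simp: vec_eq_iff)
      then have "1 \<le> \<bar>u $ a\<bar>" using ints(1) by (auto simp: int_vecs_def Ints_nonzero_abs_ge1)
      then have "e * 1 \<le> e * \<bar>u $ a\<bar>" using e(2) by (intro mult_left_mono) auto
      also have "\<dots> = \<bar>((flow (?n * ln t) ** horo A) *v z) $ Inl a\<bar>"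
        unfolding fl using e(2) by (simp add: q0 abs_mult)
      also have "\<dots> \<le> norm ((flow (?n * ln t) ** horo A) *v z)" by (rule component_le_norm_cart)
      finally show False using z(3) e(1) \<epsilon> by simp
    qed
    \<comment> \<open>Only the first block is divided by \<open>c\<close>, but the norm is bounded
      as if both were.\<close>
    define w where "w = block_vec ((e / c) *\<^sub>R (A *v q + u)) ((1 / t) *\<^sub>R q)"
    have "norm w \<le> norm ((1 / c) *\<^sub>R block_vec (e *\<^sub>R (A *v q + u)) ((1 / t) *\<^sub>R q))"
    proof (rule norm_le_componentwise_cart)
      fix i
      show "norm (w $ i) \<le> norm (((1 / c) *\<^sub>R block_vec (e *\<^sub>R (A *v q + u)) ((1 / t) *\<^sub>R q)) $ i)"
      proof (cases i)
        case (Inr b)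
        have "1 * \<bar>q $ b / t\<bar> \<le> 1 / c * \<bar>q $ b / t\<bar>" using c by (intro mult_right_mono) auto
        then show ?thesis using c(1) by (simp add: Inr w_def abs_mult)
      qed (simp add: w_def)
    qed
    also have "\<dots> = norm ((flow (?n * ln t) ** horo A) *v z) / c" using c(1) by (simp add: fl)
    also have "\<dots> < (r - \<epsilon>) / c" using z(3) c(1) by (intro divide_strict_right_mono)
    also have "\<dots> = r" using \<epsilon> r by (simp add: c_def)
    finally have "w \<in> ball 0 r" by simp
    moreover have "block_vec (A *v q - (- u)) q = block_mat (mat (c * t powr (- (?n / ?m)))) 0 0 (mat t) *v w"
      unfolding w_def block_mat_vec mat_scalar_vec et using c(1) e(2) elim(3) by simp
    moreover have "- u \<in> int_vecs" using ints(1) by (simp add: int_vecs_def)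
    ultimately show ?case using ints(2) \<open>q \<noteq> 0\<close> by (intro bexI[of _ q] bexI[of _ "- u"]) auto
  qed
  then have "A \<in> Dirichlet_set (\<lambda>t. c * t powr (- (?n / ?m)))"
    unfolding Dirichlet_set_def r_def by simp
  then show ?thesis unfolding D_hat_def using c by auto
qed

lemma linear_less_power2: "\<exists>l>0. real l * K + 1 < 2 ^ l"
proof -
  obtain k :: nat where k: "K + 1 < 2 ^ k" using real_arch_pow[of 2 "K + 1"] by auto
  define l where "l = k + 1 + k"
  have "k + 1 \<le> 2 ^ k" by (induction k) auto
  then have "2 * k + 2 \<le> 2 ^ (k + 1)" by simp
  then have "l < 2 ^ (k + 1)" by (simp add: l_def)
  then have "real l < real (2 ^ (k + 1))" by (simp only: of_nat_less_iff)
  then have l2: "real l < 2 ^ (k + 1)" by simp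
  have l1: "1 \<le> real l" by (simp add: l_def)
  have "real l * K + 1 \<le> real l * (K + 1)" using l1 by (simp add: algebra_simps)
  also have "\<dots> \<le> real l * 2 ^ k" using k by (intro mult_left_mono) auto
  also have "\<dots> < 2 ^ (k + 1) * 2 ^ k" using l2 by (intro mult_strict_right_mono) auto
  also have "\<dots> = 2 ^ (k + 1 + k)" by (rule power_add[symmetric])
  also have "k + 1 + k = l" by (simp add: l_def)
  finally show ?thesis by (intro exI[of _ l]) (simp add: l_def)
qed

text \<open>
  A ball of radius \<open>\<rho>\<close> in the space of matrices is blown up to size \<open>\<kappa>\<close> at the time \<open>\<tau> \<rho>\<close>. For each of
  the \<open>n\<close> time intervals of length \<open>\<delta>\<close> following it, the matrices in the ball whose trajectory is
  nearly critical during that interval lie close to a single point.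
\<close>

lemma HAW_D_hat: "HAW (D_hat :: (real ^ 'n::finite ^ 'm::finite) set)"
  unfolding HAW_def
proof (intro allI impI, elim conjE)
  fix \<beta> :: real assume \<beta>: "0 < \<beta>" "\<beta> < 1 / 3"
  define c where "c = 1 / real CARD('m) + 1 / real CARD('n)"
  have c: "0 < c" by (simp add: c_def add_pos_pos)
  define r where "r = critical_radius TYPE('m + 'n)"
  have r: "0 < r" unfolding r_def by (rule critical_radius_pos)
  obtain \<delta> C where \<delta>: "0 < \<delta>" and C: "0 < C"
    and near: "\<And>\<epsilon> s \<sigma> (A :: real ^ 'n ^ 'm) A'. 0 \<le> \<epsilon> \<Longrightarrow> \<epsilon> < \<delta> \<Longrightarrow> \<bar>\<sigma>\<bar> \<le> \<delta> \<Longrightarrow>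
      exp (c * s) * norm (A' - A) \<le> \<delta> \<Longrightarrow>
      admissible (r - \<epsilon>) (flow s ** horo A) \<Longrightarrow> admissible (r - \<epsilon>) (flow (s + \<sigma>) ** horo A') \<Longrightarrow>
      exp (c * s) * norm (A' - A) \<le> C * \<epsilon>"
    using near_critical_times[where 'm = 'm and 'n = 'n] unfolding c_def r_def by metis
  \<comment> \<open>The flow makes up for the loss of radius in \<open>L\<close> turns, at most the
    factor \<open>\<beta> ^ L\<close>, within the time \<open>L * ln (1 / \<beta>) / c\<close>. Cut
    into intervals of length \<delta>, this gives a number \<open>n\<close> linear in
    \<open>L\<close>, against \<open>2 ^ L\<close>.\<close>
  obtain L where L: "0 < L" "real L * (ln (1 / \<beta>) / (c * \<delta>)) + 1 < 2 ^ L"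
    using linear_less_power2 by metis
  define n where "n = nat \<lceil>real L * (ln (1 / \<beta>) / (c * \<delta>))\<rceil>"
  have lnb: "0 < ln (1 / \<beta>)" using \<beta> by (intro ln_gt_zero) simp
  have "real n < real L * (ln (1 / \<beta>) / (c * \<delta>)) + 1"
    unfolding n_def using lnb c \<delta> by (simp add: ceiling_correct of_nat_nat) linarith
  then have "real n < 2 ^ L" using L(2) by linarith
  then have "real n < real (2 ^ L)" by (simp only: of_nat_power of_nat_numeral)
  then have n: "n < 2 ^ L" by (simp only: of_nat_less_iff)
  have nT: "real L * ln (1 / \<beta>) / c \<le> real n * \<delta>"
  proof -
    have "real L * (ln (1 / \<beta>) / (c * \<delta>)) \<le> real n" unfolding n_def by (rule real_nat_ceiling_ge)
    then show ?thesis using c \<delta> by (simp add: field_simps)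
  qed
  \<comment> \<open>Points of Bob's ball are at most \<open>2 * \<rho>\<close> apart. Magnified by
    \<open>\<kappa> / \<rho>\<close> up to the start of the block and by at most
    \<open>exp (c * (real n * \<delta>))\<close> during it, their distance stays within the range
    \<delta> of \<open>near\<close>.\<close>
  define \<kappa> where "\<kappa> = \<delta> / (2 * exp (c * (real n * \<delta>)))"
  have \<kappa>: "0 < \<kappa>" using \<delta> by (simp add: \<kappa>_def)
  define w where "w = \<beta> ^ Suc L / 2"
  have w: "0 < w" using \<beta> by (simp add: w_def)
  \<comment> \<open>The last bound gives \<open>C * \<epsilon> \<le> w * \<kappa>\<close>, so the
    nearly critical matrices of one interval fit into a ball of radius
    \<open>w * \<rho>\<close>.\<close>
  define \<epsilon> where "\<epsilon> = min (min (\<delta> / 2) (r / 2)) (w * \<kappa> / C)"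
  have \<epsilon>: "0 < \<epsilon>" "\<epsilon> < \<delta>" "\<epsilon> < r" "\<epsilon> \<le> w * \<kappa> / C"
    using \<delta> r w \<kappa> C by (auto simp: \<epsilon>_def min_less_iff_disj)
  have C\<epsilon>: "C * \<epsilon> \<le> w * \<kappa>" using \<epsilon>(4) C by (simp add: field_simps)
  define \<tau> where "\<tau> \<rho> = ln (\<kappa> / \<rho>) / c" for \<rho>
  have exp\<tau>: "exp (c * \<tau> \<rho>) = \<kappa> / \<rho>" if "0 < \<rho>" for \<rho> using that \<kappa> c by (simp add: \<tau>_def)
  define bad where "bad A s \<longleftrightarrow> admissible (r - \<epsilon>) (flow s ** horo A)" for A :: "real ^ 'n ^ 'm" and s
  define Q where "Q X \<rho> i A \<longleftrightarrow> A \<in> cball X \<rho> \<and> (\<exists>s. \<tau> \<rho> + real i * \<delta> \<le> s \<and> s \<le> \<tau> \<rho> + (real i + 1) * \<delta> \<and> bad A s)"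
    for X \<rho> i A
  \<comment> \<open>Any nearly critical matrix of the interval will do, since all others are close
    to it. If there is none, Alice avoids an arbitrary point.\<close>
  define P where "P X \<rho> i = (SOME A. Q X \<rho> i A)" for X \<rho> i
  show "HA_winning \<beta> (D_hat :: (real ^ 'n ^ 'm) set)"
  proof (rule HA_winning_median[where P = P, OF \<beta>(1) _ L(1) n w])
    show "\<beta> < 1" "w \<le> \<beta> ^ Suc L / 2" using \<beta> by (simp_all add: w_def)
    fix y :: "real ^ 'n ^ 'm" and X :: "nat \<Rightarrow> real ^ 'n ^ 'm" and R :: "nat \<Rightarrow> real"
    assume R: "\<And>b. 0 < R b" "\<And>b. \<beta> ^ L * R b \<le> R (Suc b)" "R \<longlonglongrightarrow> 0" and y: "\<And>b. y \<in> cball (X b) (R b)"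
      and far: "\<And>b i. i < n \<Longrightarrow> w * R b < dist y (P (X b) (R b) i)"
    have "\<not> bad y s" if s: "\<tau> (R 0) \<le> s" for s
    proof
      assume bad: "bad y s"
      have "\<forall>\<^sub>F b in sequentially. R b < \<kappa> * exp (- c * s)"
        using R(3) \<kappa> by (intro order_tendstoD) auto
      then obtain b' where "R b' < \<kappa> * exp (- c * s)" using eventually_happens'[OF sequentially_bot] by blast
      then have "exp (c * s) < \<kappa> / R b'" using R(1)[of b'] by (simp add: exp_minus field_simps)
      then have "c * s < c * \<tau> (R b')" unfolding exp\<tau>[OF R(1), symmetric] by simp
      then have ex: "s < \<tau> (R b')" using c by simp
      \<comment> \<open>Time \<open>s\<close> is assigned to the block before the first one that
        starts after \<open>s\<close>; its own start is then at most \<open>s\<close>.\<close>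
      define m where "m = (LEAST b. s < \<tau> (R b))"
      have m: "s < \<tau> (R m)" unfolding m_def using ex by (rule LeastI)
      have "m \<noteq> 0"
      proof
        assume "m = 0"
        then show False using m s by simp
      qed
      then obtain b where b: "m = Suc b" by (cases m) auto
      have sb: "\<tau> (R b) \<le> s" using not_less_Least[of b "\<lambda>b. s < \<tau> (R b)"] b by (simp add: m_def)
      have "\<tau> (R (Suc b)) - \<tau> (R b) \<le> real n * \<delta>"
      proof -
        have "\<tau> (R (Suc b)) - \<tau> (R b) = ln (R b / R (Suc b)) / c"
          unfolding \<tau>_def using \<kappa> R(1)[of b] R(1)[of "Suc b"] by (simp add: ln_div diff_divide_distrib[symmetric])
        also have "\<dots> \<le> ln ((1 / \<beta>) ^ L) / c"
        proof (intro divide_right_mono)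
          have "R b / R (Suc b) \<le> (1 / \<beta>) ^ L"
            using R(2)[of b] R(1)[of "Suc b"] \<beta> by (simp add: power_divide field_simps)
          then show "ln (R b / R (Suc b)) \<le> ln ((1 / \<beta>) ^ L)"
            using R(1)[of b] R(1)[of "Suc b"] \<beta> by (subst ln_le_cancel_iff) auto
        qed (use c in simp)
        also have "\<dots> = real L * ln (1 / \<beta>) / c" using \<beta> by (simp add: ln_realpow)
        finally show ?thesis using nT by linarith
      qed
      then have s_lt: "s - \<tau> (R b) < real n * \<delta>" using m b by simp
      define i where "i = nat \<lfloor>(s - \<tau> (R b)) / \<delta>\<rfloor>"
      have "0 \<le> (s - \<tau> (R b)) / \<delta>" using sb \<delta> by simp
      then have i: "real i \<le> (s - \<tau> (R b)) / \<delta>" "(s - \<tau> (R b)) / \<delta> < real i + 1"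
        unfolding i_def by (simp_all add: of_nat_floor)
      have "real i < real n"
      proof -
        have "(s - \<tau> (R b)) / \<delta> < real n" using s_lt \<delta> by (simp add: field_simps)
        then show ?thesis using i(1) by linarith
      qed
      then have "i < n" by simp
      have s_i: "\<tau> (R b) + real i * \<delta> \<le> s" "s \<le> \<tau> (R b) + (real i + 1) * \<delta>"
        using i \<delta> by (simp_all add: field_simps)
      have "Q (X b) (R b) i y" unfolding Q_def using y s_i bad by blast
      then have "Q (X b) (R b) i (P (X b) (R b) i)" unfolding P_def by (rule someI)
      then obtain s' where A: "P (X b) (R b) i \<in> cball (X b) (R b)"
        and s': "\<tau> (R b) + real i * \<delta> \<le> s'" "s' \<le> \<tau> (R b) + (real i + 1) * \<delta>" "bad (P (X b) (R b) i) s'"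
        unfolding Q_def by blast
      define A where "A = P (X b) (R b) i"
      have dist: "norm (y - A) \<le> 2 * R b"
      proof -
        have "dist y A \<le> dist y (X b) + dist (X b) A" by (rule dist_triangle)
        then show ?thesis using A y[of b] unfolding A_def[symmetric] by (simp add: dist_norm norm_minus_commute)
      qed
      have "exp (c * s') * norm (y - A) \<le> \<delta>"
      proof -
        have "(real i + 1) * \<delta> \<le> real n * \<delta>" using \<open>i < n\<close> \<delta> by (intro mult_right_mono) auto
        then have "c * s' \<le> c * (\<tau> (R b) + real n * \<delta>)" using s'(2) c by (intro mult_left_mono) auto
        then have "exp (c * s') \<le> exp (c * (\<tau> (R b) + real n * \<delta>))" by simp
        also have "\<dots> = \<kappa> / R b * exp (c * (real n * \<delta>))"
          by (simp add: distrib_left exp_add exp\<tau>[OF R(1)])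
        finally have "exp (c * s') * norm (y - A) \<le> \<kappa> / R b * exp (c * (real n * \<delta>)) * (2 * R b)"
          using dist \<kappa> R(1)[of b] by (intro mult_mono) auto
        also have "\<dots> = \<delta>" using R(1)[of b] by (simp add: \<kappa>_def)
        finally show ?thesis .
      qed
      moreover have "\<bar>s - s'\<bar> \<le> \<delta>" using s_i s'(1,2) by (simp add: algebra_simps abs_le_iff)
      moreover have "admissible (r - \<epsilon>) (flow (s' + (s - s')) ** horo y)" using bad by (simp add: bad_def)
      moreover have "admissible (r - \<epsilon>) (flow s' ** horo A)" using s'(3) by (simp add: bad_def A_def)
      ultimately have "exp (c * s') * norm (y - A) \<le> C * \<epsilon>"
        using near[of \<epsilon> "s - s'" s' y A] \<epsilon> by simp
      moreover have "\<kappa> / R b * norm (y - A) \<le> exp (c * s') * norm (y - A)"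
      proof (intro mult_right_mono)
        have "0 \<le> real i * \<delta>" using \<delta> by simp
        then have "c * \<tau> (R b) \<le> c * s'" using s'(1) c by (intro mult_left_mono) auto
        then show "\<kappa> / R b \<le> exp (c * s')" unfolding exp\<tau>[OF R(1), symmetric] by simp
      qed simp
      ultimately have "\<kappa> / R b * norm (y - A) \<le> w * \<kappa>" using C\<epsilon> by linarith
      then have "norm (y - A) \<le> w * R b" using \<kappa> R(1)[of b] by (simp add: field_simps)
      then show False using far[OF \<open>i < n\<close>, of b] by (simp add: A_def dist_norm)
    qed
    then have "\<forall>\<^sub>F s in at_top. \<not> admissible (r - \<epsilon>) (flow s ** horo y)"
      unfolding bad_def eventually_at_top_linorder by blast
    then show "y \<in> D_hat"
      using D_hat_if_not_near_critical[of \<epsilon> y] \<epsilon>(1,3) unfolding r_def by blast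
  qed
qed

theorem theorem3p7:
  shows "(\<exists>\<O> :: (real ^ ('m::finite + 'n::finite) ^ ('m + 'n)) set set set.
            finite \<O> \<and>
            (\<forall>Z\<in>\<O>. \<exists>x\<in>lat_space. Z = lat_orbit SO_real x) \<and>
            critical_locus \<subseteq> \<Union>\<O> \<and>
            (\<forall>Z\<in>\<O>. transversal F_group H_group Z)) \<and>
         HAW (D_hat :: (real ^ 'n ^ 'm) set)"
proof
  obtain \<G> :: "(real ^ ('m + 'n) ^ ('m + 'n)) set" where G: "finite \<G>" "\<And>G. G \<in> \<G> \<Longrightarrow> det G = 1"
    "critical_locus \<subseteq> (\<Union>G\<in>\<G>. lat_orbit SO_real (lat_coset G))"
    using critical_locus_subset_orbits[where 'd = "'m + 'n"] by metis
  let ?\<O> = "(\<lambda>G. lat_orbit SO_real (lat_coset G)) ` \<G>"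
  have "lat_coset G \<in> lat_space" if "G \<in> \<G>" for G
    using G(2)[OF that] by (auto simp: lat_space_def SL_real_def)
  then have "\<forall>Z\<in>?\<O>. \<exists>x\<in>lat_space. Z = lat_orbit SO_real x" by blast
  moreover have "\<forall>Z\<in>?\<O>. transversal F_group H_group Z" using transversal_orbit[OF G(2)] by blast
  ultimately show "\<exists>\<O> :: (real ^ ('m + 'n) ^ ('m + 'n)) set set set. finite \<O> \<and>
      (\<forall>Z\<in>\<O>. \<exists>x\<in>lat_space. Z = lat_orbit SO_real x) \<and> critical_locus \<subseteq> \<Union>\<O> \<and>
      (\<forall>Z\<in>\<O>. transversal F_group H_group Z)"
    using G(1,3) by (intro exI[of _ ?\<O>]) blast
  show "HAW (D_hat :: (real ^ 'n ^ 'm) set)" by (rule HAW_D_hat)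
qed

end
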